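(* Let $r\in\mathbb N$. For every $p\in[1,\infty)$, the mapping $\mathcal Q_p\times\mathcal U_{2r}\ni(q,U)\mapsto\mathfrak a_{q,U}\in\mathfrak A_p$, which sends $(q,U)$ to the spectral data of the operator $T_{q,U}$, is bijective, where $\mathfrak A_p:=\{\mathfrak a_{q,U}\mid q\in\mathcal Q_p,\ U\in\mathcal U_{2r}\}$.
   Context: Notation. $\mathcal M_k$ is the algebra of complex $k\times k$ matrices, $\mathcal U_k$ its unitary elements, $I=I_r$. $\mathcal Q_p:=L_p((-1,1),\mathcal M_r)$ (functions equal a.e. are identified). $W_1^1$ denotes absolutely continuous functions (with integrable derivative). All $2r\times 2r$ block matrices below have $r\times r$ blocks. Operators $T_{q,U}$. For $q\in\mathcal Q_p$ put $J:=\frac1i\begin{pmatrix}I&0\\0&-I\end{pmatrix}$, $Q:=\begin{pmatrix}0&q\\ q^*&0\end{pmatrix}$. In $\mathcal H:=L_2((-1,1),\mathbb C^{2r})$ the maximal operator is $T_qy=Jy'+Qy$ with domain $D(T_q)=\{y\in W_1^1((-1,1),\mathbb C^{2r})\mid Jy'+Qy\in\mathcal H\}$. Let $P_1:=\begin{pmatrix}I&0\\0&0\end{pmatrix}$, $P_2:=\begin{pmatrix}0&0\\0&I\end{pmatrix}$. For $U\in\mathcal U_{2r}$ let $A_U:=P_2+UP_1$, $B_U:=P_1+UP_2$, and let $T_{q,U}$ be the restriction of $T_q$ to $\{y\in D(T_q)\mid A_Uy(-1)+B_Uy(1)=0\}$; it is self-adjoint, and its spectrum consists of countably many isolated real eigenvalues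 of finite multiplicity accumulating only at $\pm\infty$. Spectral data. Let $\lambda_j(q,U)$, $j\in\mathbb Z$, be the pairwise distinct eigenvalues of $T_{q,U}$ in increasing order with $\lambda_0<0\le\lambda_1$. Let $Y_q(\cdot,\lambda)\in W_1^1((-1,1),\mathcal M_{2r})$ solve $JY'+QY=\lambda Y$, $Y(0,\lambda)=I_{2r}$. With $\lambda_j=\lambda_j(q,U)$ put $M_j:=\frac12\int_{-1}^1Y_q(t,\lambda_j)^*Y_q(t,\lambda_j)\,dt$ (this is positive definite), let $\Pi_j$ be the orthogonal projector of $\mathbb C^{2r}$ onto $\mathcal E_j:=\ker[A_UY_q(-1,\lambda_j)+B_UY_q(1,\lambda_j)]$, and $B_j:=(\Pi_jM_j\Pi_j)|_{\mathcal E_j}:\mathcal E_j\to\mathcal E_j$ (positive, invertible). The norming matrix is $A_j(q,U):=B_j^{-1}\Pi_j$, and the spectral data is $\mathfrak a_{q,U}:=((\lambda_j(q,U),A_j(q,U)))_{j\in\mathbb Z}$. *)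

theory Defs
  imports "HOL-Analysis.Analysis"
begin

text \<open>
  The size \<open>r\<close> is \<open>CARD('r)\<close> for a finite index type \<open>'r\<close>; vectors and matrices of size \<open>2r\<close> are
  indexed by \<open>'r + 'r\<close>, so that \<open>Inl\<close> and \<open>Inr\<close> address the two blocks.
\<close>

section \<open>Complex matrices\<close>

definition cscale :: "complex \<Rightarrow> complex^'n^'m \<Rightarrow> complex^'n^'m" where
  "cscale z A = (\<chi> i j. z * A $ i $ j)"

definition adj :: "complex^'n^'m \<Rightarrow> complex^'m^'n" where
  "adj A = (\<chi> i j. cnj (A $ j $ i))"

definition unitaries :: "(complex^'n^'n) set" where
  "unitaries = {U. adj U ** U = mat 1 \<and> U ** adj U = mat 1}"

definition block ::
  "complex^'r^'r \<Rightarrow> complex^'r^'r \<Rightarrow> complex^'r^'r \<Rightarrow> complex^'r^'r \<Rightarrow> complex^('r::finite + 'r)^('r + 'r)" where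
  "block A B C D = (\<chi> i j.
     case i of
       Inl a \<Rightarrow> (case j of Inl b \<Rightarrow> A $ a $ b | Inr b \<Rightarrow> B $ a $ b)
     | Inr a \<Rightarrow> (case j of Inl b \<Rightarrow> C $ a $ b | Inr b \<Rightarrow> D $ a $ b))"

definition mkernel :: "complex^'n^'m \<Rightarrow> (complex^'n) set" where
  "mkernel A = {v. A *v v = 0}"

definition orth_projector :: "(complex^'n) set \<Rightarrow> complex^'n^'n" where
  "orth_projector S = (THE P. P ** P = P \<and> adj P = P \<and> range ((*v) P) = S)"

section \<open>Function spaces on the interval \<open>(-1, 1)\<close>\<close>

abbreviation leb_I :: "real measure" where
  "leb_I \<equiv> lebesgue_on {-1<..<1}"

definition Lp_fun :: "real \<Rightarrow> (real \<Rightarrow> 'a::euclidean_space) set" where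
  "Lp_fun p = {f. f \<in> borel_measurable leb_I \<and> integrable leb_I (\<lambda>x. norm (f x) powr p)}"

definition ae_rel :: "real \<Rightarrow> ((real \<Rightarrow> 'a::euclidean_space) \<times> (real \<Rightarrow> 'a)) set" where
  "ae_rel p = {(f, g). f \<in> Lp_fun p \<and> g \<in> Lp_fun p \<and> (AE x in leb_I. f x = g x)}"

text \<open>The elements of \<open>Q_space p\<close> are classes of a.e. equal functions.\<close>

definition Q_space :: "real \<Rightarrow> (real \<Rightarrow> complex^'r^'r) set set" where
  "Q_space p = Lp_fun p // ae_rel p"

definition absolutely_continuous_fun :: "real \<Rightarrow> real \<Rightarrow> (real \<Rightarrow> 'a::euclidean_space) \<Rightarrow> bool" where
  "absolutely_continuous_fun a b f \<longleftrightarrow>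
     (\<forall>e>0. \<exists>d>0. \<forall>(n::nat) s t.
        (\<forall>k<n. a \<le> s k \<and> s k \<le> t k \<and> t k \<le> b) \<and>
        (\<forall>j<n. \<forall>k<n. j \<noteq> k \<longrightarrow> {s j<..<t j} \<inter> {s k<..<t k} = {}) \<and>
        (\<Sum>k<n. t k - s k) < d
        \<longrightarrow> (\<Sum>k<n. norm (f (t k) - f (s k))) < e)"

text \<open>
  A function in $W_1^1(-1,1)$ is taken together with its continuous extension to \<open>[-1, 1]\<close>; its
  values elsewhere are irrelevant. Such a function is differentiable almost everywhere, so
  statements about \<open>vector_derivative\<close> that hold a.e. are not affected by the values of
  \<open>vector_derivative\<close> at points of non-differentiability.
\<close>

definition W11 :: "(real \<Rightarrow> 'a::euclidean_space) set" where
  "W11 = {y. absolutely_continuous_fun (-1) 1 y \<and>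
             integrable leb_I (\<lambda>x. vector_derivative y (at x))}"

section \<open>The operators\<close>

definition J_mat :: "complex^('r::finite + 'r)^('r + 'r)" where
  "J_mat = cscale (1 / \<i>) (block (mat 1) 0 0 (- mat 1))"

definition Q_mat :: "(real \<Rightarrow> complex^'r^'r) \<Rightarrow> real \<Rightarrow> complex^('r::finite + 'r)^('r + 'r)" where
  "Q_mat q x = block 0 (q x) (adj (q x)) 0"

definition P1 :: "complex^('r::finite + 'r)^('r + 'r)" where
  "P1 = block (mat 1) 0 0 0"

definition P2 :: "complex^('r::finite + 'r)^('r + 'r)" where
  "P2 = block 0 0 0 (mat 1)"

definition A_bc :: "complex^('r::finite + 'r)^('r + 'r) \<Rightarrow> complex^('r::finite + 'r)^('r + 'r)" where
  "A_bc U = P2 + U ** P1"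

definition B_bc :: "complex^('r::finite + 'r)^('r + 'r) \<Rightarrow> complex^('r::finite + 'r)^('r + 'r)" where
  "B_bc U = P1 + U ** P2"

definition dirac_expr ::
  "(real \<Rightarrow> complex^'r^'r) \<Rightarrow> (real \<Rightarrow> complex^('r::finite + 'r)) \<Rightarrow> real \<Rightarrow> complex^('r::finite + 'r)" where
  "dirac_expr q y x = J_mat *v vector_derivative y (at x) + Q_mat q x *v y x"

definition T_max_dom :: "(real \<Rightarrow> complex^'r^'r) \<Rightarrow> (real \<Rightarrow> complex^('r::finite + 'r)) set" where
  "T_max_dom q = {y \<in> W11. dirac_expr q y \<in> Lp_fun 2}"

definition T_dom ::
  "(real \<Rightarrow> complex^'r^'r) \<Rightarrow> complex^('r::finite + 'r)^('r + 'r) \<Rightarrow> (real \<Rightarrow> complex^('r::finite + 'r)) set" where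
  "T_dom q U = {y \<in> T_max_dom q. A_bc U *v y (-1) + B_bc U *v y 1 = 0}"

text \<open>Equality in $L_2$ is equality a.e.\<close>

definition T_eigenvalues ::
  "(real \<Rightarrow> complex^'r^'r) \<Rightarrow> complex^('r::finite + 'r)^('r + 'r) \<Rightarrow> complex set" where
  "T_eigenvalues q U = {z. \<exists>y \<in> T_dom q U.
     \<not> (AE x in leb_I. y x = 0) \<and> (AE x in leb_I. dirac_expr q y x = z *s y x)}"

section \<open>Spectral data\<close>

definition eigenvalue_seq ::
  "(real \<Rightarrow> complex^'r^'r) \<Rightarrow> complex^('r::finite + 'r)^('r + 'r) \<Rightarrow> int \<Rightarrow> real" where
  "eigenvalue_seq q U = (THE l. strict_mono l \<and>
     range (\<lambda>j. complex_of_real (l j)) = T_eigenvalues q U \<and> l 0 < 0 \<and> 0 \<le> l 1)"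

definition is_fund_solution ::
  "(real \<Rightarrow> complex^'r^'r) \<Rightarrow> complex \<Rightarrow> (real \<Rightarrow> complex^('r::finite + 'r)^('r + 'r)) \<Rightarrow> bool" where
  "is_fund_solution q z Y \<longleftrightarrow> Y \<in> W11 \<and> Y 0 = mat 1 \<and>
     (AE x in leb_I. J_mat ** vector_derivative Y (at x) + Q_mat q x ** Y x = cscale z (Y x))"

text \<open>The solution is unique on \<open>[-1, 1]\<close>, and only its values there are used.\<close>

definition fund_solution ::
  "(real \<Rightarrow> complex^'r^'r) \<Rightarrow> complex \<Rightarrow> real \<Rightarrow> complex^('r::finite + 'r)^('r + 'r)" where
  "fund_solution q z = (SOME Y. is_fund_solution q z Y)"

definition M_mat :: "(real \<Rightarrow> complex^'r^'r) \<Rightarrow> complex \<Rightarrow> complex^('r::finite + 'r)^('r + 'r)" where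
  "M_mat q z = (1 / 2) *\<^sub>R
     integral {-1..1} (\<lambda>t. adj (fund_solution q z t) ** fund_solution q z t)"

definition E_space ::
  "(real \<Rightarrow> complex^'r^'r) \<Rightarrow> complex^('r::finite + 'r)^('r + 'r) \<Rightarrow> complex \<Rightarrow> (complex^('r::finite + 'r)) set" where
  "E_space q U z =
     mkernel (A_bc U ** fund_solution q z (-1) + B_bc U ** fund_solution q z 1)"

definition Pi_mat ::
  "(real \<Rightarrow> complex^'r^'r) \<Rightarrow> complex^('r::finite + 'r)^('r + 'r) \<Rightarrow> complex \<Rightarrow> complex^('r::finite + 'r)^('r + 'r)" where
  "Pi_mat q U z = orth_projector (E_space q U z)"

definition B_op ::
  "(real \<Rightarrow> complex^'r^'r) \<Rightarrow> complex^('r::finite + 'r)^('r + 'r) \<Rightarrow> complex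
     \<Rightarrow> complex^('r::finite + 'r) \<Rightarrow> complex^('r::finite + 'r)" where
  "B_op q U z v = (Pi_mat q U z ** M_mat q z ** Pi_mat q U z) *v v"

text \<open>
  \<open>B_op q U z\<close> is invertible only as a map of \<open>E_space q U z\<close> onto itself, whence \<open>inv_into\<close>.
\<close>

definition norming_mat ::
  "(real \<Rightarrow> complex^'r^'r) \<Rightarrow> complex^('r::finite + 'r)^('r + 'r) \<Rightarrow> complex \<Rightarrow> complex^('r::finite + 'r)^('r + 'r)" where
  "norming_mat q U z =
     matrix (\<lambda>v. inv_into (E_space q U z) (B_op q U z) (Pi_mat q U z *v v))"

definition spectral_data_fun ::
  "(real \<Rightarrow> complex^'r^'r) \<Rightarrow> complex^('r::finite + 'r)^('r + 'r)
     \<Rightarrow> int \<Rightarrow> real \<times> (complex^('r::finite + 'r)^('r + 'r))" where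
  "spectral_data_fun q U j =
     (eigenvalue_seq q U j, norming_mat q U (complex_of_real (eigenvalue_seq q U j)))"

text \<open>
  Everything above depends on the class of \<open>q\<close> only (lemma \<open>spectral_data_class\<close> below), so the
  image of a class is a singleton and its element is the spectral data of the class.
\<close>

definition spectral_data ::
  "(real \<Rightarrow> complex^'r^'r) set \<Rightarrow> complex^('r::finite + 'r)^('r + 'r)
     \<Rightarrow> int \<Rightarrow> real \<times> (complex^('r::finite + 'r)^('r + 'r))" where
  "spectral_data c U = the_elem ((\<lambda>q. spectral_data_fun q U) ` c)"

definition spectral_data_set ::
  "real \<Rightarrow> (int \<Rightarrow> real \<times> (complex^('r::finite + 'r)^('r + 'r))) set" where
  "spectral_data_set p = {spectral_data c U | c U. c \<in> Q_space p \<and> U \<in> unitaries}"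

section \<open>Independence of the representative\<close>

lemma equiv_ae_rel: "equiv (Lp_fun p :: (real \<Rightarrow> 'a::euclidean_space) set) (ae_rel p)" (is "equiv ?L ?R")
proof (rule equivI)
  show "?R \<subseteq> ?L \<times> ?L" by (auto simp: ae_rel_def)
  show "refl_on (?L) (?R)" by (auto simp: refl_on_def ae_rel_def)
  show "sym (?R)"
  proof (rule symI)
    fix f g :: "real \<Rightarrow> 'a"
    assume fg: "(f, g) \<in> ?R"
    then have "AE x in leb_I. f x = g x" by (simp add: ae_rel_def)
    then have "AE x in leb_I. g x = f x" by eventually_elim simp
    then show "(g, f) \<in> ?R" using fg by (simp add: ae_rel_def)
  qed
  show "trans (?R)"
  proof (rule transI)
    fix f g h :: "real \<Rightarrow> 'a"
    assume fg: "(f, g) \<in> ?R" and gh: "(g, h) \<in> ?R"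
    have "AE x in leb_I. f x = g x" "AE x in leb_I. g x = h x"
      using fg gh by (auto simp: ae_rel_def)
    then have "AE x in leb_I. f x = h x" by eventually_elim simp
    then show "(f, h) \<in> ?R" using fg gh by (auto simp: ae_rel_def)
  qed
qed

lemma AE_iff_cong:
  assumes "AE x in M. P x \<longleftrightarrow> Q x"
  shows "(AE x in M. P x) \<longleftrightarrow> (AE x in M. Q x)"
proof
  assume "AE x in M. P x" with assms show "AE x in M. Q x" by eventually_elim simp
next
  assume "AE x in M. Q x" with assms show "AE x in M. P x" by eventually_elim simp
qed

lemma borel_measurable_leb_I_cong_AE:
  fixes f g :: "real \<Rightarrow> 'a::euclidean_space"
  assumes f: "f \<in> borel_measurable leb_I" and ae: "AE x in leb_I. f x = g x"
  shows "g \<in> borel_measurable leb_I"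
proof (rule measurableI)
  from ae obtain N where N: "N \<in> null_sets leb_I" and
    eq: "\<And>x. x \<in> space leb_I - N \<Longrightarrow> f x = g x"
    by (rule AE_E3) blast
  have Nl: "N \<in> null_sets lebesgue"
    using N by (subst (asm) null_sets_restrict_space) auto
  fix B :: "'a set" assume B: "B \<in> sets borel"
  have 1: "(f -` B \<inter> space leb_I) - N \<in> sets leb_I"
    by (intro sets.Diff measurable_sets[OF f B] null_setsD2[OF N])
  have "(g -` B \<inter> space leb_I) \<inter> N \<in> null_sets lebesgue"
    by (rule null_sets_completion_subset[OF _ Nl]) auto
  then have 2: "(g -` B \<inter> space leb_I) \<inter> N \<in> sets leb_I"
    by (subst sets_restrict_space_iff) auto
  have "g -` B \<inter> space leb_I
      = ((f -` B \<inter> space leb_I) - N) \<union> ((g -` B \<inter> space leb_I) \<inter> N)"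
    using eq by auto
  also have "\<dots> \<in> sets leb_I" using 1 2 by (rule sets.Un)
  finally show "g -` B \<inter> space leb_I \<in> sets leb_I" .
qed auto

lemma Lp_fun_cong_AE:
  fixes f g :: "real \<Rightarrow> 'a::euclidean_space"
  assumes f: "f \<in> Lp_fun p" and ae: "AE x in leb_I. f x = g x"
  shows "g \<in> Lp_fun p"
proof -
  have g: "g \<in> borel_measurable leb_I"
    using f by (intro borel_measurable_leb_I_cong_AE[OF _ ae]) (simp add: Lp_fun_def)
  have ae_p: "AE x in leb_I. norm (f x) powr p = norm (g x) powr p"
    using ae by eventually_elim simp
  have meas: "(\<lambda>x. norm (g x) powr p) \<in> borel_measurable leb_I"
    using g by (intro powr_real_measurable) auto
  have "integrable leb_I (\<lambda>x. norm (f x) powr p)"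
    using f by (simp add: Lp_fun_def)
  then have "integrable leb_I (\<lambda>x. norm (g x) powr p)"
    using meas ae_p by (rule integrable_cong_AE_imp)
  with g show ?thesis by (simp add: Lp_fun_def)
qed

lemma T_dom_cong:
  assumes "AE x in leb_I. q x = q' x"
  shows "T_dom q U = T_dom q' U"
proof -
  have eq: "AE x in leb_I. dirac_expr q y x = dirac_expr q' y x" for y
    using assms by eventually_elim (simp add: dirac_expr_def Q_mat_def)
  have eq': "AE x in leb_I. dirac_expr q' y x = dirac_expr q y x" for y
    using assms by eventually_elim (simp add: dirac_expr_def Q_mat_def)
  have "dirac_expr q y \<in> Lp_fun 2 \<longleftrightarrow> dirac_expr q' y \<in> Lp_fun 2" for y
    using Lp_fun_cong_AE[OF _ eq] Lp_fun_cong_AE[OF _ eq'] by (rule iffI)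
  then show ?thesis by (simp add: T_dom_def T_max_dom_def)
qed

lemma T_eigenvalues_cong:
  assumes "AE x in leb_I. q x = q' x"
  shows "T_eigenvalues q U = T_eigenvalues q' U"
proof -
  have "(AE x in leb_I. dirac_expr q y x = z *s y x)
      \<longleftrightarrow> (AE x in leb_I. dirac_expr q' y x = z *s y x)" for y z
    by (rule AE_iff_cong)
      (use assms in eventually_elim, simp add: dirac_expr_def Q_mat_def)
  then show ?thesis by (simp add: T_eigenvalues_def T_dom_cong[OF assms])
qed

lemma fund_solution_cong:
  fixes q q' :: "real \<Rightarrow> complex^'r::finite^'r"
  assumes "AE x in leb_I. q x = q' x"
  shows "fund_solution q z = fund_solution q' z"
proof -
  have "(AE x in leb_I. J_mat ** vector_derivative Y (at x) + Q_mat q x ** Y x = cscale z (Y x))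
      \<longleftrightarrow> (AE x in leb_I. J_mat ** vector_derivative Y (at x) + Q_mat q' x ** Y x = cscale z (Y x))"
    for Y :: "real \<Rightarrow> complex^('r + 'r)^('r + 'r)"
    by (rule AE_iff_cong) (use assms in eventually_elim, simp add: Q_mat_def)
  then show ?thesis by (simp only: fund_solution_def is_fund_solution_def)
qed

lemma spectral_data_fun_cong:
  assumes "AE x in leb_I. q x = q' x"
  shows "spectral_data_fun q U = spectral_data_fun q' U"
proof -
  have "eigenvalue_seq q U = eigenvalue_seq q' U"
    by (simp add: eigenvalue_seq_def T_eigenvalues_cong[OF assms])
  moreover have "E_space q U = E_space q' U"
    by (rule ext) (simp add: E_space_def fund_solution_cong[OF assms])
  moreover have "M_mat q = M_mat q'"
    by (rule ext) (simp add: M_mat_def fund_solution_cong[OF assms])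
  ultimately have "norming_mat q U = norming_mat q' U"
    by (intro ext) (simp add: norming_mat_def B_op_def[abs_def] Pi_mat_def)
  then show ?thesis
    using \<open>eigenvalue_seq q U = eigenvalue_seq q' U\<close> by (simp add: spectral_data_fun_def fun_eq_iff)
qed

lemma spectral_data_class:
  assumes "q \<in> Lp_fun p"
  shows "spectral_data (ae_rel p `` {q}) U = spectral_data_fun q U"
proof -
  have "q \<in> ae_rel p `` {q}" using assms by (auto simp: ae_rel_def)
  moreover have "spectral_data_fun q' U = spectral_data_fun q U" if "q' \<in> ae_rel p `` {q}" for q'
  proof -
    have "AE x in leb_I. q x = q' x" using that by (simp add: ae_rel_def)
    then show ?thesis by (rule spectral_data_fun_cong[symmetric])
  qed
  ultimately have "(\<lambda>q. spectral_data_fun q U) ` (ae_rel p `` {q}) = {spectral_data_fun q U}"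
    by blast
  then show ?thesis by (simp add: spectral_data_def)
qed

end

theory Submission
  imports Defs "HOL-Complex_Analysis.Complex_Analysis"
begin

text \<open>
  Surjectivity holds because the target is the range of the map. The content is that the eigenvalues
  and the norming matrices of the operator determine \<open>q\<close> almost everywhere and \<open>U\<close>.

  Write \<open>\<sigma>\<close> for the matrix \<open>sg\<close>, with diagonal blocks \<open>I\<close> and \<open>-I\<close>. The equation \<open>J Y' + Q Y = z Y\<close> reads
  \<open>Y' = (\<i> z \<sigma> + W) Y\<close>, where \<open>W = - \<i> \<sigma> Q\<close> is hermitian and anticommutes with \<open>\<sigma>\<close>. Therefore
  \<open>(Y(x,w)\<^sup>* \<sigma> Y(x,z))' = \<i> (z - cnj w) Y(x,w)\<^sup>* Y(x,z)\<close>, and this Lagrange identity is the source of almost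
  everything: of the inverse \<open>\<sigma> Y(x, cnj z)\<^sup>* \<sigma>\<close> of \<open>Y(x,z)\<close>, of uniqueness, of the holomorphic dependence on
  \<open>z\<close>, and of the reality of the eigenvalues, which are the zeros of the determinant of
  \<open>\<Delta>(z) = A\<^sub>U Y(-1,z) + B\<^sub>U Y(1,z)\<close>.

  The uniqueness proof follows Borg and Marchenko. Cut the interval at \<open>0\<close> and admit a jump there: for
  a non-real \<open>z\<close> there is exactly one matrix \<open>m(z)\<close> such that \<open>\<Psi>(x,z) = Y(x,z) (m(z) + \<sigma>)\<close> for \<open>x > 0\<close> and
  \<open>\<Psi>(x,z) = Y(x,z) (m(z) - \<sigma>)\<close> for \<open>x < 0\<close> satisfies the boundary condition. This Weyl matrix is
  meromorphic, its poles are simple and lie at the eigenvalues, and its residue at an eigenvalue is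
  \<open>\<i>\<close> times the norming matrix (\<open>weyl_residue\<close>). Hence, if two operators have the same spectral data,
  then \<open>m\<^sub>1 - m\<^sub>2\<close> extends to an entire function. For large \<open>z\<close> the matrix \<open>\<Delta>(z)\<close> is close to the free one,
  \<open>e\<^bsup>\<i>z\<^esup> + U e\<^bsup>-\<i>z\<^esup>\<close>, whose inverse is of size \<open>e\<^bsup>-|Im z|\<^esup>\<close> away from the real axis and on suitable
  vertical lines; so \<open>m\<^sub>1 - m\<^sub>2\<close> is bounded there, constant by the maximum principle and Liouville's
  theorem, and zero because both functions tend to \<open>1\<close> along the positive imaginary axis.

  Now that \<open>m\<^sub>1 = m\<^sub>2\<close>, the entire function \<open>Y\<^sub>1(x,z) Y\<^sub>2(x,z)\<^sup>-\<^sup>1\<close> is bounded in \<open>z\<close>: for \<open>x > 0\<close> twice it equals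
  \<open>(\<Psi>\<^sub>1(x,z) Y\<^sub>2(x, cnj z)\<^sup>* + Y\<^sub>1(x,z) \<Psi>\<^sub>2(x, cnj z)\<^sup>*) \<sigma>\<close>, as the Weyl matrices cancel because of
  \<open>m(cnj z)\<^sup>* = - m(z)\<close>; and the decay \<open>e\<^bsup>-|Im z| |x|\<^esup>\<close> of \<open>\<Psi>\<close> compensates the growth of \<open>Y\<close>. A negative \<open>x\<close>
  is treated in the same way. The function is therefore constant in \<open>z\<close>, and it is \<open>1\<close> because
  both factors approach the free solution as \<open>z\<close> tends to infinity on the real axis. So \<open>Y\<^sub>1 = Y\<^sub>2\<close>,
  the differential equation returns \<open>q\<close>, and the boundary values of the common Weyl solution return
  \<open>U\<close> (\<open>spectral_data_determine\<close>).

  Two things have to be provided before. The potential is merely integrable, so the solutions are only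
  absolutely continuous in the sense of the \<open>\<epsilon>\<close>-\<open>\<delta>\<close> definition, and Lebesgue's theorem is needed: such a function has
  a derivative almost everywhere and is its integral (\<open>absolutely_continuous_imp_primitive\<close> and
  \<open>integral_has_vector_derivative_AE\<close>). Moreover the enumeration of the eigenvalues by the integers makes
  sense only if they are discrete and unbounded in both directions; the latter follows from Hurwitz's
  theorem, since the translates \<open>\<Delta>(z + 2\<pi>k)\<close> converge to the free matrix (\<open>char_mat_zero_shifted\<close>).
\<close>

section \<open>Absolutely continuous functions\<close>

text \<open>
  The members of a family of nonoverlapping intervals are required to be nondegenerate. Then different
  members are different as pairs of end points, and families can be cut and united as sets of pairs.
\<close>

definition cells :: "real \<Rightarrow> real \<Rightarrow> (real \<times> real) set \<Rightarrow> bool" where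
  "cells a b D \<longleftrightarrow> finite D \<and> (\<forall>p\<in>D. a \<le> fst p \<and> fst p < snd p \<and> snd p \<le> b) \<and>
     (\<forall>p\<in>D. \<forall>p'\<in>D. p \<noteq> p' \<longrightarrow> {fst p<..<snd p} \<inter> {fst p'<..<snd p'} = {})"

definition total_length :: "(real \<times> real) set \<Rightarrow> real" where
  "total_length D = (\<Sum>p\<in>D. snd p - fst p)"

definition variation_over :: "(real \<Rightarrow> 'a::real_normed_vector) \<Rightarrow> (real \<times> real) set \<Rightarrow> real" where
  "variation_over y D = (\<Sum>p\<in>D. norm (y (snd p) - y (fst p)))"

lemma absolutely_continuous_fun_cells:
  "absolutely_continuous_fun a b y \<longleftrightarrow>
     (\<forall>e>0. \<exists>d>0. \<forall>D. cells a b D \<and> total_length D < d \<longrightarrow> variation_over y D < e)" (is "?L \<longleftrightarrow> ?R")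
proof
  assume L: ?L
  show ?R
  proof (intro allI impI)
    fix e :: real assume "e > 0"
    then obtain d where d: "d > 0" "\<And>(n::nat) s t.
        (\<forall>k<n. a \<le> s k \<and> s k \<le> t k \<and> t k \<le> b) \<and>
        (\<forall>j<n. \<forall>k<n. j \<noteq> k \<longrightarrow> {s j<..<t j} \<inter> {s k<..<t k} = {}) \<and>
        (\<Sum>k<n. t k - s k) < d
        \<Longrightarrow> (\<Sum>k<n. norm (y (t k) - y (s k))) < e"
      using L unfolding absolutely_continuous_fun_def by meson
    have "variation_over y D < e" if D: "cells a b D" "total_length D < d" for D
    proof -
      from D(1) have fin: "finite D" by (simp add: cells_def)
      then obtain h where h: "bij_betw h {..<card D} D"
        using ex_bij_betw_nat_finite[of D] by (auto simp: atLeast0LessThan)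
      have hD: "h k \<in> D" if "k < card D" for k using h that by (auto simp: bij_betw_def)
      have inj: "h j \<noteq> h k" if "j < card D" "k < card D" "j \<noteq> k" for j k
        using h that by (auto simp: bij_betw_def inj_on_def)
      have "(\<Sum>k<card D. norm (y (snd (h k)) - y (fst (h k)))) < e"
      proof (rule d(2)[of "card D" "\<lambda>k. fst (h k)" "\<lambda>k. snd (h k)"], intro conjI allI impI)
        show "(\<Sum>k<card D. snd (h k) - fst (h k)) < d"
          using D(2) sum.reindex_bij_betw[OF h, of "\<lambda>p. snd p - fst p"] by (simp add: total_length_def)
      qed (use D(1) hD inj in \<open>auto simp: cells_def less_imp_le\<close>)
      then show ?thesis
        using sum.reindex_bij_betw[OF h, of "\<lambda>p. norm (y (snd p) - y (fst p))"]
        by (simp add: variation_over_def)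
    qed
    with d(1) show "\<exists>d>0. \<forall>D. cells a b D \<and> total_length D < d \<longrightarrow> variation_over y D < e" by blast
  qed
next
  assume R: ?R
  show ?L unfolding absolutely_continuous_fun_def
  proof (intro allI impI)
    fix e :: real assume "e > 0"
    with R obtain d where d: "d > 0" "\<And>D. cells a b D \<Longrightarrow> total_length D < d \<Longrightarrow> variation_over y D < e"
      by meson
    have "(\<Sum>k<n. norm (y (t k) - y (s k))) < e"
      if st: "\<forall>k<n. a \<le> s k \<and> s k \<le> t k \<and> t k \<le> b"
        "\<forall>j<n. \<forall>k<n. j \<noteq> k \<longrightarrow> {s j<..<t j} \<inter> {s k<..<t k} = {}"
        "(\<Sum>k<n. t k - s k) < d" for n :: nat and s t
    proof -
      define K where "K = {k. k < n \<and> s k < t k}"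
      define D where "D = (\<lambda>k. (s k, t k)) ` K"
      have inj: "inj_on (\<lambda>k. (s k, t k)) K"
      proof (rule inj_onI)
        fix j k assume jk: "j \<in> K" "k \<in> K" "(s j, t j) = (s k, t k)"
        have "{s k<..<t k} \<noteq> {}" using jk by (simp add: K_def)
        moreover have "j \<noteq> k \<Longrightarrow> {s j<..<t j} \<inter> {s k<..<t k} = {}" using st(2) jk(1,2) unfolding K_def by blast
        ultimately show "j = k" using jk(3) by auto
      qed
      have c: "cells a b D" using st(1,2) by (auto simp: cells_def D_def K_def)
      have eq: "(\<Sum>k<n. f (s k) (t k)) = (\<Sum>p\<in>D. f (fst p) (snd p))" if "\<And>x. f x x = 0" for f :: "real \<Rightarrow> real \<Rightarrow> real"
      proof -
        have "(\<Sum>p\<in>D. f (fst p) (snd p)) = (\<Sum>k\<in>K. f (s k) (t k))"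
          unfolding D_def by (subst sum.reindex[OF inj]) simp
        also have "\<dots> = (\<Sum>k<n. f (s k) (t k))"
        proof (rule sum.mono_neutral_left)
          show "\<forall>i\<in>{..<n} - K. f (s i) (t i) = 0"
          proof
            fix i assume "i \<in> {..<n} - K"
            then have "s i = t i" using st(1) by (force simp: K_def)
            then show "f (s i) (t i) = 0" using that by simp
          qed
        qed (auto simp: K_def)
        finally show ?thesis by simp
      qed
      have "total_length D < d" using st(3) eq[of "\<lambda>x y. y - x"] by (simp add: total_length_def)
      from d(2)[OF c this] show ?thesis using eq[of "\<lambda>x x'. norm (y x' - y x)"] by (simp add: variation_over_def)
    qed
    with d(1) show "\<exists>d>0. \<forall>(n::nat) s t.
        (\<forall>k<n. a \<le> s k \<and> s k \<le> t k \<and> t k \<le> b) \<and>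
        (\<forall>j<n. \<forall>k<n. j \<noteq> k \<longrightarrow> {s j<..<t j} \<inter> {s k<..<t k} = {}) \<and>
        (\<Sum>k<n. t k - s k) < d
        \<longrightarrow> (\<Sum>k<n. norm (y (t k) - y (s k))) < e" by blast
  qed
qed

lemma total_length_le:
  assumes D: "cells a b D" and ab: "a \<le> b"
  shows "total_length D \<le> b - a"
proof -
  have fm: "{s<..<t} \<in> fmeasurable lborel" if "s < t" for s t :: real
    using that by (intro fmeasurableI) auto
  have "total_length D = (\<Sum>p\<in>D. measure lborel {fst p<..<snd p})"
    unfolding total_length_def using D by (intro sum.cong) (auto simp: cells_def)
  also have "\<dots> = measure lborel (\<Union>p\<in>D. {fst p<..<snd p})"
    using D by (intro measure_UNION'[symmetric]) (auto simp: cells_def pairwise_def disjnt_def fm)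
  also have "\<dots> \<le> measure lborel {a..b}"
    using D fmeasurable_cbox[of a b] by (intro measure_mono_fmeasurable) (auto simp: cells_def)
  finally show ?thesis using ab by simp
qed

text \<open>
  The triangle inequality shows that cutting the cells at \<open>c\<close> does not decrease the variation. This is
  what makes the variation additive over adjacent intervals.
\<close>

lemma cells_split:
  assumes D: "cells a e D"
  obtains D1 D2 where "cells a c D1" "cells c e D2"
    "variation_over y D \<le> variation_over y D1 + variation_over y D2"
proof -
  define L where "L = {p\<in>D. fst p < c}"
  define R where "R = {p\<in>D. c < snd p}"
  define f where "f = (\<lambda>p::real\<times>real. (fst p, min (snd p) c))"
  define g where "g = (\<lambda>p::real\<times>real. (max (fst p) c, snd p))"
  have fin: "finite D" using D by (simp add: cells_def)
  have dj: "{fst p<..<snd p} \<inter> {fst p'<..<snd p'} = {}" if "p\<in>D" "p'\<in>D" "p \<noteq> p'" for p p'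
    using D that by (auto simp: cells_def)
  have pos: "fst p < snd p" "a \<le> fst p" "snd p \<le> e" if "p \<in> D" for p using D that by (auto simp: cells_def)
  have injf: "inj_on f L"
  proof (rule inj_onI, rule ccontr)
    fix p p' assume p: "p \<in> L" "p' \<in> L" "f p = f p'" "p \<noteq> p'"
    have "{fst p<..<snd p} \<inter> {fst p'<..<snd p'} = {}" using p dj by (auto simp: L_def)
    moreover have "{fst p<..<min (snd p) c} \<subseteq> {fst p<..<snd p} \<inter> {fst p'<..<snd p'}"
      using p(3) by (auto simp: f_def)
    moreover have "fst p < min (snd p) c" using p pos by (auto simp: L_def)
    ultimately show False by (metis dense greaterThanLessThan_iff subset_empty empty_iff)
  qed
  have injg: "inj_on g R"
  proof (rule inj_onI, rule ccontr)
    fix p p' assume p: "p \<in> R" "p' \<in> R" "g p = g p'" "p \<noteq> p'"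
    have "{fst p<..<snd p} \<inter> {fst p'<..<snd p'} = {}" using p dj by (auto simp: R_def)
    moreover have "{max (fst p) c<..<snd p} \<subseteq> {fst p<..<snd p} \<inter> {fst p'<..<snd p'}"
      using p(3) by (auto simp: g_def)
    moreover have "max (fst p) c < snd p" using p pos by (auto simp: R_def)
    ultimately show False by (metis dense greaterThanLessThan_iff subset_empty empty_iff)
  qed
  have 1: "cells a c (f ` L)"
    unfolding cells_def
  proof (intro conjI ballI impI)
    fix q q' assume "q \<in> f ` L" "q' \<in> f ` L" "q \<noteq> q'"
    then obtain p p' where p: "p\<in>L" "p'\<in>L" "q = f p" "q' = f p'" "p \<noteq> p'" by auto
    then have "{fst p<..<snd p} \<inter> {fst p'<..<snd p'} = {}" using dj by (auto simp: L_def)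
    then show "{fst q<..<snd q} \<inter> {fst q'<..<snd q'} = {}" unfolding p f_def by fastforce
  qed (use fin pos in \<open>auto simp: L_def f_def\<close>)
  have 2: "cells c e (g ` R)"
    unfolding cells_def
  proof (intro conjI ballI impI)
    fix q q' assume "q \<in> g ` R" "q' \<in> g ` R" "q \<noteq> q'"
    then obtain p p' where p: "p\<in>R" "p'\<in>R" "q = g p" "q' = g p'" "p \<noteq> p'" by auto
    then have "{fst p<..<snd p} \<inter> {fst p'<..<snd p'} = {}" using dj by (auto simp: R_def)
    then show "{fst q<..<snd q} \<inter> {fst q'<..<snd q'} = {}" unfolding p g_def by fastforce
  qed (use fin pos in \<open>auto simp: R_def g_def\<close>)
  have v1: "variation_over y (f ` L) = (\<Sum>p\<in>D. if fst p < c then norm (y (min (snd p) c) - y (fst p)) else 0)"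
    unfolding variation_over_def
    by (subst sum.reindex[OF injf]) (simp add: L_def f_def sum.inter_filter[OF fin] flip: if_distrib)
  have v2: "variation_over y (g ` R) = (\<Sum>p\<in>D. if c < snd p then norm (y (snd p) - y (max (fst p) c)) else 0)"
    unfolding variation_over_def
    by (subst sum.reindex[OF injg]) (simp add: R_def g_def sum.inter_filter[OF fin] flip: if_distrib)
  have "variation_over y D \<le> variation_over y (f ` L) + variation_over y (g ` R)"
    unfolding v1 v2 sum.distrib[symmetric]
    unfolding variation_over_def
  proof (rule sum_mono)
    fix p assume "p \<in> D"
    then have lt: "fst p < snd p" using pos by simp
    show "norm (y (snd p) - y (fst p)) \<le> (if fst p < c then norm (y (min (snd p) c) - y (fst p)) else 0) +
         (if c < snd p then norm (y (snd p) - y (max (fst p) c)) else 0)"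
      using lt norm_triangle_ineq[of "y c - y (fst p)" "y (snd p) - y c"]
      by (auto simp: min_def max_def)
  qed
  with 1 2 that show thesis by blast
qed

text \<open>
  Every cell of a family may be refined by a family of its own; the increments of the variation
  function of \<open>y\<close> are compared with the variation of \<open>y\<close> over such a refinement.
\<close>

lemma cells_Union:
  assumes K: "cells a b K" and D: "\<And>k. k \<in> K \<Longrightarrow> cells (fst k) (snd k) (D k)"
  shows "cells a b (\<Union>k\<in>K. D k)" "total_length (\<Union>k\<in>K. D k) \<le> total_length K"
    "variation_over y (\<Union>k\<in>K. D k) = (\<Sum>k\<in>K. variation_over y (D k))"
proof -
  have finK: "finite K" using K by (simp add: cells_def)
  have finD: "\<forall>k\<in>K. finite (D k)" using D by (simp add: cells_def)
  have in_k: "fst k \<le> fst p" "snd p \<le> snd k" "fst p < snd p" if "k \<in> K" "p \<in> D k" for k p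
    using D[OF that(1)] that(2) by (auto simp: cells_def)
  have kk: "{fst k<..<snd k} \<inter> {fst k'<..<snd k'} = {}" if "k\<in>K" "k'\<in>K" "k \<noteq> k'" for k k'
    using K that by (auto simp: cells_def)
  have dj: "{fst p<..<snd p} \<inter> {fst p'<..<snd p'} = {}"
    if "k\<in>K" "k'\<in>K" "k \<noteq> k'" "p \<in> D k" "p' \<in> D k'" for k k' p p'
  proof -
    have "{fst p<..<snd p} \<subseteq> {fst k<..<snd k}" "{fst p'<..<snd p'} \<subseteq> {fst k'<..<snd k'}"
      using in_k[OF that(1) that(4)] in_k[OF that(2) that(5)] by auto
    then show ?thesis using kk[OF that(1,2,3)] by blast
  qed
  have disj: "\<forall>k\<in>K. \<forall>k'\<in>K. k \<noteq> k' \<longrightarrow> D k \<inter> D k' = {}"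
  proof (intro ballI impI)
    fix k k' assume kk': "k\<in>K" "k'\<in>K" "k \<noteq> k'"
    show "D k \<inter> D k' = {}"
    proof (rule ccontr)
      assume "D k \<inter> D k' \<noteq> {}"
      then obtain p where p: "p \<in> D k" "p \<in> D k'" by blast
      have "{fst p<..<snd p} = {}" using dj[OF kk' p] by simp
      then show False using in_k(3)[OF kk'(1) p(1)] by (simp add: not_less)
    qed
  qed
  have Kb: "a \<le> fst k" "snd k \<le> b" "fst k \<le> snd k" if "k \<in> K" for k using K that by (auto simp: cells_def)
  show "cells a b (\<Union>k\<in>K. D k)"
    unfolding cells_def
  proof (intro conjI ballI impI)
    fix p p' assume "p \<in> (\<Union>k\<in>K. D k)" "p' \<in> (\<Union>k\<in>K. D k)" and ne: "p \<noteq> p'"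
    then obtain k k' where k: "k\<in>K" "k'\<in>K" "p \<in> D k" "p' \<in> D k'" by blast
    show "{fst p<..<snd p} \<inter> {fst p'<..<snd p'} = {}"
    proof (cases "k = k'")
      case True then show ?thesis using D[OF k(1)] k ne by (auto simp: cells_def)
    qed (use dj k in blast)
  qed (use finK finD in_k Kb in \<open>fastforce+\<close>)
  have "total_length (\<Union>k\<in>K. D k) = (\<Sum>k\<in>K. total_length (D k))"
    unfolding total_length_def by (rule sum.UNION_disjoint[OF finK finD disj])
  also have "\<dots> \<le> (\<Sum>k\<in>K. snd k - fst k)"
    by (intro sum_mono total_length_le D Kb)
  finally show "total_length (\<Union>k\<in>K. D k) \<le> total_length K" by (simp add: total_length_def)
  show "variation_over y (\<Union>k\<in>K. D k) = (\<Sum>k\<in>K. variation_over y (D k))"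
    unfolding variation_over_def by (rule sum.UNION_disjoint[OF finK finD disj])
qed

text \<open>
  The variation is at most \<open>1\<close> over an interval shorter than the \<open>\<delta>\<close> that belongs to \<open>\<epsilon> = 1\<close>, and finitely
  many such intervals cover \<open>[a, b]\<close>.
\<close>

lemma absolutely_continuous_imp_bounded_variation:
  assumes ac: "absolutely_continuous_fun a b y"
  obtains B where "\<And>D. cells a b D \<Longrightarrow> variation_over y D \<le> B"
proof -
  obtain d where d: "d > 0" "\<And>D. cells a b D \<Longrightarrow> total_length D < d \<Longrightarrow> variation_over y D < 1"
    using ac unfolding absolutely_continuous_fun_cells by (meson zero_less_one)
  have bound: "variation_over y D \<le> real n"
    if "cells a x D" "x \<le> b" "x \<le> a + real n * (d/2)" for n x D
    using that
  proof (induction n arbitrary: x D)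
    case 0
    then have "D = {}" by (force simp: cells_def)
    then show ?case by (simp add: variation_over_def)
  next
    case (Suc n)
    define c where "c = max a (x - d/2)"
    obtain D1 D2 where D: "cells a c D1" "cells c x D2"
      "variation_over y D \<le> variation_over y D1 + variation_over y D2"
      using cells_split[OF Suc.prems(1), of c y] by metis
    show ?case
    proof (cases "x \<le> a")
      case True
      then have "D = {}" using Suc.prems(1) by (force simp: cells_def)
      then show ?thesis by (simp add: variation_over_def)
    next
      case False
      then have cx: "c < x" "c \<le> b" "a \<le> c" using d Suc.prems by (auto simp: c_def)
      have "0 \<le> real n * (d/2)" using d by simp
      then have "variation_over y D1 \<le> real n"
        using Suc.prems d cx(2) by (intro Suc.IH[OF D(1)]) (auto simp: c_def max_def field_simps)
      moreover have "cells a b D2" using D(2) cx Suc.prems by (auto simp: cells_def)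
      moreover have "total_length D2 < d"
        using total_length_le[OF D(2)] cx d by (auto simp: c_def)
      ultimately show ?thesis using d(2) D(3) by fastforce
    qed
  qed
  obtain n :: nat where "(b - a) / (d/2) \<le> real n" using real_arch_simple by blast
  then have "b \<le> a + real n * (d/2)" using d by (simp add: field_simps)
  then show thesis using bound[of b _ n] that by blast
qed

text \<open>
  \<open>v x\<close> is the variation of \<open>y\<close> over \<open>[a, x]\<close>. It is absolutely continuous because its increment over a cell
  is, up to an arbitrarily small error, the variation of \<open>y\<close> over a family inside this cell, and the
  union of these families is again short.
\<close>

lemma jordan_decomposition:
  fixes y :: "real \<Rightarrow> real"
  assumes ac: "absolutely_continuous_fun a b y"
  obtains v where "absolutely_continuous_fun a b v" "mono_on {a..b} v" "mono_on {a..b} (\<lambda>x. v x - y x)"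
proof -
  obtain B where B: "\<And>D. cells a b D \<Longrightarrow> variation_over y D \<le> B"
    using absolutely_continuous_imp_bounded_variation[OF ac] by blast
  define S where "S x = variation_over y ` {D. cells a x D}" for x
  define v where "v x = Sup (S x)" for x
  have ne: "S x \<noteq> {}" for x by (auto simp: S_def cells_def intro: exI[of _ "{}"])
  have mono: "cells s t D \<Longrightarrow> s' \<le> s \<Longrightarrow> t \<le> t' \<Longrightarrow> cells s' t' D" for s t s' t' D
    by (fastforce simp: cells_def)
  have bdd: "bdd_above (S x)" if "x \<le> b" for x
    using B mono[OF _ order.refl that] by (auto simp: S_def intro!: bdd_aboveI)
  have i: "v s + \<bar>y t - y s\<bar> \<le> v t" if st: "a \<le> s" "s \<le> t" "t \<le> b" for s t
  proof (cases "s = t")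
    case False
    then have "s < t" using st by simp
    have "v s \<le> v t - \<bar>y t - y s\<bar>"
      unfolding v_def
    proof (rule cSup_least[OF ne])
      fix r assume "r \<in> S s"
      then obtain D where D: "cells a s D" "r = variation_over y D" by (auto simp: S_def)
      have nin: "(s,t) \<notin> D" using D \<open>s<t\<close> by (fastforce simp: cells_def)
      have "cells a t (insert (s,t) D)" using D(1) \<open>s < t\<close> st by (fastforce simp: cells_def)
      then have "variation_over y (insert (s,t) D) \<le> Sup (S t)"
        by (intro cSup_upper bdd st) (auto simp: S_def)
      then show "r \<le> Sup (S t) - \<bar>y t - y s\<bar>"
        using D nin by (simp add: variation_over_def cells_def)
    qed
    then show ?thesis by simp
  qed simp
  have ii: "\<exists>D. cells s t D \<and> v t - v s \<le> variation_over y D + h"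
    if st: "a \<le> s" "s \<le> t" "t \<le> b" and h: "h > 0" for s t h
  proof -
    obtain r where r: "r \<in> S t" "v t - h < r"
      using less_cSup_iff[OF ne bdd[OF st(3)], of "v t - h"] h by (auto simp: v_def)
    then obtain D where D: "cells a t D" "r = variation_over y D" by (auto simp: S_def)
    obtain D1 D2 where D12: "cells a s D1" "cells s t D2"
      "variation_over y D \<le> variation_over y D1 + variation_over y D2"
      using cells_split[OF D(1), of s y] by metis
    have "variation_over y D1 \<le> v s"
      unfolding v_def by (intro cSup_upper bdd) (use D12 st in \<open>auto simp: S_def\<close>)
    then show ?thesis using D12 r D by (intro exI[of _ D2]) auto
  qed
  have m: "mono_on {a..b} v" using i by (fastforce simp: mono_on_def)
  have "absolutely_continuous_fun a b v"
    unfolding absolutely_continuous_fun_cells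
  proof (intro allI impI)
    fix e :: real assume e: "e > 0"
    obtain d where d: "d > 0" "\<And>D. cells a b D \<Longrightarrow> total_length D < d \<Longrightarrow> variation_over y D < e/2"
      using ac e unfolding absolutely_continuous_fun_cells by (meson half_gt_zero)
    have "variation_over v K < e" if K: "cells a b K" "total_length K < d" for K
    proof -
      define h where "h = e / (2 * (real (card K) + 1))"
      have h: "h > 0" using e by (simp add: h_def add_nonneg_pos)
      have Kb: "a \<le> fst k" "snd k \<le> b" "fst k \<le> snd k" if "k \<in> K" for k using K that by (auto simp: cells_def)
      have "\<forall>k\<in>K. \<exists>D. cells (fst k) (snd k) D \<and> v (snd k) - v (fst k) \<le> variation_over y D + h"
        using ii Kb h by blast
      then obtain D where D: "\<And>k. k\<in>K \<Longrightarrow> cells (fst k) (snd k) (D k)"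
        "\<And>k. k\<in>K \<Longrightarrow> v (snd k) - v (fst k) \<le> variation_over y (D k) + h" by metis
      note U = cells_Union[OF K(1) D(1)]
      have "variation_over v K = (\<Sum>k\<in>K. v (snd k) - v (fst k))"
        unfolding variation_over_def real_norm_def
        using Kb m by (intro sum.cong refl abs_of_nonneg) (fastforce simp: mono_on_def)
      also have "\<dots> \<le> (\<Sum>k\<in>K. variation_over y (D k) + h)" by (intro sum_mono D(2))
      also have "\<dots> = variation_over y (\<Union>k\<in>K. D k) + card K * h"
        by (simp add: sum.distrib U(3))
      also have "\<dots> < e/2 + e/2"
      proof (intro add_less_le_mono)
        show "variation_over y (\<Union>k\<in>K. D k) < e / 2" using U K by (intro d(2)) auto
        have "real (card K) / (real (card K) + 1) \<le> 1" by simp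
        then have "e/2 * (real (card K) / (real (card K) + 1)) \<le> e/2 * 1" using e by (intro mult_left_mono) auto
        then show "real (card K) * h \<le> e/2" by (simp add: h_def field_simps)
      qed
      finally show ?thesis by simp
    qed
    with d(1) show "\<exists>d>0. \<forall>D. cells a b D \<and> total_length D < d \<longrightarrow> variation_over v D < e" by blast
  qed
  moreover have "mono_on {a..b} (\<lambda>x. v x - y x)"
  proof (rule mono_onI)
    fix s t assume "s \<in> {a..b}" "t \<in> {a..b}" "s \<le> t"
    then show "v s - y s \<le> v t - y t" using i[of s t] by auto
  qed
  ultimately show thesis using m that by blast
qed


lemma absolutely_continuous_imp_continuous_on:
  assumes ac: "absolutely_continuous_fun a b y"
  shows "continuous_on {a..b} y"
  unfolding continuous_on_iff
proof (intro ballI allI impI)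
  fix x e :: real assume x: "x \<in> {a..b}" and e: "e > 0"
  obtain d where d: "d > 0" "\<And>D. cells a b D \<Longrightarrow> total_length D < d \<Longrightarrow> variation_over y D < e"
    using ac e unfolding absolutely_continuous_fun_cells by meson
  have "dist (y x') (y x) < e" if x': "x' \<in> {a..b}" "dist x' x < d" for x'
  proof (cases "x' = x")
    case False
    then have "variation_over y {(min x x', max x x')} < e"
      using x x' by (intro d(2)) (auto simp: cells_def total_length_def dist_real_def min_def max_def abs_if split: if_splits)
    then show ?thesis by (auto simp: variation_over_def dist_norm min_def max_def norm_minus_commute split: if_splits)
  qed (use e in simp)
  with d(1) show "\<exists>d>0. \<forall>x'\<in>{a..b}. dist x' x < d \<longrightarrow> dist (y x') (y x) < e" by blast
qed

text \<open>
  A null set is contained in open sets \<open>U\<close> of small Lebesgue measure. The set \<open>U\<close> is exhausted from inside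
  by finite unions of cells of a fine grid, and over these the increments of \<open>g\<close> are small by absolute
  continuity. The function \<open>G\<close> extends \<open>g\<close> by constants to the real line.
\<close>

lemma null_sets_interval_measure:
  fixes g :: "real \<Rightarrow> real"
  assumes ac: "absolutely_continuous_fun a b g" and m: "mono_on {a..b} g" and ab: "a < b"
  defines "G \<equiv> \<lambda>x. g (max a (min b x))"
  shows "absolutely_continuous lborel (interval_measure G)"
proof -
  define c where "c x = max a (min b x)" for x
  have G: "G x = g (c x)" for x by (simp add: G_def c_def)
  have cab: "c x \<in> {a..b}" for x using ab by (auto simp: c_def)
  have cm: "c x \<le> c z" if "x \<le> z" for x z using that by (auto simp: c_def)
  have monoG: "\<And>x z. x \<le> z \<Longrightarrow> G x \<le> G z"
    unfolding G using m cab cm by (simp add: mono_on_def)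
  have "continuous_on UNIV G"
    unfolding G
    by (rule continuous_on_compose2[OF absolutely_continuous_imp_continuous_on[OF ac], of UNIV c])
       (use cab in \<open>auto simp: c_def intro!: continuous_intros\<close>)
  then have rc: "\<And>x. continuous (at_right x) G"
    by (meson UNIV_I continuous_on_eq_continuous_within continuous_within_subset subset_UNIV)
  note em = emeasure_interval_measure_Ioc[OF _ monoG rc]
  let ?\<mu> = "interval_measure G"
  have "emeasure ?\<mu> N = 0" if N: "N \<in> null_sets lborel" for N
  proof -
    have "emeasure ?\<mu> N \<le> 0 + ennreal e" if e: "e > 0" for e :: real
    proof -
      obtain d where d: "d > 0" "\<And>D. cells a b D \<Longrightarrow> total_length D < d \<Longrightarrow> variation_over g D < e"
        using ac e unfolding absolutely_continuous_fun_cells by meson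
      obtain U where U: "open U" "N \<subseteq> U" "emeasure lborel (U - N) < ennreal d"
        using outer_regular_lborel[of N d] N d(1) by (auto simp: null_sets_def)
      have Ud: "emeasure lborel U < ennreal d"
      proof -
        have "emeasure lborel U \<le> emeasure lborel (U - N) + emeasure lborel N"
          using emeasure_subadditive[of "U - N" lborel N] U N
          by (auto simp: null_sets_def Un_absorb2)
        then show ?thesis using U(3) N by (simp add: null_sets_def)
      qed
      \<comment> \<open>the grid cells of width \<open>1 / Suc n\<close> that meet \<open>V n\<close> are contained in \<open>U\<close>\<close>
      define V where "V n = {x\<in>U. \<bar>x\<bar> \<le> real n \<and> ball x (2 / real (Suc n)) \<subseteq> U}" for n
      have Vmeas: "V n \<in> sets borel" for n
      proof -
        have "V n = {- real n..real n} \<inter> (- (\<Union>z\<in>-U. ball z (2 / real (Suc n))))"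
          unfolding V_def using dist_self[where 'a=real] by (fastforce simp: subset_iff dist_commute abs_le_iff)
        moreover have "closed (- (\<Union>z\<in>-U. ball z (2 / real (Suc n))))"
          by (intro closed_Compl open_UN) auto
        ultimately show ?thesis
          by (metis borel_closed closed_Int closed_atLeastAtMost)
      qed
      have "incseq V"
      proof (rule incseq_SucI)
        fix n show "V n \<subseteq> V (Suc n)"
        proof
          fix x assume x: "x \<in> V n"
          have "2 / real (Suc (Suc n)) \<le> 2 / real (Suc n)" by (simp add: field_simps)
          then have "ball x (2 / real (Suc (Suc n))) \<subseteq> ball x (2 / real (Suc n))" by (rule subset_ball)
          with x show "x \<in> V (Suc n)" unfolding V_def by auto
        qed
      qed
      moreover have "(\<Union>n. V n) = U"
      proof (intro subset_antisym subsetI)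
        fix x assume x: "x \<in> U"
        then obtain r where r: "r > 0" "ball x r \<subseteq> U" using U(1) open_contains_ball by blast
        obtain n1 :: nat where n1: "\<bar>x\<bar> \<le> real n1" using real_arch_simple by blast
        obtain n2 :: nat where n2: "2 / r \<le> real n2" using real_arch_simple by blast
        have "2 / real (Suc (max n1 n2)) \<le> r"
        proof -
          have "2 \<le> real n2 * r" using n2 r by (simp add: field_simps)
          also have "\<dots> \<le> real (Suc (max n1 n2)) * r" using r by (intro mult_right_mono) auto
          finally show ?thesis using r by (simp add: field_simps)
        qed
        then have "ball x (2 / real (Suc (max n1 n2))) \<subseteq> U" using subset_ball r by blast
        then have "x \<in> V (max n1 n2)" using n1 x by (simp add: V_def)
        then show "x \<in> (\<Union>n. V n)" by blast
      qed (auto simp: V_def)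
      ultimately have SUP: "(SUP n. emeasure ?\<mu> (V n)) = emeasure ?\<mu> U"
        using SUP_emeasure_incseq[of V ?\<mu>] Vmeas by auto
      have Vn: "emeasure ?\<mu> (V n) \<le> ennreal e" for n
      proof -
        define h where "h = 1 / real (Suc n)"
        have h: "h > 0" "2 * h = 2 / real (Suc n)" by (auto simp: h_def)
        define C where "C k = {real_of_int k * h<..real_of_int (k+1) * h}" for k
        define M where "M = int (n * Suc n) + 1"
        have M: "real_of_int M = real (n * Suc n) + 1" by (simp add: M_def)
        define S where "S = {k\<in>{-M..M}. C k \<subseteq> U}"
        have finS: "finite S" unfolding S_def by (rule finite_subset[of _ "{-M..M}"]) auto
        have "V n \<subseteq> (\<Union>k\<in>S. C k)"
        proof
          fix x assume x: "x \<in> V n"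
          define k where "k = \<lceil>x / h\<rceil> - 1"
          have k: "real_of_int k < x / h" "x / h \<le> real_of_int k + 1" unfolding k_def by linarith+
          then have xk: "real_of_int k * h < x" "x \<le> (real_of_int k + 1) * h"
            using h by (auto simp: field_simps)
          have "C k \<subseteq> ball x (2*h)"
            using xk h(1) by (auto simp: C_def dist_real_def abs_if algebra_simps)
          then have CU: "C k \<subseteq> U" using x h by (auto simp: V_def)
          have "\<bar>x\<bar> \<le> real n" using x by (simp add: V_def)
          then have "\<bar>x\<bar> * real (Suc n) \<le> real n * real (Suc n)" by (intro mult_right_mono) auto
          moreover have "x / h = x * real (Suc n)" by (simp add: h_def)
          ultimately have "\<bar>x / h\<bar> \<le> real (n * Suc n)" by (simp only: abs_mult abs_of_nat of_nat_mult)
          then have "- real_of_int M \<le> real_of_int k" "real_of_int k \<le> real_of_int M"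
            using k M unfolding abs_le_iff by linarith+
          then have "k \<in> {-M..M}" by (metis atLeastAtMost_iff of_int_le_iff of_int_minus)
          with CU have "k \<in> S" by (simp add: S_def)
          moreover have "x \<in> C k" using xk by (simp add: C_def)
          ultimately show "x \<in> (\<Union>k\<in>S. C k)" by blast
        qed
        then have "emeasure ?\<mu> (V n) \<le> emeasure ?\<mu> (\<Union>k\<in>S. C k)"
          by (intro emeasure_mono) (use finS in \<open>auto simp: C_def\<close>)
        also have "\<dots> \<le> (\<Sum>k\<in>S. emeasure ?\<mu> (C k))"
          by (intro emeasure_subadditive_finite finS) (auto simp: C_def)
        also have "\<dots> = (\<Sum>k\<in>S. ennreal (G (real_of_int (k+1) * h) - G (real_of_int k * h)))"
          unfolding C_def using h(1) by (intro sum.cong em) (auto intro!: mult_right_mono)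
        also have "\<dots> = ennreal (\<Sum>k\<in>S. G (real_of_int (k+1) * h) - G (real_of_int k * h))"
          using h(1) by (intro sum_ennreal) (auto intro!: monoG mult_right_mono)
        also have "(\<Sum>k\<in>S. G (real_of_int (k+1) * h) - G (real_of_int k * h)) < e"
        proof -
          define l where "l k = c (real_of_int k * h)" for k
          define u where "u k = c (real_of_int (k+1) * h)" for k
          define S' where "S' = {k\<in>S. l k < u k}"
          define D where "D = (\<lambda>k. (l k, u k)) ` S'"
          have lu: "l k \<le> u k" for k unfolding l_def u_def using h by (intro cm) (auto intro!: mult_right_mono)
          have ul: "u j \<le> l k" if "j < k" for j k
            unfolding l_def u_def using h that by (intro cm mult_right_mono) auto
          have dj: "{l j<..<u j} \<inter> {l k<..<u k} = {}" if "j \<noteq> k" for j k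
          proof (cases "j < k")
            case True then show ?thesis using ul[of j k] by auto
          next
            case False then show ?thesis using ul[of k j] that by auto
          qed
          have inj: "inj_on (\<lambda>k. (l k, u k)) S'"
          proof (rule inj_onI, rule ccontr)
            fix j k assume jk: "j \<in> S'" "k \<in> S'" "(l j, u j) = (l k, u k)" "j \<noteq> k"
            then have "{l k<..<u k} = {}" using dj[of j k] by simp
            then show False using jk by (simp add: S'_def)
          qed
          have cells: "cells a b D"
            unfolding cells_def
          proof (intro conjI ballI impI)
            show "finite D" using finS by (simp add: D_def S'_def)
            fix p p' assume "p \<in> D" "p' \<in> D" "p \<noteq> p'"
            then obtain j k where jk: "p = (l j, u j)" "p' = (l k, u k)" "j \<noteq> k" by (auto simp: D_def)
            show "{fst p<..<snd p} \<inter> {fst p'<..<snd p'} = {}"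
              unfolding jk(1,2) fst_conv snd_conv by (rule dj[OF jk(3)])
          qed (use cab in \<open>auto simp: D_def S'_def l_def u_def\<close>)
          have "ennreal (total_length D) < ennreal d"
          proof -
            have "total_length D = (\<Sum>k\<in>S'. u k - l k)"
              unfolding total_length_def D_def by (subst sum.reindex[OF inj]) simp
            also have "\<dots> \<le> (\<Sum>k\<in>S'. h)"
            proof (rule sum_mono)
              fix k
              have "c x' - c x \<le> x' - x" if "x \<le> x'" for x x' using that by (auto simp: c_def)
              from this[of "real_of_int k * h" "real_of_int (k+1) * h"] show "u k - l k \<le> h"
                using h(1) by (simp add: l_def u_def distrib_right)
            qed
            also have "\<dots> \<le> (\<Sum>k\<in>S. h)" using h finS by (intro sum_mono2) (auto simp: S'_def)
            finally have "ennreal (total_length D) \<le> ennreal (\<Sum>k\<in>S. h)" by (rule ennreal_leI)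
            also have "\<dots> = (\<Sum>k\<in>S. ennreal h)" using h by (intro sum_ennreal[symmetric]) auto
            also have "\<dots> = (\<Sum>k\<in>S. emeasure lborel (C k))"
              using h by (intro sum.cong refl) (simp add: C_def algebra_simps)
            also have "\<dots> = emeasure lborel (\<Union>k\<in>S. C k)"
            proof (rule sum_emeasure)
              show "disjoint_family_on C S"
                unfolding disjoint_family_on_def
              proof (intro ballI impI)
                fix j k :: int assume "j \<noteq> k"
                have *: "C j \<inter> C k = {}" if "j < k" for j k
                proof -
                  have "real_of_int (j+1) * h \<le> real_of_int k * h" using that h by (intro mult_right_mono) auto
                  then show ?thesis by (auto simp: C_def)
                qed
                show "C j \<inter> C k = {}" using *[of j k] *[of k j] \<open>j \<noteq> k\<close> by (cases "j < k") auto
              qed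
            qed (use finS in \<open>auto simp: C_def\<close>)
            also have "\<dots> \<le> emeasure lborel U" using U(1) by (intro emeasure_mono) (auto simp: S_def)
            finally show ?thesis using Ud by simp
          qed
          then have "variation_over g D < e" by (intro d(2) cells) (metis ennreal_leI not_less)
          moreover have "variation_over g D = (\<Sum>k\<in>S'. g (u k) - g (l k))"
            unfolding variation_over_def D_def
            by (subst sum.reindex[OF inj], rule sum.cong)
               (use m cab lu in \<open>auto simp: mono_on_def l_def u_def intro!: abs_of_nonneg\<close>)
          moreover have "\<dots> = (\<Sum>k\<in>S. g (u k) - g (l k))"
          proof (rule sum.mono_neutral_left[OF finS])
            show "\<forall>k\<in>S - S'. g (u k) - g (l k) = 0"
            proof
              fix k assume "k \<in> S - S'"
              then have "u k = l k" using lu[of k] by (auto simp: S'_def)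
              then show "g (u k) - g (l k) = 0" by simp
            qed
          qed (auto simp: S'_def)
          ultimately show ?thesis by (simp add: G l_def u_def)
        qed
        then have "ennreal (\<Sum>k\<in>S. G (real_of_int (k+1) * h) - G (real_of_int k * h)) \<le> ennreal e"
          by (intro ennreal_leI) simp
        finally show ?thesis by simp
      qed
      have "emeasure ?\<mu> N \<le> emeasure ?\<mu> U" using U by (intro emeasure_mono) auto
      also have "\<dots> \<le> ennreal e" unfolding SUP[symmetric] using Vn by (intro SUP_least) auto
      finally show ?thesis by simp
    qed
    then show ?thesis using ennreal_le_epsilon[of 0 "emeasure ?\<mu> N"] by simp
  qed
  then show ?thesis unfolding absolutely_continuous_def null_sets_def by auto
qed

text \<open>
  The integrand is the Radon-Nikodym derivative of the Stieltjes measure of \<open>g\<close>.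
\<close>

lemma mono_absolutely_continuous_primitive:
  fixes g :: "real \<Rightarrow> real"
  assumes ac: "absolutely_continuous_fun a b g" and m: "mono_on {a..b} g" and ab: "a < b"
  obtains f where "f absolutely_integrable_on {a..b}"
    "\<And>x. x \<in> {a..b} \<Longrightarrow> (f has_integral (g x - g a)) {a..x}"
proof -
  define c where "c x = max a (min b x)" for x
  define G where "G \<equiv> \<lambda>x. g (max a (min b x))"
  have Gc: "G x = g (c x)" for x by (simp add: G_def c_def)
  have cab: "c x \<in> {a..b}" for x using ab by (auto simp: c_def)
  have cm: "c x \<le> c z" if "x \<le> z" for x z using that by (auto simp: c_def)
  have monoG: "\<And>x z. x \<le> z \<Longrightarrow> G x \<le> G z"
    unfolding Gc using m cab cm by (simp add: mono_on_def)
  have "continuous_on UNIV G"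
    unfolding Gc
    by (rule continuous_on_compose2[OF absolutely_continuous_imp_continuous_on[OF ac], of UNIV c])
       (use cab in \<open>auto simp: c_def intro!: continuous_intros\<close>)
  then have rc: "\<And>x. continuous (at_right x) G"
    by (meson UNIV_I continuous_on_eq_continuous_within continuous_within_subset subset_UNIV)
  note em = emeasure_interval_measure_Ioc[OF _ monoG rc]
  let ?\<mu> = "interval_measure G"
  obtain f where f: "f \<in> borel_measurable lborel" "density lborel f = ?\<mu>"
    using sigma_finite_measure.Radon_Nikodym[OF sigma_finite_lborel null_sets_interval_measure[OF ac m ab, folded G_def]] by auto
  have [measurable]: "f \<in> borel_measurable borel" using f(1) by simp
  have Gx: "G x = g x" if "x \<in> {a..b}" for x using that by (auto simp: G_def)
  have nn: "(\<integral>\<^sup>+t. f t * indicator {a<..x} t \<partial>lborel) = ennreal (g x - g a)" if x: "x \<in> {a..b}" for x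
  proof -
    have "(\<integral>\<^sup>+t. f t * indicator {a<..x} t \<partial>lborel) = emeasure (density lborel f) {a<..x}"
      by (subst emeasure_density) auto
    also have "\<dots> = ennreal (G x - G a)" unfolding f(2) using x by (intro em) auto
    finally show ?thesis using Gx x by auto
  qed
  have fin: "AE t in lborel. f t * indicator {a<..b} t \<noteq> \<infinity>"
    by (rule nn_integral_PInf_AE) (use nn[of b] ab in auto)
  define f' where "f' t = enn2real (f t) * indicator {a<..b} t" for t
  have [measurable]: "f' \<in> borel_measurable borel" unfolding f'_def by measurable
  have hi: "(f' has_integral (g x - g a)) {a..x}" if x: "x \<in> {a..b}" for x
  proof -
    have "(\<integral>\<^sup>+t. ennreal (f' t * indicator {a..x} t) \<partial>lborel) = (\<integral>\<^sup>+t. f t * indicator {a<..x} t \<partial>lborel)"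
    proof (rule nn_integral_cong_AE)
      show "AE t in lborel. ennreal (f' t * indicator {a..x} t) = f t * indicator {a<..x} t"
        using fin by eventually_elim (use x in \<open>auto simp: f'_def indicator_def less_top\<close>)
    qed
    then have *: "(\<integral>\<^sup>+t. ennreal (f' t * indicator {a..x} t) \<partial>lborel) = ennreal (g x - g a)" using nn[OF x] by simp
    have "((\<lambda>t. f' t * indicator {a..x} t) has_integral (g x - g a)) UNIV"
      using nn_integral_has_integral[OF _ _ *] m x ab by (auto simp: mono_on_def f'_def indicator_def)
    moreover have "(\<lambda>t. f' t * indicator {a..x} t) = (\<lambda>t. if t \<in> {a..x} then f' t else 0)" by (auto simp: indicator_def)
    ultimately show ?thesis by (simp only: has_integral_restrict_UNIV)
  qed
  have "f' absolutely_integrable_on {a..b}"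
    by (rule nonnegative_absolutely_integrable_1) (use hi[of b] ab in \<open>auto simp: f'_def\<close>)
  with hi that show thesis by blast
qed

lemma absolutely_continuous_funE:
  assumes "absolutely_continuous_fun a b y" "e > 0"
  obtains d where "d > 0" "\<And>D. cells a b D \<Longrightarrow> total_length D < d \<Longrightarrow> variation_over y D < e"
  using assms unfolding absolutely_continuous_fun_cells by meson

text \<open>
  One criterion that covers sums, products and the images under linear and Lipschitz maps.
\<close>

lemma absolutely_continuous_fun_dominated:
  assumes y: "absolutely_continuous_fun a b y" and z: "absolutely_continuous_fun a b z"
    and le: "\<And>s t. s \<in> {a..b} \<Longrightarrow> t \<in> {a..b} \<Longrightarrow> norm (u t - u s) \<le> C * (norm (y t - y s) + norm (z t - z s))"
  shows "absolutely_continuous_fun a b u"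
  unfolding absolutely_continuous_fun_cells
proof (intro allI impI)
  fix e :: real assume e: "e > 0"
  define c where "c = \<bar>C\<bar> + 1"
  have c: "c > 0" "C \<le> c" by (auto simp: c_def)
  have ec: "e / (2*c) > 0" using e c by simp
  obtain d1 where d1: "d1 > 0" "\<And>D. cells a b D \<Longrightarrow> total_length D < d1 \<Longrightarrow> variation_over y D < e / (2*c)"
    using absolutely_continuous_funE[OF y ec] by blast
  obtain d2 where d2: "d2 > 0" "\<And>D. cells a b D \<Longrightarrow> total_length D < d2 \<Longrightarrow> variation_over z D < e / (2*c)"
    using absolutely_continuous_funE[OF z ec] by blast
  have "variation_over u D < e" if D: "cells a b D" "total_length D < min d1 d2" for D
  proof -
    have "variation_over u D \<le> (\<Sum>p\<in>D. c * (norm (y (snd p) - y (fst p)) + norm (z (snd p) - z (fst p))))"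
      unfolding variation_over_def
    proof (rule sum_mono)
      fix p assume "p \<in> D"
      then have "norm (u (snd p) - u (fst p)) \<le> C * (norm (y (snd p) - y (fst p)) + norm (z (snd p) - z (fst p)))"
        using D by (intro le) (auto simp: cells_def intro: order_trans less_imp_le)
      also have "\<dots> \<le> c * (norm (y (snd p) - y (fst p)) + norm (z (snd p) - z (fst p)))"
        using c by (intro mult_right_mono) auto
      finally show "norm (u (snd p) - u (fst p)) \<le> \<dots>" .
    qed
    also have "\<dots> = c * (variation_over y D + variation_over z D)"
      by (simp add: variation_over_def sum.distrib flip: sum_distrib_left)
    also have "\<dots> < c * (e / (2*c) + e / (2*c))"
      using c d1(2)[OF D(1)] d2(2)[OF D(1)] D(2) by (intro mult_strict_left_mono add_strict_mono) auto
    also have "\<dots> = e" using c by (simp add: field_simps)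
    finally show ?thesis .
  qed
  then show "\<exists>d>0. \<forall>D. cells a b D \<and> total_length D < d \<longrightarrow> variation_over u D < e"
    using d1 d2 by (intro exI[of _ "min d1 d2"]) auto
qed

lemma absolutely_continuous_imp_primitive_real:
  fixes y :: "real \<Rightarrow> real"
  assumes ac: "absolutely_continuous_fun a b y" and ab: "a < b"
  obtains f where "f absolutely_integrable_on {a..b}"
    "\<And>x. x \<in> {a..b} \<Longrightarrow> (f has_integral (y x - y a)) {a..x}"
proof -
  obtain v where v: "absolutely_continuous_fun a b v" "mono_on {a..b} v" "mono_on {a..b} (\<lambda>x. v x - y x)"
    using jordan_decomposition[OF ac] by blast
  have w: "absolutely_continuous_fun a b (\<lambda>x. v x - y x)"
    by (rule absolutely_continuous_fun_dominated[OF v(1) ac, of _ 1]) simp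
  obtain f where f: "f absolutely_integrable_on {a..b}" "\<And>x. x \<in> {a..b} \<Longrightarrow> (f has_integral (v x - v a)) {a..x}"
    using mono_absolutely_continuous_primitive[OF v(1,2) ab] by metis
  obtain g where g: "g absolutely_integrable_on {a..b}" "\<And>x. x \<in> {a..b} \<Longrightarrow> (g has_integral ((v x - y x) - (v a - y a))) {a..x}"
    using mono_absolutely_continuous_primitive[OF w v(3) ab] by metis
  show thesis
  proof (rule that)
    show "(\<lambda>x. f x - g x) absolutely_integrable_on {a..b}"
      by (rule set_integral_diff[OF f(1) g(1)])
    fix x assume x: "x \<in> {a..b}"
    show "((\<lambda>x. f x - g x) has_integral (y x - y a)) {a..x}"
      using has_integral_diff[OF f(2)[OF x] g(2)[OF x]] by (simp add: algebra_simps)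
  qed
qed

lemma absolutely_continuous_imp_primitive:
  fixes y :: "real \<Rightarrow> 'a::euclidean_space"
  assumes ac: "absolutely_continuous_fun a b y" and ab: "a < b"
  obtains f where "f absolutely_integrable_on {a..b}"
    "\<And>x. x \<in> {a..b} \<Longrightarrow> (f has_integral (y x - y a)) {a..x}"
proof -
  have "\<exists>f. f absolutely_integrable_on {a..b} \<and> (\<forall>x \<in> {a..b}. (f has_integral (y x \<bullet> i - y a \<bullet> i)) {a..x})"
    if "i \<in> Basis" for i
  proof -
    have "absolutely_continuous_fun a b (\<lambda>x. y x \<bullet> i)"
      by (rule absolutely_continuous_fun_dominated[OF ac ac, of _ 1])
         (use that in \<open>auto simp flip: inner_diff_left intro!: order_trans[OF Basis_le_norm]\<close>)
    from absolutely_continuous_imp_primitive_real[OF this ab] show ?thesis by metis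
  qed
  then obtain f where f: "\<And>i. i \<in> Basis \<Longrightarrow> f i absolutely_integrable_on {a..b}"
    "\<And>i x. i \<in> Basis \<Longrightarrow> x \<in> {a..b} \<Longrightarrow> (f i has_integral (y x \<bullet> i - y a \<bullet> i)) {a..x}"
    by metis
  show thesis
  proof (rule that)
    show "(\<lambda>x. \<Sum>i\<in>Basis. f i x *\<^sub>R (i::'a)) absolutely_integrable_on {a..b}"
      by (rule absolutely_integrable_sum) (auto intro!: absolutely_integrable_scaleR_right absolutely_integrable_scaleR_left f(1))
    fix x assume x: "x \<in> {a..b}"
    have "((\<lambda>x. \<Sum>i\<in>Basis. f i x *\<^sub>R (i::'a)) has_integral (\<Sum>i\<in>Basis. (y x \<bullet> i - y a \<bullet> i) *\<^sub>R i)) {a..x}"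
      by (intro has_integral_sum has_integral_scaleR_left f(2) x) auto
    moreover have "(\<Sum>i\<in>Basis. (y x \<bullet> i - y a \<bullet> i) *\<^sub>R i) = y x - y a"
      unfolding inner_diff_left[symmetric] by (rule euclidean_representation)
    ultimately show "((\<lambda>x. \<Sum>i\<in>Basis. f i x *\<^sub>R (i::'a)) has_integral (y x - y a)) {a..x}" by simp
  qed
qed

text \<open>
  Right-hand difference quotients of the integral converge almost everywhere by
  \<open>integrable_ccontinuous_explicit\<close>, and the left-hand ones are the right-hand ones of the reflected
  function.
\<close>

lemma integral_has_vector_derivative_AE:
  fixes f :: "real \<Rightarrow> 'a::euclidean_space"
  assumes f: "f integrable_on {a..b}"
  obtains N where "negligible N"
    "\<And>x. x \<in> {a<..<b} - N \<Longrightarrow> ((\<lambda>x. integral {a..x} f) has_vector_derivative f x) (at x)"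
proof -
  define g where "g x = (if x \<in> {a..b} then f x else 0)" for x
  have gUN: "g integrable_on UNIV" using f unfolding g_def integrable_restrict_UNIV .
  have gi: "g integrable_on {c..d}" for c d using integrable_on_subcbox[OF gUN, of c d] by simp
  have gri: "(\<lambda>x. g (- x)) integrable_on cbox c d" for c d
    using gi[of "-d" "-c"] Henstock_Kurzweil_Integration.integrable_reflect_real[where f=g and a="-d" and b="-c"] by simp
  obtain N1 where N1: "negligible N1" "\<And>x e. x \<notin> N1 \<Longrightarrow> 0 < e \<Longrightarrow>
      \<exists>d>0. \<forall>h. 0 < h \<and> h < d \<longrightarrow> norm (integral {x..x+h} g /\<^sub>R h - g x) < e"
    using integrable_ccontinuous_explicit[of g] gi by (auto simp: )
  obtain N2 where N2: "negligible N2" "\<And>x e. x \<notin> N2 \<Longrightarrow> 0 < e \<Longrightarrow>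
      \<exists>d>0. \<forall>h. 0 < h \<and> h < d \<longrightarrow> norm (integral {x..x+h} (\<lambda>x. g (- x)) /\<^sub>R h - g (- x)) < e"
    using integrable_ccontinuous_explicit[of "\<lambda>x. g (- x)"] gri by (auto simp: )
  show thesis
  proof (rule that)
    have "negligible (uminus ` N2)" using N2(1) by (intro negligible_differentiable_image_negligible) (auto intro!: derivative_intros)
    then show "negligible (N1 \<union> uminus ` N2)" using N1(1) by (rule negligible_Un[rotated])
    fix x assume x: "x \<in> {a<..<b} - (N1 \<union> uminus ` N2)"
    then have xN: "x \<notin> N1" "- x \<notin> N2" "a < x" "x < b" by (auto simp: image_iff)
    have gx: "g x = f x" using xN by (simp add: g_def)
    have eqfg: "integral {c..d} f = integral {c..d} g" if "a \<le> c" "d \<le> b" for c d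
      using that by (intro integral_cong) (auto simp: g_def)
    show "((\<lambda>x. integral {a..x} f) has_vector_derivative f x) (at x)"
      unfolding has_vector_derivative_def has_derivative_at_alt
    proof (intro conjI allI impI bounded_linear_scaleR_left)
      fix e :: real assume e: "e > 0"
      obtain d1 where d1: "d1 > 0" "\<And>h. 0 < h \<and> h < d1 \<Longrightarrow> norm (integral {x..x+h} g /\<^sub>R h - g x) < e"
        using N1(2)[OF xN(1) e] by meson
      obtain d2 where d2: "d2 > 0" "\<And>h. 0 < h \<and> h < d2 \<Longrightarrow> norm (integral {-x..-x+h} (\<lambda>x. g (- x)) /\<^sub>R h - g x) < e"
        using N2(2)[OF xN(2) e] by auto
      define d where "d = Min {d1, d2, x - a, b - x}"
      have d: "d > 0" "d \<le> d1" "d \<le> d2" "d \<le> x - a" "d \<le> b - x" using d1 d2 xN by (auto simp: d_def)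
      have "norm (integral {a..z} f - integral {a..x} f - (z - x) *\<^sub>R f x) \<le> e * norm (z - x)"
        if z: "norm (z - x) < d" for z
      proof -
        consider "z = x" | "z > x" | "z < x" by linarith
        then show ?thesis
        proof cases
          case 2
          define h where "h = z - x"
          have h: "0 < h" "h < d1" "z = x + h" "z \<le> b" using 2 z d by (auto simp: h_def)
          have "integral {a..x} g + integral {x..z} g = integral {a..z} g"
            using 2 xN by (intro Henstock_Kurzweil_Integration.integral_combine gi) auto
          then have "integral {a..z} f - integral {a..x} f = integral {x..x+h} g"
            using eqfg[of a z] eqfg[of a x] h xN by (simp add: algebra_simps)
          then have "norm (integral {a..z} f - integral {a..x} f - (z - x) *\<^sub>R f x) =
             norm (h *\<^sub>R (integral {x..x+h} g /\<^sub>R h - g x))"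
            using h by (simp add: h_def[symmetric] gx scaleR_diff_right)
          also have "\<dots> = h * norm (integral {x..x+h} g /\<^sub>R h - g x)" using h by simp
          also have "\<dots> \<le> h * e" using d1(2)[of h] h by (intro mult_left_mono) auto
          finally show ?thesis using h by (simp add: mult.commute)
        next
          case 3
          define h where "h = x - z"
          have h: "0 < h" "h < d2" "z = x - h" "a \<le> z" using 3 z d by (auto simp: h_def)
          have xh: "-x+h = -z" using h by simp
          have e1: "integral {a..z} f = integral {a..z} g" by (rule eqfg) (use 3 xN in auto)
          have e2: "integral {a..x} f = integral {a..x} g" by (rule eqfg) (use xN in auto)
          have "integral {a..z} g + integral {z..x} g = integral {a..x} g"
            using 3 h by (intro Henstock_Kurzweil_Integration.integral_combine gi) auto
          moreover have "integral {-x..-x+h} (\<lambda>x. g (- x)) = integral {z..x} g"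
            unfolding xh by (rule Henstock_Kurzweil_Integration.integral_reflect_real)
          ultimately have fd: "integral {a..z} f - integral {a..x} f = - integral {-x..-x+h} (\<lambda>x. g (- x))"
          proof -
            assume 1: "integral {a..z} g + integral {z..x} g = integral {a..x} g"
              and 2: "integral {-x..-x+h} (\<lambda>x. g (- x)) = integral {z..x} g"
            show ?thesis unfolding e1 e2 2 1[symmetric] by simp
          qed
          have zx: "z - x = - h" using h by simp
          have "norm (integral {a..z} f - integral {a..x} f - (z - x) *\<^sub>R f x) =
             norm (- (h *\<^sub>R (integral {-x..-x+h} (\<lambda>x. g (- x)) /\<^sub>R h - g x)))"
            unfolding fd zx using h(1) by (simp add: gx scaleR_diff_right)
          also have "\<dots> = h * norm (integral {-x..-x+h} (\<lambda>x. g (- x)) /\<^sub>R h - g x)" using h by simp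
          also have "\<dots> \<le> h * e" using d2(2)[of h] h by (intro mult_left_mono) auto
          finally show ?thesis using h by (simp add: mult.commute)
        qed simp
      qed
      with d(1) show "\<exists>d>0. \<forall>z. norm (z - x) < d \<longrightarrow>
          norm (integral {a..z} f - integral {a..x} f - (z - x) *\<^sub>R f x) \<le> e * norm (z - x)" by blast
    qed
  qed
qed

text \<open>
  The indicator functions of disjoint cells add up to at most \<open>1\<close>.
\<close>

lemma sum_integral_cells_le:
  fixes g :: "real \<Rightarrow> real"
  assumes g: "g integrable_on {a..b}" and pos: "\<And>x. x \<in> {a..b} \<Longrightarrow> 0 \<le> g x" and D: "cells a b D"
  shows "(\<Sum>p\<in>D. integral {fst p..snd p} g) \<le> integral {a..b} g"
proof -
  have fin: "finite D" using D by (simp add: cells_def)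
  have sub: "{fst p<..<snd p} \<subseteq> {a..b}" "fst p < snd p" "{fst p..snd p} \<subseteq> {a..b}" if "p \<in> D" for p
    using D that by (auto simp: cells_def)
  have hi: "((\<lambda>x. if x \<in> {fst p<..<snd p} then g x else 0) has_integral integral {fst p..snd p} g) {a..b}" if p: "p \<in> D" for p
  proof -
    have "g integrable_on {fst p..snd p}" using sub(3)[OF p] g by (rule integrable_on_subinterval[rotated])
    then have "(g has_integral integral {fst p..snd p} g) {fst p<..<snd p}"
      using has_integral_Icc_iff_Ioo by (auto simp: has_integral_integral)
    then show ?thesis by (subst has_integral_restrict[OF sub(1)[OF p]])
  qed
  have "((\<lambda>x. \<Sum>p\<in>D. if x \<in> {fst p<..<snd p} then g x else 0) has_integral (\<Sum>p\<in>D. integral {fst p..snd p} g)) {a..b}"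
    by (rule has_integral_sum[OF fin hi])
  moreover have "(g has_integral integral {a..b} g) {a..b}" using g by (simp add: has_integral_integral)
  moreover have "(\<Sum>p\<in>D. if x \<in> {fst p<..<snd p} then g x else 0) \<le> g x" if x: "x \<in> {a..b}" for x
  proof (cases "\<exists>p\<in>D. x \<in> {fst p<..<snd p}")
    case True
    then obtain p where p: "p \<in> D" "x \<in> {fst p<..<snd p}" by blast
    have "(\<Sum>p'\<in>D. if x \<in> {fst p'<..<snd p'} then g x else 0) = (\<Sum>p'\<in>D. if p' = p then g x else 0)"
    proof (intro sum.cong refl)
      fix p' assume "p' \<in> D"
      then have "p' \<noteq> p \<Longrightarrow> {fst p'<..<snd p'} \<inter> {fst p<..<snd p} = {}" using D p(1) unfolding cells_def by blast
      then show "(if x \<in> {fst p'<..<snd p'} then g x else 0) = (if p' = p then g x else 0)"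
        using p(2) by (metis IntI empty_iff)
    qed
    then show ?thesis using p fin by simp
  next
    case False
    then have "(\<Sum>p\<in>D. if x \<in> {fst p<..<snd p} then g x else 0) = 0" by (intro sum.neutral) auto
    then show ?thesis using pos[OF x] by simp
  qed
  ultimately show ?thesis by (rule has_integral_le)
qed

text \<open>
  For large \<open>n\<close> the part of \<open>f\<close> where its norm exceeds \<open>n\<close> has a small integral, and the integral of the
  remaining part over the cells is at most \<open>n\<close> times their total length.
\<close>

lemma absolutely_continuous_integral:
  fixes f :: "real \<Rightarrow> 'a::euclidean_space"
  assumes f: "f absolutely_integrable_on {a..b}"
  shows "absolutely_continuous_fun a b (\<lambda>x. integral {a..x} f)"
  unfolding absolutely_continuous_fun_cells
proof (intro allI impI)
  fix e :: real assume e: "e > 0"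
  define g where "g n x = (if norm (f x) > real n then norm (f x) else 0)" for n x
  have nf: "(\<lambda>x. norm (f x)) absolutely_integrable_on {a..b}" by (rule absolutely_integrable_norm[OF f, unfolded o_def])
  have gi: "g n absolutely_integrable_on {a..b}" for n
  proof (rule measurable_bounded_by_integrable_imp_absolutely_integrable)
    have [measurable]: "f \<in> borel_measurable (lebesgue_on {a..b})"
      by (rule absolutely_integrable_imp_borel_measurable[OF f]) simp
    show "g n \<in> borel_measurable (lebesgue_on {a..b})" unfolding g_def by measurable
    show "(\<lambda>x. norm (f x)) integrable_on {a..b}" using nf absolutely_integrable_on_def by blast
  qed (auto simp: g_def)
  have "(\<lambda>n. integral {a..b} (g n)) \<longlonglongrightarrow> integral {a..b} (\<lambda>x. 0)"
  proof (rule dominated_convergence(2))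
    show "g n integrable_on {a..b}" for n using gi absolutely_integrable_on_def by blast
    show "(\<lambda>x. norm (f x)) integrable_on {a..b}" using nf absolutely_integrable_on_def by blast
    show "(\<lambda>n. g n x) \<longlonglongrightarrow> 0" for x
    proof -
      obtain m :: nat where "norm (f x) \<le> real m" using real_arch_simple by blast
      then have "\<forall>n\<ge>m. g n x = 0" by (auto simp: g_def)
      then show ?thesis by (intro tendsto_eventually eventually_sequentiallyI[of m]) auto
    qed
  qed (auto simp: g_def)
  then have "eventually (\<lambda>n. integral {a..b} (g n) < e/2) sequentially"
    using e by (intro order_tendstoD(2)) auto
  then obtain n where n: "integral {a..b} (g n) < e/2" by (auto simp: eventually_sequentially)
  define d where "d = e / (2 * (real n + 1))"
  have d: "d > 0" using e by (simp add: d_def)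
  have "variation_over (\<lambda>x. integral {a..x} f) D < e" if D: "cells a b D" "total_length D < d" for D
  proof -
    have sub: "a \<le> fst p" "fst p < snd p" "snd p \<le> b" "{fst p..snd p} \<subseteq> {a..b}" if "p \<in> D" for p
      using D that by (auto simp: cells_def)
    have fi: "f integrable_on {a..b}" "g n integrable_on {a..b}" "(\<lambda>x. norm (f x)) integrable_on {a..b}"
      using f gi nf absolutely_integrable_on_def by blast+
    have "variation_over (\<lambda>x. integral {a..x} f) D \<le> (\<Sum>p\<in>D. real n * (snd p - fst p) + integral {fst p..snd p} (g n))"
      unfolding variation_over_def
    proof (rule sum_mono)
      fix p assume p: "p \<in> D"
      have i: "f integrable_on {fst p..snd p}" "g n integrable_on {fst p..snd p}"
        using integrable_on_subinterval[OF _ sub(4)[OF p]] fi by blast+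
      have "integral {a..fst p} f + integral {fst p..snd p} f = integral {a..snd p} f"
        using sub[OF p] by (intro Henstock_Kurzweil_Integration.integral_combine integrable_on_subinterval[OF fi(1)]) auto
      then have "norm (integral {a..snd p} f - integral {a..fst p} f) = norm (integral {fst p..snd p} f)"
        by (metis add_diff_cancel_left')
      also have "\<dots> \<le> integral {fst p..snd p} (\<lambda>x. real n + g n x)"
        by (intro integral_norm_bound_integral i integrable_add) (auto simp: g_def)
      also have "\<dots> = real n * (snd p - fst p) + integral {fst p..snd p} (g n)"
        using sub[OF p] i by (subst integral_add) auto
      finally show "norm (integral {a..snd p} f - integral {a..fst p} f) \<le> \<dots>" .
    qed
    also have "\<dots> = real n * total_length D + (\<Sum>p\<in>D. integral {fst p..snd p} (g n))"
      by (simp add: sum.distrib total_length_def sum_distrib_left)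
    also have "\<dots> < e/2 + e/2"
    proof (intro add_le_less_mono)
      have "real n * total_length D \<le> real n * d" using D by (intro mult_left_mono) auto
      also have "\<dots> \<le> (real n + 1) * d" using d by (intro mult_right_mono) auto
      also have "\<dots> = e/2" unfolding d_def using add_pos_nonneg[of 1 "real n"] by (simp add: field_simps)
      finally show "real n * total_length D \<le> e/2" .
      show "(\<Sum>p\<in>D. integral {fst p..snd p} (g n)) < e/2"
        using sum_integral_cells_le[OF fi(2) _ D(1)] n by (force simp: g_def)
    qed
    finally show ?thesis by simp
  qed
  with d show "\<exists>d>0. \<forall>D. cells a b D \<and> total_length D < d \<longrightarrow> variation_over (\<lambda>x. integral {a..x} f) D < e" by blast
qed

section \<open>Calculus with almost everywhere derivatives\<close>

text \<open>
  All differential equations below are handled in this form. In contrast to \<open>vector_derivative\<close>, which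
  has some value at every point, the relation records differentiability; it obeys the product rule, and
  by the next lemmas it says that \<open>y\<close> is a primitive of the integrable function \<open>f\<close>.
\<close>

definition ac_deriv :: "(real \<Rightarrow> 'a::euclidean_space) \<Rightarrow> (real \<Rightarrow> 'a) \<Rightarrow> bool" where
  "ac_deriv y f \<longleftrightarrow> absolutely_continuous_fun (-1) 1 y \<and> (AE x in leb_I. (y has_vector_derivative f x) (at x))"

lemma AE_leb_I_iff: "(AE x in leb_I. P x) \<longleftrightarrow> negligible {x\<in>{-1<..<1}. \<not> P x}"
proof -
  have "(AE x in leb_I. P x) \<longleftrightarrow> (AE x in lebesgue. x \<in> {-1<..<1} \<longrightarrow> P x)"
    by (subst AE_restrict_space_iff) auto
  also have "\<dots> \<longleftrightarrow> {x. \<not> (x \<in> {-1<..<1} \<longrightarrow> P x)} \<in> null_sets lebesgue" (is "?A \<longleftrightarrow> ?B")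
  proof
    assume ?A
    then obtain N where N: "N \<in> null_sets lebesgue" "{x \<in> space lebesgue. \<not> (x \<in> {-1<..<1} \<longrightarrow> P x)} \<subseteq> N"
      unfolding eventually_ae_filter by blast
    show ?B by (rule null_sets_completion_subset[OF _ N(1)]) (use N(2) in auto)
  next
    assume ?B then show ?A by (rule AE_I') auto
  qed
  finally show ?thesis by (simp add: negligible_iff_null_sets conj_commute)
qed

lemma AE_leb_I_negligible:
  assumes "negligible N" "\<And>x. x \<in> {-1<..<1} - N \<Longrightarrow> P x"
  shows "AE x in leb_I. P x"
  unfolding AE_leb_I_iff by (rule negligible_subset[OF assms(1)]) (use assms(2) in auto)

lemma AE_leb_IE:
  assumes "AE x in leb_I. P x"
  obtains N where "negligible N" "\<And>x. x \<in> {-1<..<1} - N \<Longrightarrow> P x"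
  using assms unfolding AE_leb_I_iff by (rule that) auto

lemma integrable_leb_I_iff:
  fixes f :: "real \<Rightarrow> 'a::euclidean_space"
  shows "integrable leb_I f \<longleftrightarrow> f absolutely_integrable_on {-1..1}"
proof -
  have "integrable leb_I f \<longleftrightarrow> f absolutely_integrable_on {-1<..<1}"
    by (simp add: set_integrable_def integrable_restrict_space)
  then show ?thesis by (simp add: absolutely_integrable_on_Icc_iff_Ioo)
qed

lemma absolutely_integrable_cong_AE:
  fixes f :: "real \<Rightarrow> 'a::euclidean_space"
  assumes f: "f absolutely_integrable_on {-1..1}" and fg: "AE x in leb_I. f x = g x"
  shows "g absolutely_integrable_on {-1..1}" 
    "\<And>s t. s \<in> {-1..1} \<Longrightarrow> t \<in> {-1..1} \<Longrightarrow> (f has_integral I) {s..t} \<Longrightarrow> (g has_integral I) {s..t}"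
proof -
  obtain N where N: "negligible N" "\<And>x. x \<in> {-1<..<1} - N \<Longrightarrow> f x = g x" using AE_leb_IE[OF fg] by blast
  have N': "negligible (N \<union> {-1,1})" using N(1) by (intro negligible_Un) auto
  show "g absolutely_integrable_on {-1..1}"
    by (rule absolutely_integrable_spike[OF f N']) (use N(2) in force)
  show "(g has_integral I) {s..t}" if "s \<in> {-1..1}" "t \<in> {-1..1}" "(f has_integral I) {s..t}" for s t
    by (rule has_integral_spike[OF N' _ that(3)]) (use N(2) that in force)
qed

lemma ac_deriv_cong:
  assumes "ac_deriv y f" "\<And>x. x \<in> {-1..1} \<Longrightarrow> y x = z x" "AE x in leb_I. f x = g x"
  shows "ac_deriv z g"
proof -
  have c: "(\<lambda>x. y x) = y" by simp
  have ac: "absolutely_continuous_fun (-1) 1 y" using assms by (simp add: ac_deriv_def)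
  have "absolutely_continuous_fun (-1) 1 z"
    by (rule absolutely_continuous_fun_dominated[OF ac ac, of _ 1]) (simp add: assms(2)[symmetric])
  moreover have "AE x in leb_I. x \<in> {-1<..<1}" by (rule AE_I2) auto
  moreover have "AE x in leb_I. (y has_vector_derivative f x) (at x)" using assms by (simp add: ac_deriv_def)
  ultimately show ?thesis unfolding ac_deriv_def
  proof (intro conjI)
    assume "AE x in leb_I. x \<in> {-1<..<1}" "AE x in leb_I. (y has_vector_derivative f x) (at x)"
    with assms(3) show "AE x in leb_I. (z has_vector_derivative g x) (at x)"
    proof eventually_elim
      case (elim x)
      show ?case
        by (rule has_vector_derivative_transform_within_open[of y _ x "{-1<..<1}"]) (use elim assms(2) in auto)
    qed
  qed auto
qed

lemma ac_deriv_continuous_on: "ac_deriv y f \<Longrightarrow> continuous_on {-1..1} y"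
  by (simp add: ac_deriv_def absolutely_continuous_imp_continuous_on)

lemma ac_deriv_integral:
  fixes f :: "real \<Rightarrow> 'a::euclidean_space"
  assumes f: "f absolutely_integrable_on {-1..1}"
  shows "ac_deriv (\<lambda>x. c + integral {-1..x} f) f"
proof -
  have ac: "absolutely_continuous_fun (-1) 1 (\<lambda>x. integral {-1..x} f)"
    by (rule absolutely_continuous_integral[OF f])
  have fi: "f integrable_on {-1..1}" using f absolutely_integrable_on_def by blast
  obtain N where N: "negligible N"
    "\<And>x. x \<in> {-1<..<1} - N \<Longrightarrow> ((\<lambda>x. integral {-1..x} f) has_vector_derivative f x) (at x)"
    using integral_has_vector_derivative_AE[OF fi] by blast
  show ?thesis unfolding ac_deriv_def
  proof
    show "absolutely_continuous_fun (-1) 1 (\<lambda>x. c + integral {-1..x} f)"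
      by (rule absolutely_continuous_fun_dominated[OF ac ac, of _ 1]) auto
    show "AE x in leb_I. ((\<lambda>x. c + integral {-1..x} f) has_vector_derivative f x) (at x)"
      by (rule AE_leb_I_negligible[OF N(1)]) (auto intro!: derivative_eq_intros N(2))
  qed
qed

lemma absolutely_continuous_ac_deriv:
  fixes y :: "real \<Rightarrow> 'a::euclidean_space"
  assumes ac: "absolutely_continuous_fun (-1) 1 y"
  obtains g where "ac_deriv y g" "g absolutely_integrable_on {-1..1}"
    "\<And>x. x \<in> {-1..1} \<Longrightarrow> (g has_integral (y x - y (-1))) {-1..x}"
proof -
  obtain g where g: "g absolutely_integrable_on {-1..1}"
    "\<And>x. x \<in> {-1..1} \<Longrightarrow> (g has_integral (y x - y (-1))) {-1..x}"
    using absolutely_continuous_imp_primitive[OF ac] by auto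
  have "ac_deriv (\<lambda>x. y (-1) + integral {-1..x} g) g" by (rule ac_deriv_integral[OF g(1)])
  then have "ac_deriv y g"
  proof (rule ac_deriv_cong)
    fix x :: real assume "x \<in> {-1..1}"
    then have "integral {-1..x} g = y x - y (-1)" by (intro integral_unique g(2))
    then show "y (-1) + integral {-1..x} g = y x" by simp
  qed auto
  with g that show thesis by blast
qed

lemma ac_deriv_FTC:
  fixes y :: "real \<Rightarrow> 'a::euclidean_space"
  assumes "ac_deriv y f"
  shows "f absolutely_integrable_on {-1..1}"
    "\<And>s t. -1 \<le> s \<Longrightarrow> s \<le> t \<Longrightarrow> t \<le> 1 \<Longrightarrow> (f has_integral (y t - y s)) {s..t}"
proof -
  obtain g where g: "ac_deriv y g" "g absolutely_integrable_on {-1..1}"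
    "\<And>x. x \<in> {-1..1} \<Longrightarrow> (g has_integral (y x - y (-1))) {-1..x}"
    using absolutely_continuous_ac_deriv assms unfolding ac_deriv_def by metis
  have "AE x in leb_I. (y has_vector_derivative f x) (at x)" "AE x in leb_I. (y has_vector_derivative g x) (at x)"
    using assms g by (auto simp: ac_deriv_def)
  then have eq: "AE x in leb_I. g x = f x" by eventually_elim (rule vector_derivative_unique_at)
  show "f absolutely_integrable_on {-1..1}" by (rule absolutely_integrable_cong_AE[OF g(2) eq])
  fix s t :: real assume st: "-1 \<le> s" "s \<le> t" "t \<le> 1"
  have gi: "g integrable_on {s..t}" using st absolutely_integrable_on_def g(2) integrable_on_subinterval[of g "{-1..1}" s t] by force
  have "integral {-1..s} g + integral {s..t} g = integral {-1..t} g"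
    using st g(3)[of t] by (intro Henstock_Kurzweil_Integration.integral_combine) auto
  moreover have "integral {-1..s} g = y s - y (-1)" "integral {-1..t} g = y t - y (-1)"
    using g(3) st by (auto intro!: integral_unique)
  ultimately have "integral {s..t} g = y t - y s" by (simp add: algebra_simps)
  with gi have "(g has_integral (y t - y s)) {s..t}" by (simp add: has_integral_iff)
  then show "(f has_integral (y t - y s)) {s..t}"
    using absolutely_integrable_cong_AE(2)[OF g(2) eq] st by auto
qed

lemma W11_ac_deriv: "y \<in> W11 \<Longrightarrow> ac_deriv y (\<lambda>x. vector_derivative y (at x))"
proof -
  assume y: "y \<in> W11"
  then obtain g where g: "ac_deriv y g"
    using absolutely_continuous_ac_deriv[of y] unfolding W11_def by auto
  have "AE x in leb_I. (y has_vector_derivative g x) (at x)" using g by (simp add: ac_deriv_def)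
  then have eq: "AE x in leb_I. g x = vector_derivative y (at x)"
    by eventually_elim (simp add: vector_derivative_at)
  show ?thesis by (rule ac_deriv_cong[OF g refl eq])
qed

lemma ac_deriv_AE_vector_derivative:
  assumes "ac_deriv y f" shows "AE x in leb_I. vector_derivative y (at x) = f x"
proof -
  have "AE x in leb_I. (y has_vector_derivative f x) (at x)" using assms by (simp add: ac_deriv_def)
  then show ?thesis by eventually_elim (simp add: vector_derivative_at)
qed

lemma ac_deriv_W11: "ac_deriv y f \<Longrightarrow> y \<in> W11"
  unfolding W11_def integrable_leb_I_iff
  using absolutely_integrable_cong_AE(1)[OF ac_deriv_FTC(1) ac_deriv_AE_vector_derivative[THEN AE_symmetric]]
  by (auto simp: ac_deriv_def)

lemma ac_deriv_unique:
  assumes "ac_deriv y f" "ac_deriv y g" shows "AE x in leb_I. f x = g x"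
proof -
  have "AE x in leb_I. (y has_vector_derivative f x) (at x)" "AE x in leb_I. (y has_vector_derivative g x) (at x)"
    using assms by (auto simp: ac_deriv_def)
  then show ?thesis by eventually_elim (rule vector_derivative_unique_at)
qed

lemma ac_deriv_const_derivative_zero:
  assumes "ac_deriv y (\<lambda>x. 0)" "s \<in> {-1..1}" "t \<in> {-1..1}" shows "y s = y t"
proof -
  have "y t = y s" if "s \<le> t" "s \<in> {-1..1}" "t \<in> {-1..1}" for s t
    using ac_deriv_FTC(2)[OF assms(1), of s t] that has_integral_0_eq by fastforce
  from this[of s t] this[of t s] show ?thesis using assms(2,3) by fastforce
qed

lemma ac_deriv_nonpos:
  fixes u :: "real \<Rightarrow> real"
  assumes u: "ac_deriv u f" and f: "AE x in leb_I. f x \<le> 0" and st: "-1 \<le> s" "s \<le> t" "t \<le> 1"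
  shows "u t \<le> u s"
proof -
  have "AE x in leb_I. f x = min 0 (f x)" using f by eventually_elim simp
  then have "((\<lambda>x. min 0 (f x)) has_integral (u t - u s)) {s..t}"
    using absolutely_integrable_cong_AE(2)[OF ac_deriv_FTC(1)[OF u] _ _ _ ac_deriv_FTC(2)[OF u st]] st by auto
  then have "u t - u s \<le> 0" by (rule has_integral_le[OF _ has_integral_0]) simp
  then show ?thesis by simp
qed

lemma ac_deriv_linear:
  assumes h: "bounded_linear h" and y: "ac_deriv y f"
  shows "ac_deriv (\<lambda>x. h (y x)) (\<lambda>x. h (f x))"
  unfolding ac_deriv_def
proof
  have ac: "absolutely_continuous_fun (-1) 1 y" using y by (simp add: ac_deriv_def)
  obtain K where K: "\<And>v. norm (h v) \<le> norm v * K" "K \<ge> 0" using bounded_linear.nonneg_bounded[OF h] by blast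
  have eq: "h a - h b = h (a - b)" for a b using h by (simp add: linear_diff bounded_linear.linear)
  show "absolutely_continuous_fun (-1) 1 (\<lambda>x. h (y x))"
  proof (rule absolutely_continuous_fun_dominated[OF ac ac])
    fix s t show "norm (h (y t) - h (y s)) \<le> K * (norm (y t - y s) + norm (y t - y s))"
      unfolding eq using K(1)[of "y t - y s"] mult_nonneg_nonneg[OF norm_ge_zero[of "y t - y s"] K(2)]
      by (simp add: algebra_simps)
  qed
  have "AE x in leb_I. (y has_vector_derivative f x) (at x)" using y by (simp add: ac_deriv_def)
  then show "AE x in leb_I. ((\<lambda>x. h (y x)) has_vector_derivative h (f x)) (at x)"
    by eventually_elim (rule bounded_linear.has_vector_derivative[OF h])
qed

lemma ac_deriv_bilinear:
  assumes h: "bounded_bilinear h" and y: "ac_deriv y f" and z: "ac_deriv z g"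
  shows "ac_deriv (\<lambda>x. h (y x) (z x)) (\<lambda>x. h (y x) (g x) + h (f x) (z x))"
  unfolding ac_deriv_def
proof
  have ay: "absolutely_continuous_fun (-1) 1 y" and az: "absolutely_continuous_fun (-1) 1 z"
    using y z by (auto simp: ac_deriv_def)
  obtain K where K: "\<And>v w. norm (h v w) \<le> norm v * norm w * K" "K \<ge> 0" using bounded_bilinear.nonneg_bounded[OF h] by blast
  have "bounded (y ` {-1..1})" "bounded (z ` {-1..1})"
    using ac_deriv_continuous_on[OF y] ac_deriv_continuous_on[OF z] compact_continuous_image compact_imp_bounded by blast+
  then obtain By Bz where "\<forall>x\<in>{-1..1}. norm (y x) \<le> By" "\<forall>x\<in>{-1..1}. norm (z x) \<le> Bz"
    unfolding bounded_iff by auto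
  define B where "B = max 0 (max By Bz)"
  have B: "norm (y x) \<le> B" "norm (z x) \<le> B" "B \<ge> 0" if "x \<in> {-1..1}" for x
    using \<open>\<forall>x\<in>{-1..1}. norm (y x) \<le> By\<close> \<open>\<forall>x\<in>{-1..1}. norm (z x) \<le> Bz\<close> that by (force simp: B_def)+
  show "absolutely_continuous_fun (-1) 1 (\<lambda>x. h (y x) (z x))"
  proof (rule absolutely_continuous_fun_dominated[OF ay az])
    fix s t :: real assume st: "s \<in> {-1..1}" "t \<in> {-1..1}"
    have "h (y t) (z t) - h (y s) (z s) = h (y t) (z t - z s) + h (y t - y s) (z s)"
      using h by (simp add: bounded_bilinear.diff_left bounded_bilinear.diff_right)
    also have "norm \<dots> \<le> norm (y t) * norm (z t - z s) * K + norm (y t - y s) * norm (z s) * K"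
      by (rule order_trans[OF norm_triangle_ineq add_mono]) (rule K)+
    also have "\<dots> \<le> B * norm (z t - z s) * K + norm (y t - y s) * B * K"
      using B[OF st(1)] B[OF st(2)] K(2) by (intro add_mono mult_mono) auto
    finally show "norm (h (y t) (z t) - h (y s) (z s)) \<le> (B*K) * (norm (y t - y s) + norm (z t - z s))"
      by (simp add: algebra_simps)
  qed
  have "AE x in leb_I. (y has_vector_derivative f x) (at x)" "AE x in leb_I. (z has_vector_derivative g x) (at x)"
    using y z by (auto simp: ac_deriv_def)
  then show "AE x in leb_I. ((\<lambda>x. h (y x) (z x)) has_vector_derivative h (y x) (g x) + h (f x) (z x)) (at x)"
    by eventually_elim (rule bounded_bilinear.has_vector_derivative[OF h])
qed

lemma ac_deriv_add:
  assumes y: "ac_deriv y f" and z: "ac_deriv z g"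
  shows "ac_deriv (\<lambda>x. y x + z x) (\<lambda>x. f x + g x)"
  unfolding ac_deriv_def
proof
  have ay: "absolutely_continuous_fun (-1) 1 y" and az: "absolutely_continuous_fun (-1) 1 z"
    using y z by (auto simp: ac_deriv_def)
  show "absolutely_continuous_fun (-1) 1 (\<lambda>x. y x + z x)"
  proof (rule absolutely_continuous_fun_dominated[OF ay az])
    fix s t
    show "norm (y t + z t - (y s + z s)) \<le> 1 * (norm (y t - y s) + norm (z t - z s))"
      using norm_triangle_ineq[of "y t - y s" "z t - z s"] by (simp add: algebra_simps)
  qed
  have "AE x in leb_I. (y has_vector_derivative f x) (at x)" "AE x in leb_I. (z has_vector_derivative g x) (at x)"
    using y z by (auto simp: ac_deriv_def)
  then show "AE x in leb_I. ((\<lambda>x. y x + z x) has_vector_derivative f x + g x) (at x)"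
    by eventually_elim (rule has_vector_derivative_add)
qed

lemma ac_deriv_C1:
  fixes g :: "real \<Rightarrow> 'a::euclidean_space"
  assumes g: "\<And>x. x \<in> {-1..1} \<Longrightarrow> (g has_vector_derivative g' x) (at x)" and c: "continuous_on {-1..1} g'"
  shows "ac_deriv g g'"
proof -
  have "ac_deriv (\<lambda>x. g (-1) + integral {-1..x} g') g'"
    by (rule ac_deriv_integral) (rule absolutely_integrable_continuous_real[OF c])
  then show ?thesis
  proof (rule ac_deriv_cong)
    fix x :: real assume x: "x \<in> {-1..1}"
    have "(g' has_integral g x - g (-1)) {-1..x}"
    proof (rule fundamental_theorem_of_calculus)
      show "(g has_vector_derivative g' z) (at z within {-1..x})" if "z \<in> {-1..x}" for z
        using that x by (intro has_vector_derivative_at_within[OF g]) auto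
    qed (use x in auto)
    then show "g (-1) + integral {-1..x} g' = g x" by (simp add: integral_unique)
  qed auto
qed

lemma ac_deriv_exp:
  fixes S :: "real \<Rightarrow> real"
  assumes S: "ac_deriv S w"
  shows "ac_deriv (\<lambda>x. exp (S x)) (\<lambda>x. w x * exp (S x))"
  unfolding ac_deriv_def
proof
  have ac: "absolutely_continuous_fun (-1) 1 S" using S by (simp add: ac_deriv_def)
  have "bounded (S ` {-1..1})"
    using ac_deriv_continuous_on[OF S] compact_continuous_image compact_imp_bounded by blast
  then obtain B where "\<forall>z\<in>S ` {-1..1}. norm z \<le> B" unfolding bounded_iff by blast
  then have B: "\<And>x. x\<in>{-1..1} \<Longrightarrow> \<bar>S x\<bar> \<le> B" by simp
  show "absolutely_continuous_fun (-1) 1 (\<lambda>x. exp (S x))"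
  proof (rule absolutely_continuous_fun_dominated[OF ac ac])
    fix s t :: real assume st: "s \<in> {-1..1}" "t \<in> {-1..1}"
    have *: "exp a - exp b \<le> exp B * \<bar>a - b\<bar>" if "\<bar>a\<bar> \<le> B" for a b
    proof -
      have "exp a * (1 + (b - a)) \<le> exp a * exp (b - a)" by (intro mult_left_mono) auto
      also have "\<dots> = exp b" by (simp flip: exp_add)
      finally have "exp a - exp b \<le> exp a * (a - b)" by (simp add: algebra_simps)
      also have "\<dots> \<le> exp a * \<bar>a - b\<bar>" by (intro mult_left_mono) auto
      also have "\<dots> \<le> exp B * \<bar>a - b\<bar>" using that by (intro mult_right_mono) auto
      finally show ?thesis .
    qed
    have "\<bar>exp (S t) - exp (S s)\<bar> \<le> exp B * \<bar>S t - S s\<bar>"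
      using *[of "S t" "S s"] *[of "S s" "S t"] B[OF st(1)] B[OF st(2)] by (auto simp: abs_le_iff abs_minus_commute)
    also have "\<dots> \<le> exp B * (\<bar>S t - S s\<bar> + \<bar>S t - S s\<bar>)" by (intro mult_left_mono) auto
    finally show "norm (exp (S t) - exp (S s)) \<le> exp B * (norm (S t - S s) + norm (S t - S s))" by simp
  qed
  have "AE x in leb_I. (S has_vector_derivative w x) (at x)" using S by (simp add: ac_deriv_def)
  then show "AE x in leb_I. ((\<lambda>x. exp (S x)) has_vector_derivative w x * exp (S x)) (at x)"
    by eventually_elim (auto simp flip: has_real_derivative_iff_has_vector_derivative intro!: derivative_eq_intros)
qed

text \<open>
  Let \<open>S\<close> be a primitive of \<open>k\<close>. By hypothesis the derivative of the function \<open>|Z|\<^sup>2 exp (- 2 S)\<close> is nonpositive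
  and that of \<open>|Z|\<^sup>2 exp (2 S)\<close> is nonnegative.
\<close>

lemma ac_deriv_norm_growth:
  fixes Z :: "real \<Rightarrow> 'a::euclidean_space"
  assumes Z: "ac_deriv Z f" and k: "k absolutely_integrable_on {-1..1}"
    and le: "AE x in leb_I. \<bar>Z x \<bullet> f x\<bar> \<le> k x * (norm (Z x))\<^sup>2"
    and st: "s \<in> {-1..1}" "t \<in> {-1..1}"
  shows "norm (Z t) \<le> exp \<bar>integral {-1..t} k - integral {-1..s} k\<bar> * norm (Z s)"
proof -
  define S where "S x = integral {-1..x} k" for x
  have S: "ac_deriv S k" using ac_deriv_integral[OF k, of 0] by (simp add: S_def[abs_def])
  define u where "u x = Z x \<bullet> Z x" for x
  have u: "ac_deriv u (\<lambda>x. 2 * (Z x \<bullet> f x))"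
    using ac_deriv_bilinear[OF bounded_bilinear_inner Z Z]
    by (simp add: u_def[abs_def] inner_commute[of "f _"])
  have un: "u x = (norm (Z x))\<^sup>2" for x by (simp add: u_def power2_norm_eq_inner)
  have mono: "u t * exp (c * S t) \<le> u s * exp (c * S s)"
    if c: "c = -2 \<and> s \<le> t \<or> c = 2 \<and> t \<le> s" and st: "s \<in> {-1..1}" "t \<in> {-1..1}" for c s t
  proof -
    have e: "ac_deriv (\<lambda>x. exp (c * S x)) (\<lambda>x. c * k x * exp (c * S x))"
      by (intro ac_deriv_exp ac_deriv_linear[OF bounded_linear_mult_right] S)
    note v = ac_deriv_bilinear[OF bounded_bilinear_mult u e]
    show ?thesis
    proof (cases "c = -2")
      case True
      have "AE x in leb_I. u x * (c * k x * exp (c * S x)) + 2 * (Z x \<bullet> f x) * exp (c * S x) \<le> 0"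
        using le
      proof eventually_elim
        case (elim x)
        have "u x * (c * k x * exp (c * S x)) + 2 * (Z x \<bullet> f x) * exp (c * S x)
            = 2 * exp (c * S x) * (Z x \<bullet> f x - k x * (norm (Z x))\<^sup>2)"
          by (simp add: True un algebra_simps)
        also have "\<dots> \<le> 0" using elim by (intro mult_nonneg_nonpos) auto
        finally show ?case .
      qed
      from ac_deriv_nonpos[OF v this, of s t] st that True show ?thesis by auto
    next
      case False
      then have c2: "c = 2" using c by simp
      have "AE x in leb_I. - (u x * (c * k x * exp (c * S x)) + 2 * (Z x \<bullet> f x) * exp (c * S x)) \<le> 0"
        using le
      proof eventually_elim
        case (elim x)
        have "u x * (c * k x * exp (c * S x)) + 2 * (Z x \<bullet> f x) * exp (c * S x)
            = 2 * exp (c * S x) * (Z x \<bullet> f x + k x * (norm (Z x))\<^sup>2)"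
          by (simp add: c2 un algebra_simps)
        also have "\<dots> \<ge> 0" using elim by (intro mult_nonneg_nonneg) auto
        finally show ?case by simp
      qed
      from ac_deriv_nonpos[OF ac_deriv_linear[OF bounded_linear_minus[OF bounded_linear_ident] v] this, of t s] st that c2
      show ?thesis by auto
    qed
  qed
  have main: "u t \<le> exp (2 * \<bar>S t - S s\<bar>) * u s"
  proof -
    define c where "c = (if s \<le> t then -2 else 2::real)"
    have "u t * exp (c * S t) \<le> u s * exp (c * S s)" by (rule mono) (use st in \<open>auto simp: c_def\<close>)
    then have "u t * exp (c * S t) * exp (- (c * S t)) \<le> u s * exp (c * S s) * exp (- (c * S t))"
      by (rule mult_right_mono) simp
    then have 1: "u t \<le> u s * exp (c * (S s - S t))"
      by (simp add: mult.assoc flip: exp_add) (simp add: algebra_simps)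
    have "c * (S s - S t) \<le> 2 * \<bar>S t - S s\<bar>" by (auto simp: c_def abs_if)
    then have "u s * exp (c * (S s - S t)) \<le> u s * exp (2 * \<bar>S t - S s\<bar>)"
      by (intro mult_left_mono) (auto simp: un)
    with 1 show ?thesis by (simp add: mult.commute)
  qed
  have "(norm (Z t))\<^sup>2 \<le> (exp \<bar>S t - S s\<bar> * norm (Z s))\<^sup>2"
    using main by (simp add: un power_mult_distrib exp_double)
  then show ?thesis unfolding S_def by (rule power2_le_imp_le) simp
qed

section \<open>Complex matrices\<close>

lemma norm_matrix_power2: "(norm (A :: complex^'n^'m))\<^sup>2 = (\<Sum>i\<in>UNIV. \<Sum>j\<in>UNIV. (cmod (A $ i $ j))\<^sup>2)"
  by (simp add: norm_vec_def L2_set_def sum_nonneg)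

lemma norm_vector_power2: "(norm (v :: complex^'n))\<^sup>2 = (\<Sum>i\<in>UNIV. (cmod (v $ i))\<^sup>2)"
  by (simp add: norm_vec_def L2_set_def sum_nonneg)

lemma cauchy_schwarz_sum_complex:
  fixes f g :: "'i \<Rightarrow> complex"
  shows "(cmod (\<Sum>k\<in>S. f k * g k))\<^sup>2 \<le> (\<Sum>k\<in>S. (cmod (f k))\<^sup>2) * (\<Sum>k\<in>S. (cmod (g k))\<^sup>2)"
proof -
  have "cmod (\<Sum>k\<in>S. f k * g k) \<le> (\<Sum>k\<in>S. cmod (f k) * cmod (g k))"
    by (rule order_trans[OF norm_sum]) (simp add: norm_mult)
  then have "(cmod (\<Sum>k\<in>S. f k * g k))\<^sup>2 \<le> (\<Sum>k\<in>S. cmod (f k) * cmod (g k))\<^sup>2"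
    by (rule power_mono) simp
  also have "\<dots> \<le> (\<Sum>k\<in>S. (cmod (f k))\<^sup>2) * (\<Sum>k\<in>S. (cmod (g k))\<^sup>2)"
    by (rule Cauchy_Schwarz_ineq_sum)
  finally show ?thesis .
qed

lemma norm_matrix_mult_le: "norm (A ** B) \<le> norm A * norm (B :: complex^'k^'n)" for A :: "complex^'n^'m"
proof (rule power2_le_imp_le)
  have "(norm (A ** B))\<^sup>2 = (\<Sum>i\<in>UNIV. \<Sum>j\<in>UNIV. (cmod (\<Sum>k\<in>UNIV. A$i$k * B$k$j))\<^sup>2)"
    by (simp add: norm_matrix_power2 matrix_matrix_mult_def)
  also have "\<dots> \<le> (\<Sum>i\<in>UNIV. \<Sum>j\<in>UNIV. (\<Sum>k\<in>UNIV. (cmod (A$i$k))\<^sup>2) * (\<Sum>k\<in>UNIV. (cmod (B$k$j))\<^sup>2))"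
    by (intro sum_mono cauchy_schwarz_sum_complex)
  also have "\<dots> = (\<Sum>i\<in>UNIV. \<Sum>k\<in>UNIV. (cmod (A$i$k))\<^sup>2) * (\<Sum>j\<in>UNIV. \<Sum>k\<in>UNIV. (cmod (B$k$j))\<^sup>2)"
    by (simp add: sum_product)
  also have "(\<Sum>j\<in>UNIV. \<Sum>k\<in>UNIV. (cmod (B$k$j))\<^sup>2) = (norm B)\<^sup>2"
    unfolding norm_matrix_power2 by (rule sum.swap)
  finally show "(norm (A ** B))\<^sup>2 \<le> (norm A * norm B)\<^sup>2"
    by (simp add: norm_matrix_power2 power_mult_distrib)
qed simp

lemma norm_matrix_vector_le: "norm (A *v v) \<le> norm A * norm v" for A :: "complex^'n^'m"
proof (rule power2_le_imp_le)
  have "(norm (A *v v))\<^sup>2 = (\<Sum>i\<in>UNIV. (cmod (\<Sum>k\<in>UNIV. A$i$k * v$k))\<^sup>2)"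
    by (simp add: norm_vector_power2 matrix_vector_mult_def)
  also have "\<dots> \<le> (\<Sum>i\<in>UNIV. (\<Sum>k\<in>UNIV. (cmod (A$i$k))\<^sup>2) * (\<Sum>k\<in>UNIV. (cmod (v$k))\<^sup>2))"
    by (intro sum_mono cauchy_schwarz_sum_complex)
  finally show "(norm (A *v v))\<^sup>2 \<le> (norm A * norm v)\<^sup>2"
    by (simp add: norm_matrix_power2 norm_vector_power2 power_mult_distrib sum_distrib_right)
qed simp

lemma matrix_mult_scaleR: "(r *\<^sub>R A) ** B = r *\<^sub>R (A ** B)" "A ** (r *\<^sub>R B) = r *\<^sub>R (A ** B)"
  for A :: "complex^'n^'m" and B :: "complex^'k^'n"
  by (simp_all add: matrix_matrix_mult_def vec_eq_iff scaleR_sum_right)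

lemma matrix_add_rdistrib_complex: "(A + B) ** C = A ** C + B ** (C :: complex^'k^'n)"
  by (simp add: matrix_matrix_mult_def vec_eq_iff sum.distrib distrib_right)

lemma bounded_bilinear_matrix_mult:
  "bounded_bilinear ((**) :: complex^'n^'m \<Rightarrow> complex^'k^'n \<Rightarrow> complex^'k^'m)"
  by (rule bounded_bilinear.intro)
     (auto simp: matrix_add_ldistrib matrix_add_rdistrib_complex matrix_mult_scaleR
        intro!: exI[of _ 1] norm_matrix_mult_le)

lemma bounded_bilinear_matrix_vector:
  "bounded_bilinear ((*v) :: complex^'n^'m \<Rightarrow> complex^'n \<Rightarrow> complex^'m)"
proof (rule bounded_bilinear.intro)
  show "(r *\<^sub>R A) *v v = r *\<^sub>R (A *v v)" "A *v (r *\<^sub>R v) = r *\<^sub>R (A *v v)" for r and A :: "complex^'n^'m" and v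
    by (simp_all add: matrix_vector_mult_def vec_eq_iff scaleR_sum_right)
  show "\<exists>K. \<forall>(A :: complex^'n^'m) v. norm (A *v v) \<le> norm A * norm v * K"
    by (intro exI[of _ 1]) (auto intro: norm_matrix_vector_le)
qed (auto simp: matrix_vector_mult_add_rdistrib matrix_vector_right_distrib)

interpretation mm: bounded_bilinear "(**) :: complex^'n^'m \<Rightarrow> complex^'k^'n \<Rightarrow> complex^'k^'m"
  by (rule bounded_bilinear_matrix_mult)

interpretation mv: bounded_bilinear "(*v) :: complex^'n^'m \<Rightarrow> complex^'n \<Rightarrow> complex^'m"
  by (rule bounded_bilinear_matrix_vector)

lemma norm_cscale: "norm (cscale z A) = cmod z * norm A"
proof (rule power2_eq_imp_eq)
  show "(norm (cscale z A))\<^sup>2 = (cmod z * norm A)\<^sup>2"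
    unfolding power_mult_distrib norm_matrix_power2
    by (simp add: cscale_def norm_mult power_mult_distrib sum_distrib_left)
qed auto

lemma cscale_simps [simp]:
  "cscale z (cscale w A) = cscale (z * w) A"
  "cscale 1 A = A" "cscale 0 A = 0" "cscale z 0 = 0"
  "(cscale z A) $ i $ j = z * A $ i $ j"
  by (simp_all add: cscale_def vec_eq_iff)

lemma cscale_add: "cscale z (A + B) = cscale z A + cscale z B"
  and cscale_diff: "cscale z (A - B) = cscale z A - cscale z B"
  and cscale_minus: "cscale z (- A) = - cscale z A"
  and cscale_add_left: "cscale (z + w) A = cscale z A + cscale w A"
  and cscale_diff_left: "cscale (z - w) A = cscale z A - cscale w A"
  and cscale_minus_left: "cscale (- z) A = - cscale z A"
  by (simp_all add: vec_eq_iff algebra_simps)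

lemma scaleR_cscale: "r *\<^sub>R A = cscale (of_real r) A"
  by (simp add: vec_eq_iff of_real_def)

lemma cscale_mult_left: "cscale z A ** B = cscale z (A ** B)"
  and cscale_mult_right: "A ** cscale z B = cscale z (A ** B)"
  by (simp_all add: vec_eq_iff matrix_matrix_mult_def sum_distrib_left algebra_simps)

lemma cscale_vector: "cscale z A *v v = z *s (A *v v)"
  by (simp add: vec_eq_iff matrix_vector_mult_def sum_distrib_left algebra_simps)

lemma matrix_vector_smult: "A *v (z *s v) = z *s (A *v v)" for A :: "complex^'n^'m"
  by (simp add: vec_eq_iff matrix_vector_mult_def sum_distrib_left algebra_simps)

lemma bounded_linear_cscale: "bounded_linear (cscale z)"
  by (rule bounded_linear_intro[of _ "cmod z"]) (auto simp: cscale_add norm_cscale scaleR_cscale mult_ac)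

lemma adj_nth [simp]: "adj A $ i $ j = cnj (A $ j $ i)" by (simp add: adj_def)

lemma adj_adj [simp]: "adj (adj A) = A" by (simp add: vec_eq_iff)
lemma adj_mult: "adj (A ** B) = adj B ** adj A" for A :: "complex^'n^'m" and B :: "complex^'k^'n"
  by (simp add: vec_eq_iff matrix_matrix_mult_def mult.commute)
lemma adj_add: "adj (A + B) = adj A + adj B"
  and adj_diff: "adj (A - B) = adj A - adj B"
  and adj_minus: "adj (- A) = - adj A"
  and adj_cscale: "adj (cscale z A) = cscale (cnj z) (adj A)"
  by (simp_all add: vec_eq_iff)
lemma adj_one [simp]: "adj (mat 1) = mat 1"
  by (simp add: vec_eq_iff mat_def)

lemma norm_adj [simp]: "norm (adj A) = norm A"
proof (rule power2_eq_imp_eq)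
  show "(norm (adj A))\<^sup>2 = (norm A)\<^sup>2"
    unfolding norm_matrix_power2 by (simp add: sum.swap[of "\<lambda>i j. (cmod (A $ j $ i))\<^sup>2"])
qed auto

lemma bounded_linear_adj: "bounded_linear adj"
  by (rule bounded_linear_intro[of _ 1]) (auto simp: adj_add adj_cscale scaleR_cscale)

definition diag :: "('n \<Rightarrow> complex) \<Rightarrow> complex^'n^'n" where
  "diag f = (\<chi> i j. if i = j then f i else 0)"

lemma diag_mult_nth [simp]: "(diag f ** A) $ i $ j = f i * A $ i $ j"
  and mult_diag_nth [simp]: "(B ** diag f) $ k $ i = B $ k $ i * f i"
  by (simp_all add: diag_def matrix_matrix_mult_def if_distrib if_distribR cong: if_cong)

lemma diag_mult_diag: "diag f ** diag g = diag (\<lambda>i. f i * g i)"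
  unfolding vec_eq_iff diag_mult_nth by (simp add: diag_def)
lemma adj_diag: "adj (diag f) = diag (\<lambda>i. cnj (f i))"
  by (simp add: vec_eq_iff diag_def)
lemma cscale_diag: "cscale z (diag f) = diag (\<lambda>i. z * f i)"
  by (simp add: vec_eq_iff diag_def)
lemma diag_add: "diag f + diag g = diag (\<lambda>i. f i + g i)"
  and diag_diff: "diag f - diag g = diag (\<lambda>i. f i - g i)"
  and diag_minus: "- diag f = diag (\<lambda>i. - f i)"
  by (simp_all add: vec_eq_iff diag_def)
lemma diag_1: "mat 1 = diag (\<lambda>_. 1)"
  by (simp add: vec_eq_iff diag_def mat_def)

lemma norm_diag_mult_le:
  assumes "\<And>i. cmod (f i) \<le> K" shows "norm (diag f ** A) \<le> K * norm A"
proof (rule power2_le_imp_le)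
  have K: "K \<ge> 0" using assms order_trans[OF norm_ge_zero] by blast
  have "(norm (diag f ** A))\<^sup>2 = (\<Sum>i\<in>UNIV. \<Sum>j\<in>UNIV. (cmod (f i))\<^sup>2 * (cmod (A $ i $ j))\<^sup>2)"
    by (simp add: norm_matrix_power2 norm_mult power_mult_distrib)
  also have "\<dots> \<le> (\<Sum>i\<in>UNIV. \<Sum>j\<in>UNIV. K\<^sup>2 * (cmod (A $ i $ j))\<^sup>2)"
    using assms K by (intro sum_mono mult_right_mono power_mono) auto
  also have "\<dots> = (K * norm A)\<^sup>2"
    by (simp add: norm_matrix_power2 power_mult_distrib sum_distrib_left)
  finally show "(norm (diag f ** A))\<^sup>2 \<le> (K * norm A)\<^sup>2" .
  show "0 \<le> K * norm A" using K by simp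
qed

text \<open>
  The diagonal of the signature matrix \<open>sg = \<i> J\<close>.
\<close>

definition sg_fun :: "'r + 'r \<Rightarrow> complex" where
  "sg_fun i = (case i of Inl _ \<Rightarrow> 1 | Inr _ \<Rightarrow> -1)"

definition sg :: "complex^('r::finite + 'r)^('r + 'r)" where "sg = diag sg_fun"

lemma sg_fun_simps [simp]: "sg_fun (Inl a) = 1" "sg_fun (Inr a) = -1" "sg_fun i * sg_fun i = 1"
  "cnj (sg_fun i) = sg_fun i" "cmod (sg_fun i) = 1"
  by (auto simp: sg_fun_def split: sum.splits)

lemma P1_diag: "P1 = diag (\<lambda>i. (1 + sg_fun i) / 2)"
  and P2_diag: "P2 = diag (\<lambda>i. (1 - sg_fun i) / 2)"
  and J_diag: "J_mat = diag (\<lambda>i. - \<i> * sg_fun i)"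
  by (auto simp: P1_def P2_def J_mat_def diag_def block_def vec_eq_iff mat_def sg_fun_def split: sum.splits)

lemma sg_sg: "sg ** sg = mat 1" by (simp add: sg_def diag_mult_diag diag_1)
lemma sg_sg_mult [simp]: "sg ** (sg ** A) = A" by (simp add: matrix_mul_assoc sg_sg)
lemma adj_sg [simp]: "adj sg = sg" by (simp add: sg_def adj_diag)
lemma J_sg: "J_mat = cscale (- \<i>) sg" by (simp add: J_diag sg_def cscale_diag)

lemma norm_sg_mult [simp]: "norm (sg ** A) = norm A"
proof (rule power2_eq_imp_eq)
  show "(norm (sg ** A))\<^sup>2 = (norm A)\<^sup>2"
    unfolding norm_matrix_power2 by (simp add: sg_def norm_mult)
qed auto

lemma norm_mult_sg [simp]: "norm (A ** sg) = norm A"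
  using norm_sg_mult[of "adj A"] by (metis adj_mult adj_sg norm_adj)

section \<open>Linear differential equations with integrable coefficients\<close>

lemma absolutely_integrable_mult_continuous:
  fixes G :: "real \<Rightarrow> complex^'n^'m" and Z :: "real \<Rightarrow> complex^'k^'n"
  assumes G: "G absolutely_integrable_on {-1..1}" and Z: "continuous_on {-1..1} Z"
  shows "(\<lambda>x. G x ** Z x) absolutely_integrable_on {-1..1}"
proof -
  have bl: "bilinear (\<lambda>(Z :: complex^'k^'n) (G :: complex^'n^'m). G ** Z)"
    using bounded_bilinear.flip[OF bounded_bilinear_matrix_mult] by (simp add: bilinear_conv_bounded_bilinear)
  show ?thesis
    by (rule absolutely_integrable_bounded_measurable_product[OF bl])
       (use G Z in \<open>auto intro!: continuous_imp_measurable_on_sets_lebesgue compact_imp_bounded compact_continuous_image\<close>)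
qed

text \<open>
  Picard iteration. With \<open>S\<close> a primitive of \<open>norm \<circ> G\<close>, the integral operator halves the norm that is
  weighted by \<open>exp (- 2 S)\<close>, so the series of the iterates converges on the whole interval although
  \<open>G\<close> is unbounded.
\<close>

lemma linear_ode_exists:
  fixes G :: "real \<Rightarrow> complex^'n^'n"
  assumes G: "G absolutely_integrable_on {-1..1}"
  obtains Z where "ac_deriv Z (\<lambda>x. G x ** Z x)" "Z (-1) = mat 1"
proof -
  define I1 where "I1 = (mat 1 :: complex^'n^'n)"
  define Zk where "Zk = rec_nat (\<lambda>x. I1) (\<lambda>_ Z x. integral {-1..x} (\<lambda>t. G t ** Z t))"
  have Z0: "Zk 0 = (\<lambda>x. I1)" and ZS: "Zk (Suc n) = (\<lambda>x. integral {-1..x} (\<lambda>t. G t ** Zk n t))" for n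
    by (simp_all add: Zk_def)
  define S where "S x = integral {-1..x} (\<lambda>t. norm (G t))" for x
  have nG: "(\<lambda>t. norm (G t)) absolutely_integrable_on {-1..1}" by (rule absolutely_integrable_norm[OF G, unfolded o_def])
  have S: "ac_deriv S (\<lambda>t. norm (G t))" using ac_deriv_integral[OF nG, of 0] by (simp add: S_def[abs_def])
  have cont: "continuous_on {-1..1} (Zk n)" for n
  proof (induction n)
    case (Suc n)
    have "ac_deriv (\<lambda>x. 0 + integral {-1..x} (\<lambda>t. G t ** Zk n t)) (\<lambda>t. G t ** Zk n t)"
      by (rule ac_deriv_integral[OF absolutely_integrable_mult_continuous[OF G Suc]])
    then show ?case using ac_deriv_continuous_on by (fastforce simp: ZS)
  qed (simp add: Z0)
  have int: "(\<lambda>t. G t ** Zk n t) absolutely_integrable_on {-1..1}" for n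
    by (rule absolutely_integrable_mult_continuous[OF G cont])
  have sub: "f integrable_on {-1..x}" if "f absolutely_integrable_on {-1..1}" "x \<in> {-1..1}" for x and f :: "real \<Rightarrow> 'z::euclidean_space"
    using that absolutely_integrable_on_def integrable_on_subinterval[of f "{-1..1}" "-1" x] by force
  have bound: "norm (Zk n x) \<le> norm I1 * exp (2 * S x) / 2 ^ n" if "x \<in> {-1..1}" for n x
    using that
  proof (induction n arbitrary: x)
    case 0
    have "0 \<le> S x" unfolding S_def by (rule integral_nonneg[OF sub[OF nG 0]]) simp
    then have "norm I1 * 1 \<le> norm I1 * exp (2 * S x)" by (intro mult_left_mono) auto
    then show ?case by (simp add: Z0)
  next
    case (Suc n)
    define c where "c = norm I1 / 2 ^ Suc n"
    have E: "ac_deriv (\<lambda>x. c * exp (2 * S x)) (\<lambda>x. c * (2 * norm (G x) * exp (2 * S x)))"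
      by (intro ac_deriv_linear[OF bounded_linear_mult_right] ac_deriv_exp S)
    \<comment> \<open>the majorant is an exact derivative, which is the reason for the exponential weight\<close>
    have hi: "((\<lambda>x. c * (2 * norm (G x) * exp (2 * S x))) has_integral (c * exp (2 * S x) - c * exp (2 * S (-1)))) {-1..x}"
      using ac_deriv_FTC(2)[OF E, of "-1" x] Suc.prems by simp
    have "norm (Zk (Suc n) x) \<le> integral {-1..x} (\<lambda>x. c * (2 * norm (G x) * exp (2 * S x)))"
      unfolding ZS
    proof (rule integral_norm_bound_integral)
      show "(\<lambda>t. G t ** Zk n t) integrable_on {-1..x}" by (rule sub[OF int Suc.prems])
      show "(\<lambda>x. c * (2 * norm (G x) * exp (2 * S x))) integrable_on {-1..x}" using hi by blast
      fix t assume t: "t \<in> {-1..x}"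
      have "norm (G t ** Zk n t) \<le> norm (G t) * norm (Zk n t)" by (rule norm_matrix_mult_le)
      also have "\<dots> \<le> norm (G t) * (norm I1 * exp (2 * S t) / 2 ^ n)"
        using Suc.IH[of t] t Suc.prems by (intro mult_left_mono) auto
      also have "\<dots> = c * (2 * norm (G t) * exp (2 * S t))" by (simp add: c_def)
      finally show "norm (G t ** Zk n t) \<le> c * (2 * norm (G t) * exp (2 * S t))" .
    qed
    also have "\<dots> = c * exp (2 * S x) - c * exp (2 * S (-1))" using hi by (rule integral_unique)
    also have "\<dots> \<le> c * exp (2 * S x)" by (simp add: c_def)
    finally show ?case by (simp add: c_def)
  qed
  have "continuous_on {-1..1} S" using ac_deriv_continuous_on[OF S] .
  then obtain B where B: "\<And>x. x \<in> {-1..1} \<Longrightarrow> norm I1 * exp (2 * S x) \<le> B"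
  proof -
    assume *: "continuous_on {-1..1} S" and that: "\<And>B. (\<And>x. x \<in> {-1..1} \<Longrightarrow> norm I1 * exp (2 * S x) \<le> B) \<Longrightarrow> thesis"
    have "continuous_on {-1..1} (\<lambda>x. norm I1 * exp (2 * S x))" by (intro continuous_intros *)
    then have "bounded ((\<lambda>x. norm I1 * exp (2 * S x)) ` {-1..1})"
      by (intro compact_imp_bounded compact_continuous_image) auto
    then obtain B where "\<forall>z\<in>(\<lambda>x. norm I1 * exp (2 * S x)) ` {-1..1}. norm z \<le> B" unfolding bounded_iff by blast
    then show thesis by (intro that[of B]) auto
  qed
  have bnd: "norm (Zk n x) \<le> B * (1/2) ^ n" if "x \<in> {-1..1}" for n x
  proof -
    have "norm (Zk n x) \<le> norm I1 * exp (2 * S x) / 2 ^ n" by (rule bound[OF that])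
    also have "\<dots> \<le> B / 2 ^ n" using B[OF that] by (intro divide_right_mono) auto
    finally show ?thesis by (simp add: power_one_over)
  qed
  have B0: "B \<ge> 0" using bnd[of 0 0] order_trans[OF norm_ge_zero] by fastforce
  have sB: "summable (\<lambda>n. B * (1/2::real) ^ n)" by (intro summable_mult summable_geometric) simp
  define Z where "Z x = (\<Sum>n. Zk n x)" for x
  have ul: "uniform_limit {-1..1} (\<lambda>N x. \<Sum>n<N. Zk n x) Z sequentially"
    unfolding Z_def[abs_def] by (rule Weierstrass_m_test[OF bnd sB])
  have Zc: "continuous_on {-1..1} Z"
    by (rule uniform_limit_theorem[OF _ ul]) (auto intro!: always_eventually continuous_on_sum cont)
  have GZ: "(\<lambda>t. G t ** Z t) absolutely_integrable_on {-1..1}"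
    by (rule absolutely_integrable_mult_continuous[OF G Zc])
  have lim: "(\<lambda>N. \<Sum>n<N. Zk n x) \<longlonglongrightarrow> Z x" if "x \<in> {-1..1}" for x
    using tendsto_uniform_limitI[OF ul that] .
  have eq: "Z x = I1 + integral {-1..x} (\<lambda>t. G t ** Z t)" if x: "x \<in> {-1..1}" for x
  proof -
    have ci: "(\<lambda>t. G t ** (\<Sum>n<N. Zk n t)) integrable_on {-1..x}" for N
      by (rule sub[OF absolutely_integrable_mult_continuous[OF G] x]) (auto intro!: continuous_on_sum cont)
    have 1: "(\<lambda>N. integral {-1..x} (\<lambda>t. G t ** (\<Sum>n<N. Zk n t))) \<longlonglongrightarrow> integral {-1..x} (\<lambda>t. G t ** Z t)"
    proof (rule dominated_convergence(2))
      show "(\<lambda>t. G t ** (\<Sum>n<N. Zk n t)) integrable_on {-1..x}" for N by (rule ci)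
      show "(\<lambda>t. norm (G t) * (2 * B)) integrable_on {-1..x}"
        by (rule integrable_on_mult_left[OF sub[OF nG x]])
      show "norm (G t ** (\<Sum>n<N. Zk n t)) \<le> norm (G t) * (2 * B)" if t: "t \<in> {-1..x}" for N t
      proof -
        have "norm (\<Sum>n<N. Zk n t) \<le> (\<Sum>n<N. B * (1/2) ^ n)"
          by (rule order_trans[OF norm_sum sum_mono]) (rule bnd, use t x in auto)
        also have "\<dots> \<le> (\<Sum>n. B * (1/2::real) ^ n)" using B0 by (intro sum_le_suminf sB) auto
        also have "\<dots> = 2 * B" by (simp add: suminf_mult suminf_geometric)
        finally show ?thesis
          by (intro order_trans[OF norm_matrix_mult_le] mult_left_mono) auto
      qed
      show "(\<lambda>N. G t ** (\<Sum>n<N. Zk n t)) \<longlonglongrightarrow> G t ** Z t" if t: "t \<in> {-1..x}" for t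
        by (rule mm.tendsto[OF tendsto_const lim]) (use t x in auto)
    qed
    have 2: "integral {-1..x} (\<lambda>t. G t ** (\<Sum>n<N. Zk n t)) = (\<Sum>n<N. Zk (Suc n) x)" for N
    proof -
      have "integral {-1..x} (\<lambda>t. G t ** (\<Sum>n<N. Zk n t)) = integral {-1..x} (\<lambda>t. \<Sum>n<N. G t ** Zk n t)"
        by (simp add: mm.sum_right)
      also have "\<dots> = (\<Sum>n<N. integral {-1..x} (\<lambda>t. G t ** Zk n t))"
        by (rule integral_sum) (auto intro: sub[OF int x])
      finally show ?thesis by (simp add: ZS)
    qed
    have "(\<lambda>N. \<Sum>n<Suc N. Zk n x) \<longlonglongrightarrow> Z x" using lim[OF x] by (rule LIMSEQ_Suc)
    then have "(\<lambda>N. I1 + (\<Sum>n<N. Zk (Suc n) x)) \<longlonglongrightarrow> Z x"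
      by (simp add: sum.lessThan_Suc_shift Z0 del: sum.lessThan_Suc)
    moreover have "(\<lambda>N. I1 + (\<Sum>n<N. Zk (Suc n) x)) \<longlonglongrightarrow> I1 + integral {-1..x} (\<lambda>t. G t ** Z t)"
      using 1 unfolding 2 by (intro tendsto_intros)
    ultimately show ?thesis by (rule LIMSEQ_unique)
  qed
  show thesis
  proof (rule that)
    show "ac_deriv Z (\<lambda>x. G x ** Z x)"
      by (rule ac_deriv_cong[OF ac_deriv_integral[OF GZ, of I1]]) (auto simp: eq)
    show "Z (-1) = mat 1" using eq[of "-1"] by (simp add: I1_def)
  qed
qed

text \<open>
  The mean value inequality for the oriented integral between \<open>s\<close> and \<open>t\<close>; the bound is integrated over
  the whole interval to avoid a distinction of cases in the applications.
\<close>

lemma ac_deriv_diff_bound: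
  fixes V :: "real \<Rightarrow> 'a::euclidean_space"
  assumes V: "ac_deriv V D" and st: "s \<in> {-1..1}" "t \<in> {-1..1}"
    and le: "\<And>x. x \<in> {min s t..max s t} \<Longrightarrow> norm (D x) \<le> k x"
    and k: "k integrable_on {-1..1}" and k0: "\<And>x. x \<in> {-1..1} \<Longrightarrow> 0 \<le> k x"
  shows "norm (V t - V s) \<le> integral {-1..1} k"
proof -
  have *: "norm (V t - V s) \<le> integral {-1..1} k"
    if st: "-1 \<le> s" "s \<le> t" "t \<le> 1" and le: "\<And>x. x \<in> {s..t} \<Longrightarrow> norm (D x) \<le> k x" for s t
  proof -
    have hi: "(D has_integral (V t - V s)) {s..t}" by (rule ac_deriv_FTC(2)[OF V st])
    have kst: "k integrable_on {s..t}" using k st integrable_on_subinterval[of k "{-1..1}" s t] by auto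
    have "norm (V t - V s) = norm (integral {s..t} D)" using hi by (simp add: integral_unique)
    also have "\<dots> \<le> integral {s..t} k"
      using hi kst le by (intro integral_norm_bound_integral) auto
    also have "\<dots> \<le> integral {-1..1} k"
      using st by (intro integral_subset_le kst k) (auto intro: k0)
    finally show ?thesis .
  qed
  show ?thesis
  proof (cases "s \<le> t")
    case True then show ?thesis using * st le by (auto simp: min_def max_def)
  next
    case False then show ?thesis using *[of t s] st le by (auto simp: min_def max_def norm_minus_commute)
  qed
qed

text \<open>
  The radial retraction onto the ball of radius \<open>n\<close>.
\<close>

definition clamp_norm :: "real \<Rightarrow> 'a::real_normed_vector \<Rightarrow> 'a" where
  "clamp_norm n v = (n / max n (norm v)) *\<^sub>R v"

lemma clamp_norm:
  assumes "n > 0"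
  shows "norm (clamp_norm n v) \<le> n" "norm (clamp_norm n v) \<le> norm v" "norm v \<le> n \<Longrightarrow> clamp_norm n v = v"
    "continuous_on UNIV (clamp_norm n)"
proof -
  show "norm (clamp_norm n v) \<le> n" using assms by (simp add: clamp_norm_def field_simps max_def)
  show "norm (clamp_norm n v) \<le> norm v" using assms by (simp add: clamp_norm_def field_simps max_def mult_right_mono)
  show "norm v \<le> n \<Longrightarrow> clamp_norm n v = v" using assms by (simp add: clamp_norm_def)
  show "continuous_on UNIV (clamp_norm n)" unfolding clamp_norm_def[abs_def]
    using assms by (intro continuous_intros) (auto simp: max_def)
qed

text \<open>
  Large values are cut off at a small cost in the mean. The bounded function so obtained is almost
  everywhere the limit of uniformly bounded continuous functions, and these are approximated uniformly
  by polynomials.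
\<close>

lemma L1_polynomial_approximation:
  fixes q :: "real \<Rightarrow> 'a::euclidean_space"
  assumes q: "q absolutely_integrable_on {-1..1}" and e: "e > 0"
  obtains p where "polynomial_function p" "integral {-1..1} (\<lambda>x. norm (q x - p x)) < e"
proof -
  define Q where "Q x = (if x \<in> {-1..1} then q x else 0)" for x
  have qi: "q integrable_on {-1..1}" using q absolutely_integrable_on_def by blast
  have nq: "(\<lambda>x. norm (q x)) integrable_on {-1..1}" using q absolutely_integrable_on_def by blast
  have "Q integrable_on UNIV" unfolding Q_def integrable_restrict_UNIV by (rule qi)
  then have "Q integrable_on cbox a b" for a b by (rule integrable_on_subcbox) simp
  then have "Q measurable_on UNIV" by (rule integrable_subintervals_imp_measurable)
  then obtain N g where N: "negligible N" and g: "\<And>k. continuous_on UNIV (g k)"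
    "\<And>x. x \<notin> N \<Longrightarrow> (\<lambda>k. g k x) \<longlonglongrightarrow> Q x"
    unfolding measurable_on_def by auto
  have qm: "q \<in> borel_measurable (lebesgue_on {-1..1})"
    by (rule absolutely_integrable_imp_borel_measurable[OF q]) simp
  have cmeas: "(\<lambda>x. clamp_norm n (q x)) \<in> borel_measurable (lebesgue_on {-1..1})" if "n > 0" for n
    using borel_measurable_continuous_onI[OF clamp_norm(4)[OF that]] qm by (rule measurable_compose[rotated])
  have cint: "(\<lambda>x. clamp_norm n (q x)) absolutely_integrable_on {-1..1}" if "n > 0" for n
    by (rule measurable_bounded_by_integrable_imp_absolutely_integrable[OF cmeas[OF that] _ nq])
       (auto intro: clamp_norm(2)[OF that])
  have nrm: "(\<lambda>x. norm (f x - h x)) integrable_on {-1..1}"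
    if "f absolutely_integrable_on {-1..1}" "h absolutely_integrable_on {-1..1}" for f h :: "real \<Rightarrow> 'a"
    using absolutely_integrable_norm[OF set_integral_diff(1)[OF that]] by (simp add: o_def absolutely_integrable_on_def)
  have "(\<lambda>n. integral {-1..1} (\<lambda>x. norm (q x - clamp_norm (real (Suc n)) (q x)))) \<longlonglongrightarrow> integral {-1..1} (\<lambda>x::real. 0)"
  proof (rule dominated_convergence(2)[where h="\<lambda>x. 2 * norm (q x)"])
    show "(\<lambda>x. norm (q x - clamp_norm (real (Suc n)) (q x))) integrable_on {-1..1}" for n
      by (rule nrm[OF q cint]) simp
    show "(\<lambda>x. 2 * norm (q x)) integrable_on {-1..1}" by (rule integrable_on_mult_right[OF nq])
    show "norm (norm (q x - clamp_norm (real (Suc n)) (q x))) \<le> 2 * norm (q x)" for n x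
      using norm_triangle_ineq4[of "q x" "clamp_norm (real (Suc n)) (q x)"] clamp_norm(2)[of "real (Suc n)" "q x"] by simp
    show "(\<lambda>n. norm (q x - clamp_norm (real (Suc n)) (q x))) \<longlonglongrightarrow> 0" for x
    proof -
      obtain m :: nat where m: "norm (q x) \<le> real m" using real_arch_simple by blast
      have "norm (q x - clamp_norm (real (Suc n)) (q x)) = 0" if "n \<ge> m" for n
        using clamp_norm(3)[of "real (Suc n)" "q x"] m that by simp
      then show ?thesis by (intro tendsto_eventually eventually_sequentiallyI[of m]) auto
    qed
  qed
  then have "eventually (\<lambda>n. integral {-1..1} (\<lambda>x. norm (q x - clamp_norm (real (Suc n)) (q x))) < e/3) sequentially"
    using e by (intro order_tendstoD(2)) auto
  then obtain m where m: "integral {-1..1} (\<lambda>x. norm (q x - clamp_norm (real (Suc m)) (q x))) < e/3"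
    by (auto simp: eventually_sequentially)
  define n where "n = real (Suc m)"
  have n: "n > 0" by (simp add: n_def)
  have gc: "continuous_on {-1..1} (\<lambda>x. clamp_norm n (g k x))" for k
    by (rule continuous_on_compose2[OF clamp_norm(4)[OF n] continuous_on_subset[OF g(1)]]) auto
  define d where "d k x = (if x \<in> N then 0 else norm (clamp_norm n (q x) - clamp_norm n (g k x)))" for k x
  have d_int: "d k integrable_on {-1..1}"
    and d_eq: "integral {-1..1} (d k) = integral {-1..1} (\<lambda>x. norm (clamp_norm n (q x) - clamp_norm n (g k x)))" for k
  proof -
    have "(\<lambda>x. norm (clamp_norm n (q x) - clamp_norm n (g k x))) integrable_on {-1..1}"
      by (rule nrm[OF cint[OF n] absolutely_integrable_continuous_real[OF gc]])
    then show "d k integrable_on {-1..1}" by (rule integrable_spike[OF _ N]) (simp add: d_def)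
    show "integral {-1..1} (d k) = integral {-1..1} (\<lambda>x. norm (clamp_norm n (q x) - clamp_norm n (g k x)))"
      by (rule integral_spike[OF N]) (simp add: d_def)
  qed
  have "(\<lambda>k. integral {-1..1} (d k)) \<longlonglongrightarrow> integral {-1..1} (\<lambda>x::real. 0)"
  proof (rule dominated_convergence(2)[where h="\<lambda>x. 2*n"])
    show "norm (d k x) \<le> 2 * n" for k x
      using norm_triangle_ineq4[of "clamp_norm n (q x)" "clamp_norm n (g k x)"] clamp_norm(1)[OF n, of "q x"]
        clamp_norm(1)[OF n, of "g k x"] n by (simp add: d_def)
    fix x :: real assume x: "x \<in> {-1..1}"
    show "(\<lambda>k. d k x) \<longlonglongrightarrow> 0"
    proof (cases "x \<in> N")
      case False
      then have "(\<lambda>k. g k x) \<longlonglongrightarrow> q x" using g(2)[of x] x by (simp add: Q_def)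
      then have "(\<lambda>k. clamp_norm n (g k x)) \<longlonglongrightarrow> clamp_norm n (q x)"
        using continuous_on_tendsto_compose[OF clamp_norm(4)[OF n]] by auto
      then have "(\<lambda>k. norm (clamp_norm n (q x) - clamp_norm n (g k x))) \<longlonglongrightarrow> norm (clamp_norm n (q x) - clamp_norm n (q x))"
        by (intro tendsto_intros)
      then show ?thesis using False by (simp add: d_def)
    qed (simp add: d_def)
  qed (use d_int in auto)
  then have "eventually (\<lambda>k. integral {-1..1} (d k) < e/3) sequentially"
    using e by (intro order_tendstoD(2)) auto
  then have "eventually (\<lambda>k. integral {-1..1} (\<lambda>x. norm (clamp_norm n (q x) - clamp_norm n (g k x))) < e/3) sequentially"
    unfolding d_eq .
  then obtain k where k: "integral {-1..1} (\<lambda>x. norm (clamp_norm n (q x) - clamp_norm n (g k x))) < e/3"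
    by (auto simp: eventually_sequentially)
  obtain p where p: "polynomial_function p" "\<And>x. x \<in> {-1..1} \<Longrightarrow> norm (clamp_norm n (g k x) - p x) < e/6"
  proof -
    have e6: "e/6 > 0" using e by simp
    obtain p where "polynomial_function p \<and> (\<forall>x\<in>{-1..1}. norm (clamp_norm n (g k x) - p x) < e/6)"
      using Stone_Weierstrass_polynomial_function[OF compact_Icc gc e6] by blast
    then show thesis using that by blast
  qed
  have pa: "p absolutely_integrable_on {-1..1}"
    by (intro absolutely_integrable_continuous_real continuous_on_polymonial_function p)
  note ga = absolutely_integrable_continuous_real[OF gc]
  have "integral {-1..1} (\<lambda>x. norm (q x - p x)) \<le> integral {-1..1} (\<lambda>x. norm (q x - clamp_norm n (q x)) + (norm (clamp_norm n (q x) - clamp_norm n (g k x)) + e/6))"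
  proof (rule integral_le)
    fix x :: real assume "x \<in> {-1..1}"
    from p(2)[OF this] show "norm (q x - p x) \<le> norm (q x - clamp_norm n (q x)) + (norm (clamp_norm n (q x) - clamp_norm n (g k x)) + e/6)"
      using norm_triangle_ineq[of "q x - clamp_norm n (q x)" "clamp_norm n (q x) - p x"]
        norm_triangle_ineq[of "clamp_norm n (q x) - clamp_norm n (g k x)" "clamp_norm n (g k x) - p x"] by simp
  qed (intro integrable_add nrm q pa cint n ga integrable_const_ivl)+
  also have "\<dots> = integral {-1..1} (\<lambda>x. norm (q x - clamp_norm n (q x))) + (integral {-1..1} (\<lambda>x. norm (clamp_norm n (q x) - clamp_norm n (g k x))) + e/3)"
    by (subst integral_add; (subst integral_add)?; (intro integrable_add nrm q cint n ga integrable_const_ivl)?) simp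
  also have "\<dots> < e" using m k by (simp add: n_def)
  finally show thesis using p(1) that by blast
qed

section \<open>The Dirac system\<close>

text \<open>
  The matrix \<open>W = - \<i> \<sigma> Q\<close> as a real-linear function of the value of \<open>q\<close>.
\<close>

definition potential_lin :: "complex^'r^'r \<Rightarrow> complex^('r::finite + 'r)^('r + 'r)" where
  "potential_lin A = cscale (- \<i>) (sg ** block 0 A (adj A) 0)"

definition potential :: "(real \<Rightarrow> complex^'r^'r) \<Rightarrow> real \<Rightarrow> complex^('r::finite + 'r)^('r + 'r)" where
  "potential q x = potential_lin (q x)"

definition dirac_coeff :: "(real \<Rightarrow> complex^'r^'r) \<Rightarrow> complex \<Rightarrow> real \<Rightarrow> complex^('r::finite + 'r)^('r + 'r)" where
  "dirac_coeff q z x = cscale (\<i> * z) sg + potential q x"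

lemma adj_potential_lin [simp]: "adj (potential_lin A) = potential_lin A"
  by (auto simp: vec_eq_iff potential_lin_def sg_def block_def sg_fun_def split: sum.splits)

lemma adj_potential [simp]: "adj (potential q x) = potential q x" by (simp add: potential_def)

lemma sg_potential_lin: "sg ** potential_lin A = - (potential_lin A ** sg)"
  by (auto simp: vec_eq_iff potential_lin_def sg_def block_def sg_fun_def split: sum.splits)

lemma potential_lin_eq_iff: "potential_lin A = potential_lin B \<longleftrightarrow> A = B"
proof
  assume "potential_lin A = potential_lin B"
  then have "potential_lin A $ Inl i $ Inr j = potential_lin B $ Inl i $ Inr j" for i j by simp
  then show "A = B" by (simp add: potential_lin_def sg_def block_def vec_eq_iff)
qed simp

lemma bounded_linear_potential_lin: "bounded_linear potential_lin"
  unfolding linear_conv_bounded_linear[symmetric]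
  by (rule linearI) (auto simp: vec_eq_iff potential_lin_def sg_def block_def algebra_simps split: sum.splits)

lemma potential_integrable: "q absolutely_integrable_on {-1..1} \<Longrightarrow> potential q absolutely_integrable_on {-1..1}"
  using absolutely_integrable_linear[OF _ bounded_linear_potential_lin, where f=q] by (simp add: o_def potential_def[abs_def])

lemma dirac_coeff_integrable: "q absolutely_integrable_on {-1..1} \<Longrightarrow> dirac_coeff q z absolutely_integrable_on {-1..1}"
  unfolding dirac_coeff_def[abs_def]
  by (rule set_integral_add(1)[OF absolutely_integrable_continuous_real[OF continuous_on_const] potential_integrable])

lemma Lp_fun_imp_integrable:
  fixes q :: "real \<Rightarrow> 'a::euclidean_space"
  assumes p: "1 \<le> p" and q: "q \<in> Lp_fun p"
  shows "q absolutely_integrable_on {-1..1}"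
  unfolding integrable_leb_I_iff[symmetric]
proof (rule Bochner_Integration.integrable_bound)
  have fm: "finite_measure leb_I" by (rule finite_measureI) (simp add: emeasure_restrict_space)
  show "integrable leb_I (\<lambda>x. 1 + norm (q x) powr p)"
    using q by (intro Bochner_Integration.integrable_add finite_measure.integrable_const[OF fm]) (auto simp: Lp_fun_def)
  show "q \<in> borel_measurable leb_I" using q by (simp add: Lp_fun_def)
  have "t \<le> 1 + t powr p" if "0 \<le> t" for t :: real
  proof (cases "t \<le> 1")
    case False
    then have "t powr 1 \<le> t powr p" using p by (intro powr_mono) auto
    then show ?thesis using False by simp
  qed (simp add: add_increasing2)
  then show "AE x in leb_I. norm (q x) \<le> norm (1 + norm (q x) powr p)" by simp
qed

lemma Q_mat_potential: "Q_mat q x = cscale \<i> (sg ** potential q x)"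
  by (simp add: Q_mat_def potential_def potential_lin_def cscale_mult_right)

lemma dirac_matrix_iff: "J_mat ** Y' + Q_mat q x ** Y = cscale z Y \<longleftrightarrow> Y' = dirac_coeff q z x ** Y"
proof -
  have "J_mat ** Y' + Q_mat q x ** Y = cscale z Y \<longleftrightarrow> cscale (- \<i>) (sg ** Y') = cscale z Y - cscale \<i> (sg ** (potential q x ** Y))"
    by (simp add: J_sg Q_mat_potential cscale_mult_left matrix_mul_assoc eq_diff_eq)
  also have "\<dots> \<longleftrightarrow> Y' = cscale \<i> (sg ** (cscale z Y - cscale \<i> (sg ** (potential q x ** Y))))" (is "?l = ?r \<longleftrightarrow> _")
  proof
    assume *: "?l = ?r"
    have "cscale \<i> (sg ** ?l) = Y'" by (simp add: cscale_mult_right)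
    then show "Y' = cscale \<i> (sg ** ?r)" unfolding * by simp
  next
    assume *: "Y' = cscale \<i> (sg ** ?r)"
    show "?l = ?r" unfolding * by (simp add: cscale_mult_right)
  qed
  also have "cscale \<i> (sg ** (cscale z Y - cscale \<i> (sg ** (potential q x ** Y)))) = dirac_coeff q z x ** Y"
    by (simp add: dirac_coeff_def mm.diff_right mm.add_left cscale_mult_right cscale_mult_left cscale_diff cscale_minus_left)
  finally show ?thesis .
qed

lemma dirac_vector_iff: "J_mat *v y' + Q_mat q x *v y = z *s y \<longleftrightarrow> y' = dirac_coeff q z x *v y"
proof -
  define col where "col v = (\<chi> i (j::1). v $ i)" for v :: "complex^('a+'a)"
  have inj: "col v = col w \<longleftrightarrow> v = w" for v w by (auto simp: col_def vec_eq_iff)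
  have mult: "A ** col v = col (A *v v)" for A :: "complex^('a+'a)^('a+'a)" and v
    by (simp add: col_def vec_eq_iff matrix_matrix_mult_def matrix_vector_mult_def)
  have add: "col v + col w = col (v + w)" "cscale z (col v) = col (z *s v)" for v w
    by (simp_all add: col_def vec_eq_iff)
  show ?thesis using dirac_matrix_iff[of "col y'" q x "col y" z] by (simp add: mult add inj)
qed

lemma is_fund_solution_iff:
  "is_fund_solution q z Y \<longleftrightarrow> ac_deriv Y (\<lambda>x. dirac_coeff q z x ** Y x) \<and> Y 0 = mat 1"
proof
  assume L: "is_fund_solution q z Y"
  then have "AE x in leb_I. vector_derivative Y (at x) = dirac_coeff q z x ** Y x"
    unfolding is_fund_solution_def dirac_matrix_iff by simp
  with W11_ac_deriv[of Y] L show "ac_deriv Y (\<lambda>x. dirac_coeff q z x ** Y x) \<and> Y 0 = mat 1"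
    using ac_deriv_cong[of Y _ Y] by (auto simp: is_fund_solution_def)
next
  assume R: "ac_deriv Y (\<lambda>x. dirac_coeff q z x ** Y x) \<and> Y 0 = mat 1"
  then show "is_fund_solution q z Y"
    using ac_deriv_AE_vector_derivative[of Y] ac_deriv_W11[of Y] unfolding is_fund_solution_def dirac_matrix_iff by blast
qed

text \<open>
  The potential drops out because \<open>W\<close> is hermitian and anticommutes with \<open>\<sigma>\<close>.
\<close>

lemma dirac_coeff_wronskian: "adj (dirac_coeff q w x) ** sg + sg ** dirac_coeff q z x = cscale (\<i> * (z - cnj w)) (mat 1)"
proof -
  have 0: "potential q x ** sg + sg ** potential q x = 0" by (simp add: potential_def sg_potential_lin)
  have "adj (dirac_coeff q w x) ** sg + sg ** dirac_coeff q z x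
      = (cscale (\<i> * z) (mat 1) + cscale (- (\<i> * cnj w)) (mat 1)) + (potential q x ** sg + sg ** potential q x)"
    by (simp add: dirac_coeff_def adj_add adj_cscale mm.add_left mm.add_right cscale_mult_left cscale_mult_right sg_sg add_ac)
  from this[unfolded 0] show ?thesis by (simp add: algebra_simps flip: cscale_add_left)
qed

text \<open>
  The Lagrange identity, for matrix solutions with arbitrary numbers of columns.
\<close>

lemma wronskian_matrix:
  assumes V: "ac_deriv V (\<lambda>x. dirac_coeff q w x ** V x)" and Y: "ac_deriv Y (\<lambda>x. dirac_coeff q z x ** Y x)"
  shows "ac_deriv (\<lambda>x. adj (V x) ** (sg ** Y x)) (\<lambda>x. cscale (\<i> * (z - cnj w)) (adj (V x) ** Y x))"
proof -
  have 1: "ac_deriv (\<lambda>x. adj (V x)) (\<lambda>x. adj (dirac_coeff q w x ** V x))" by (rule ac_deriv_linear[OF bounded_linear_adj V])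
  have 2: "ac_deriv (\<lambda>x. sg ** Y x) (\<lambda>x. sg ** (dirac_coeff q z x ** Y x))"
    by (rule ac_deriv_linear[OF mm.bounded_linear_right Y])
  have eq: "adj (V x) ** (sg ** (dirac_coeff q z x ** Y x)) + adj (dirac_coeff q w x ** V x) ** (sg ** Y x)
      = cscale (\<i> * (z - cnj w)) (adj (V x) ** Y x)" for x
  proof -
    have "adj (V x) ** (sg ** (dirac_coeff q z x ** Y x)) + adj (dirac_coeff q w x ** V x) ** (sg ** Y x)
      = adj (V x) ** ((adj (dirac_coeff q w x) ** sg + sg ** dirac_coeff q z x) ** Y x)"
      by (simp add: adj_mult matrix_mul_assoc mm.add_left mm.add_right)
    then show ?thesis by (simp add: dirac_coeff_wronskian cscale_mult_left cscale_mult_right)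
  qed
  show ?thesis by (rule ac_deriv_cong[OF ac_deriv_bilinear[OF bounded_bilinear_matrix_mult 1 2] refl]) (simp add: eq)
qed

lemma wronskian_vector:
  assumes V: "ac_deriv V (\<lambda>x. dirac_coeff q w x ** V x)" and y: "ac_deriv y (\<lambda>x. dirac_coeff q z x *v y x)"
  shows "ac_deriv (\<lambda>x. adj (V x) *v (sg *v y x)) (\<lambda>x. (\<i> * (z - cnj w)) *s (adj (V x) *v y x))"
proof -
  have 1: "ac_deriv (\<lambda>x. adj (V x)) (\<lambda>x. adj (dirac_coeff q w x ** V x))" by (rule ac_deriv_linear[OF bounded_linear_adj V])
  have 2: "ac_deriv (\<lambda>x. sg *v y x) (\<lambda>x. sg *v (dirac_coeff q z x *v y x))"
    by (rule ac_deriv_linear[OF mv.bounded_linear_right y])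
  have eq: "adj (V x) *v (sg *v (dirac_coeff q z x *v y x)) + adj (dirac_coeff q w x ** V x) *v (sg *v y x)
      = (\<i> * (z - cnj w)) *s (adj (V x) *v y x)" for x
  proof -
    have "adj (V x) *v (sg *v (dirac_coeff q z x *v y x)) + adj (dirac_coeff q w x ** V x) *v (sg *v y x)
      = adj (V x) *v ((adj (dirac_coeff q w x) ** sg + sg ** dirac_coeff q z x) *v y x)"
      by (simp add: adj_mult matrix_vector_mul_assoc matrix_mul_assoc mv.add_left mv.add_right)
    then show ?thesis by (simp add: dirac_coeff_wronskian cscale_vector matrix_vector_smult)
  qed
  show ?thesis by (rule ac_deriv_cong[OF ac_deriv_bilinear[OF bounded_bilinear_matrix_vector 1 2] refl]) (simp add: eq)
qed

text \<open>
  By the Lagrange identity the solution that is normalised at \<open>-1\<close> is invertible at \<open>0\<close>, so it can be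
  normalised there instead.
\<close>

lemma fund_solution_exists:
  fixes q :: "real \<Rightarrow> complex^'r::finite^'r"
  assumes q: "q absolutely_integrable_on {-1..1}"
  shows "is_fund_solution q z (fund_solution q z)"
proof -
  obtain Z where Z: "ac_deriv Z (\<lambda>x. dirac_coeff q z x ** Z x)" "Z (-1) = mat 1"
    using linear_ode_exists[OF dirac_coeff_integrable[OF q]] by blast
  obtain V where V: "ac_deriv V (\<lambda>x. dirac_coeff q (cnj z) x ** V x)" "V (-1) = mat 1"
    using linear_ode_exists[OF dirac_coeff_integrable[OF q]] by blast
  have "ac_deriv (\<lambda>x. adj (V x) ** (sg ** Z x)) (\<lambda>x. 0)" using wronskian_matrix[OF V(1) Z(1)] by simp
  from ac_deriv_const_derivative_zero[OF this, of 0 "-1"] V(2) Z(2) have "adj (V 0) ** (sg ** Z 0) = sg" by simp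
  then have "(sg ** adj (V 0) ** sg) ** Z 0 = mat 1" by (metis matrix_mul_assoc sg_sg)
  then obtain B where B: "Z 0 ** B = mat 1" using matrix_left_right_inverse by blast
  have "ac_deriv (\<lambda>x. Z x ** B) (\<lambda>x. (dirac_coeff q z x ** Z x) ** B)" by (rule ac_deriv_linear[OF mm.bounded_linear_left Z(1)])
  then have "is_fund_solution q z (\<lambda>x. Z x ** B)"
    unfolding is_fund_solution_iff using B by (simp add: matrix_mul_assoc)
  then show ?thesis unfolding fund_solution_def by (rule someI[of "is_fund_solution q z"])
qed

lemma fund_solution_ac_deriv:
  "q absolutely_integrable_on {-1..1} \<Longrightarrow> ac_deriv (fund_solution q z) (\<lambda>x. dirac_coeff q z x ** fund_solution q z x)"
  "q absolutely_integrable_on {-1..1} \<Longrightarrow> fund_solution q z 0 = mat 1"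
  using fund_solution_exists[of q z] by (auto simp: is_fund_solution_iff)

subsection \<open>Growth and dependence on the spectral parameter\<close>

text \<open>
  Only the imaginary part of \<open>z\<close> contributes to the growth of the energy \<open>|Z|\<^sup>2\<close>, since \<open>\<sigma>\<close> is hermitian. This
  gives the exponent \<open>|Im z|\<close>, instead of \<open>|z|\<close>, in all estimates below.
\<close>

lemma inner_cscale_sg_le:
  fixes Z :: "complex^'k^('r::finite + 'r)"
  shows "\<bar>Z \<bullet> cscale (\<i> * z) (sg ** Z)\<bar> \<le> \<bar>Im z\<bar> * (norm Z)\<^sup>2"
proof -
  have e: "\<bar>c \<bullet> (\<i> * z * (sg_fun i * c))\<bar> \<le> \<bar>Im z\<bar> * (cmod c)\<^sup>2" for c :: complex and i :: "'r + 'r"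
  proof (cases i)
    case (Inl a)
    have "c \<bullet> (\<i> * z * (sg_fun i * c)) = - Im z * (cmod c)\<^sup>2"
      by (simp add: Inl inner_complex_def cmod_def algebra_simps power2_eq_square)
    then show ?thesis by (simp add: abs_mult)
  next
    case (Inr a)
    have "c \<bullet> (\<i> * z * (sg_fun i * c)) = Im z * (cmod c)\<^sup>2"
      by (simp add: Inr inner_complex_def cmod_def algebra_simps power2_eq_square)
    then show ?thesis by (simp add: abs_mult)
  qed
  have "\<bar>Z \<bullet> cscale (\<i> * z) (sg ** Z)\<bar> = \<bar>\<Sum>i\<in>UNIV. \<Sum>j\<in>UNIV. Z $ i $ j \<bullet> (\<i> * z * (sg_fun i * Z $ i $ j))\<bar>"
    by (simp add: inner_vec_def sg_def)
  also have "\<dots> \<le> (\<Sum>i\<in>UNIV. \<Sum>j\<in>UNIV. \<bar>Im z\<bar> * (cmod (Z $ i $ j))\<^sup>2)"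
    by (intro order_trans[OF sum_abs] sum_mono e)
  also have "\<dots> = \<bar>Im z\<bar> * (norm Z)\<^sup>2" by (simp add: norm_matrix_power2 sum_distrib_left)
  finally show ?thesis .
qed

definition potential_mass :: "(real \<Rightarrow> complex^'r::finite^'r) \<Rightarrow> real" where
  "potential_mass q = integral {-1..1} (\<lambda>x. norm (potential q x))"

lemma potential_mass_nonneg: "q absolutely_integrable_on {-1..1} \<Longrightarrow> 0 \<le> potential_mass q"
  unfolding potential_mass_def using potential_integrable[of q]
  by (intro integral_nonneg) (auto simp: absolutely_integrable_on_def)

lemma dirac_growth:
  fixes Z :: "real \<Rightarrow> complex^'k^('r::finite + 'r)"
  assumes q: "q absolutely_integrable_on {-1..1}" and Z: "ac_deriv Z (\<lambda>x. dirac_coeff q z x ** Z x)"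
    and st: "s \<in> {-1..1}" "t \<in> {-1..1}"
  shows "norm (Z t) \<le> exp (\<bar>Im z\<bar> * \<bar>t - s\<bar> + potential_mass q) * norm (Z s)"
proof -
  define k where "k x = \<bar>Im z\<bar> + norm (potential q x)" for x
  have nW: "(\<lambda>x. norm (potential q x)) absolutely_integrable_on {-1..1}"
    using absolutely_integrable_norm[OF potential_integrable[OF q]] by (simp add: o_def)
  have k: "k absolutely_integrable_on {-1..1}" unfolding k_def
    by (rule set_integral_add(1)[OF absolutely_integrable_continuous_real[OF continuous_on_const] nW])
  have "norm (Z t) \<le> exp \<bar>integral {-1..t} k - integral {-1..s} k\<bar> * norm (Z s)"
  proof (rule ac_deriv_norm_growth[OF Z k _ st], rule AE_I2)
    fix x
    have "\<bar>Z x \<bullet> (dirac_coeff q z x ** Z x)\<bar> \<le> \<bar>Z x \<bullet> cscale (\<i> * z) (sg ** Z x)\<bar> + \<bar>Z x \<bullet> (potential q x ** Z x)\<bar>"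
      by (simp add: dirac_coeff_def mm.add_left cscale_mult_left inner_add_right)
    also have "\<dots> \<le> \<bar>Im z\<bar> * (norm (Z x))\<^sup>2 + norm (Z x) * (norm (potential q x) * norm (Z x))"
      by (intro add_mono inner_cscale_sg_le order_trans[OF Cauchy_Schwarz_ineq2] mult_left_mono norm_matrix_mult_le norm_ge_zero)
    finally show "\<bar>Z x \<bullet> (dirac_coeff q z x ** Z x)\<bar> \<le> k x * (norm (Z x))\<^sup>2"
      by (simp add: k_def algebra_simps power2_eq_square)
  qed
  also have "\<bar>integral {-1..t} k - integral {-1..s} k\<bar> \<le> \<bar>Im z\<bar> * \<bar>t - s\<bar> + potential_mass q"
  proof -
    have *: "\<bar>integral {-1..t} k - integral {-1..s} k\<bar> \<le> \<bar>Im z\<bar> * \<bar>t - s\<bar> + potential_mass q" if "-1 \<le> s" "s \<le> t" "t \<le> 1" for s t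
    proof -
      have nWi: "(\<lambda>x. norm (potential q x)) integrable_on {-1..1}" using nW absolutely_integrable_on_def by blast
      have ki: "k integrable_on {-1..1}" using k absolutely_integrable_on_def by blast
      have nWst: "(\<lambda>x. norm (potential q x)) integrable_on {s..t}" by (rule integrable_on_subinterval[OF nWi]) (use that in auto)
      have "integral {-1..s} k + integral {s..t} k = integral {-1..t} k"
        using that by (intro Henstock_Kurzweil_Integration.integral_combine integrable_on_subinterval[OF ki]) auto
      then have "integral {-1..t} k - integral {-1..s} k = integral {s..t} k" by simp
      also have "\<dots> = \<bar>Im z\<bar> * (t - s) + integral {s..t} (\<lambda>x. norm (potential q x))"
        unfolding k_def using that nWst by (subst integral_add) auto
      finally have eq: "integral {-1..t} k - integral {-1..s} k = \<bar>Im z\<bar> * (t - s) + integral {s..t} (\<lambda>x. norm (potential q x))" .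
      have "0 \<le> integral {s..t} (\<lambda>x. norm (potential q x))" by (rule integral_nonneg[OF nWst]) simp
      moreover have "integral {s..t} (\<lambda>x. norm (potential q x)) \<le> potential_mass q"
        unfolding potential_mass_def using that by (intro integral_subset_le nWst nWi) auto
      ultimately show ?thesis unfolding eq using that by simp
    qed
    show ?thesis
    proof (cases "s \<le> t")
      case True then show ?thesis using *[of s t] st by simp
    next
      case False then show ?thesis using *[of t s] st by (simp add: abs_minus_commute)
    qed
  qed
  finally show ?thesis by (simp add: mult_right_mono)
qed

lemma field_derivative_quadratic_bound:
  fixes f :: "complex \<Rightarrow> complex"
  assumes "\<And>w. cmod (w - z) < 1 \<Longrightarrow> cmod (f w - f z - D * (w - z)) \<le> C * (cmod (w - z))\<^sup>2"
  shows "(f has_field_derivative D) (at z)"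
  unfolding has_field_derivative_def has_derivative_at_alt
proof (intro conjI allI impI bounded_linear_mult_right)
  fix e :: real assume e: "e > 0"
  define d where "d = min 1 (e / (\<bar>C\<bar> + 1))"
  have d: "d > 0" using e by (auto simp: d_def)
  have "cmod (f w - f z - D * (w - z)) \<le> e * cmod (w - z)" if w: "cmod (w - z) < d" for w
  proof -
    have "cmod (f w - f z - D * (w - z)) \<le> C * (cmod (w - z))\<^sup>2" using w by (intro assms) (auto simp: d_def)
    also have "\<dots> \<le> ((\<bar>C\<bar> + 1) * cmod (w - z)) * cmod (w - z)"
      by (auto simp: power2_eq_square mult.assoc intro!: mult_right_mono)
    also have "(\<bar>C\<bar> + 1) * cmod (w - z) \<le> e" using w by (auto simp: d_def field_simps)
    finally show ?thesis by (simp add: mult_right_mono)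
  qed
  with d show "\<exists>d>0. \<forall>w. cmod (w - z) < d \<longrightarrow> cmod (f w - f z - D * (w - z)) \<le> e * cmod (w - z)" by blast
qed

context
  fixes q :: "real \<Rightarrow> complex^'r::finite^'r"
  assumes q: "q absolutely_integrable_on {-1..1}"
begin

lemma fund_solution_growth:
  assumes "x \<in> {-1..1}"
  shows "norm (fund_solution q z x) \<le> norm (mat 1 :: complex^('r+'r)^('r+'r)) * exp (potential_mass q) * exp (\<bar>Im z\<bar> * \<bar>x\<bar>)"
  using dirac_growth[OF q fund_solution_ac_deriv(1)[OF q], of 0 x z] assms
  by (simp add: fund_solution_ac_deriv(2)[OF q] exp_add mult_ac)

text \<open>
  For conjugate parameters the right-hand side of the Lagrange identity vanishes.
\<close>

lemma fund_solution_symplectic: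
  assumes "x \<in> {-1..1}"
  shows "adj (fund_solution q (cnj z) x) ** (sg ** fund_solution q z x) = sg"
proof -
  have "ac_deriv (\<lambda>x. adj (fund_solution q (cnj z) x) ** (sg ** fund_solution q z x)) (\<lambda>x. 0)"
    using wronskian_matrix[OF fund_solution_ac_deriv(1)[OF q, of "cnj z"] fund_solution_ac_deriv(1)[OF q, of z]] by simp
  from ac_deriv_const_derivative_zero[OF this, of x 0] assms show ?thesis by (simp add: fund_solution_ac_deriv(2)[OF q])
qed

lemma fund_solution_inverse:
  assumes "x \<in> {-1..1}"
  shows "(sg ** adj (fund_solution q (cnj z) x) ** sg) ** fund_solution q z x = mat 1"
    "fund_solution q z x ** (sg ** adj (fund_solution q (cnj z) x) ** sg) = mat 1"
proof -
  show "(sg ** adj (fund_solution q (cnj z) x) ** sg) ** fund_solution q z x = mat 1"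
    using fund_solution_symplectic[OF assms, of z] by (metis matrix_mul_assoc sg_sg)
  then show "fund_solution q z x ** (sg ** adj (fund_solution q (cnj z) x) ** sg) = mat 1"
    by (simp add: matrix_left_right_inverse)
qed

lemma fund_solution_vector_unique:
  assumes y: "ac_deriv y (\<lambda>x. dirac_coeff q z x *v y x)" and x: "x \<in> {-1..1}"
  shows "y x = fund_solution q z x *v y 0"
proof -
  have "ac_deriv (\<lambda>x. adj (fund_solution q (cnj z) x) *v (sg *v y x)) (\<lambda>x. 0)"
    using wronskian_vector[OF fund_solution_ac_deriv(1)[OF q, of "cnj z"] y] by simp
  from ac_deriv_const_derivative_zero[OF this, of x 0] x
  have "adj (fund_solution q (cnj z) x) *v (sg *v y x) = sg *v y 0" by (simp add: fund_solution_ac_deriv(2)[OF q])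
  then have "fund_solution q z x *v (sg *v (adj (fund_solution q (cnj z) x) *v (sg *v y x))) = fund_solution q z x *v (sg *v (sg *v y 0))" by simp
  then show ?thesis using fund_solution_inverse(2)[OF x, of z]
    by (simp add: matrix_vector_mul_assoc matrix_mul_assoc sg_sg)
qed

lemma fund_solution_continuous: "continuous_on {-1..1} (fund_solution q z)"
  using ac_deriv_continuous_on[OF fund_solution_ac_deriv(1)[OF q]] .

lemma fund_solution_locally_bounded:
  obtains B where "B \<ge> 0" "\<And>w x. cmod (w - z) < 1 \<Longrightarrow> x \<in> {-1..1} \<Longrightarrow> norm (fund_solution q w x) \<le> B"
    "\<And>x. x \<in> {-1..1} \<Longrightarrow> norm (fund_solution q (cnj z) x) \<le> B"
proof -
  define B where "B = norm (mat 1 :: complex^('r+'r)^('r+'r)) * exp (potential_mass q) * exp (\<bar>Im z\<bar> + 1)"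
  have bound: "norm (fund_solution q w x) \<le> B" if "\<bar>Im w\<bar> \<le> \<bar>Im z\<bar> + 1" "x \<in> {-1..1}" for w x
  proof -
    have "\<bar>Im w\<bar> * \<bar>x\<bar> \<le> (\<bar>Im z\<bar> + 1) * 1" using that by (intro mult_mono) auto
    then have "norm (mat 1 :: complex^('r+'r)^('r+'r)) * exp (potential_mass q) * exp (\<bar>Im w\<bar> * \<bar>x\<bar>) \<le> B"
      unfolding B_def by (intro mult_left_mono) auto
    then show ?thesis using fund_solution_growth[OF that(2), of w] by linarith
  qed
  show thesis
  proof (rule that[of B])
    show "B \<ge> 0" by (simp add: B_def)
    show "norm (fund_solution q (cnj z) x) \<le> B" if "x \<in> {-1..1}" for x using that by (intro bound) auto
    fix w :: complex and x :: real assume w: "cmod (w - z) < 1" and x: "x \<in> {-1..1}"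
    have "\<bar>Im (w - z)\<bar> < 1" using abs_Im_le_cmod[of "w - z"] w by linarith
    then show "norm (fund_solution q w x) \<le> B" by (intro bound x) auto
  qed
qed

text \<open>
  With \<open>\<omega> = Y(x, cnj z)\<^sup>* \<sigma> Y(x,w)\<close> one has \<open>Y(x,w) - Y(x,z) = Y(x,z) \<sigma> (\<omega> - \<sigma>)\<close>, and by the Lagrange identity
  \<open>\<omega> - \<sigma>\<close> is \<open>w - z\<close> times a bounded integral.
\<close>

lemma fund_solution_Lipschitz:
  obtains C where "C \<ge> 0" "\<And>w x. cmod (w - z) < 1 \<Longrightarrow> x \<in> {-1..1} \<Longrightarrow> norm (fund_solution q w x - fund_solution q z x) \<le> C * cmod (w - z)"
proof -
  obtain B where B: "B \<ge> 0" "\<And>w x. cmod (w - z) < 1 \<Longrightarrow> x \<in> {-1..1} \<Longrightarrow> norm (fund_solution q w x) \<le> B"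
    "\<And>x. x \<in> {-1..1} \<Longrightarrow> norm (fund_solution q (cnj z) x) \<le> B"
    using fund_solution_locally_bounded[of z] by metis
  show thesis
  proof (rule that[of "B * (2 * (B * B))"])
    show "0 \<le> B * (2 * (B * B))" using B by simp
    fix w :: complex and x :: real assume w: "cmod (w - z) < 1" and x: "x \<in> {-1..1}"
    define om where "om x = adj (fund_solution q (cnj z) x) ** (sg ** fund_solution q w x)" for x
    have om: "ac_deriv om (\<lambda>x. cscale (\<i> * (w - z)) (adj (fund_solution q (cnj z) x) ** fund_solution q w x))"
      using wronskian_matrix[OF fund_solution_ac_deriv(1)[OF q, of "cnj z"] fund_solution_ac_deriv(1)[OF q, of w]]
      by (simp add: om_def[abs_def])
    have "norm (om x - om 0) \<le> integral {-1..1} (\<lambda>x::real. cmod (w - z) * (B * B))"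
    proof (rule ac_deriv_diff_bound[OF om])
      fix t assume "t \<in> {min 0 x..max 0 x}"
      then have t: "t \<in> {-1..1}" using x by (auto simp: min_def max_def split: if_splits)
      have "norm (adj (fund_solution q (cnj z) t) ** fund_solution q w t) \<le> B * B"
        by (rule order_trans[OF norm_matrix_mult_le]) (use B t w in \<open>auto intro!: mult_mono\<close>)
      then show "norm (cscale (\<i> * (w - z)) (adj (fund_solution q (cnj z) t) ** fund_solution q w t)) \<le> cmod (w - z) * (B * B)"
        by (simp add: norm_cscale norm_mult mult_left_mono)
    qed (use x B in auto)
    then have 1: "norm (om x - sg) \<le> cmod (w - z) * (2 * (B * B))"
      by (simp add: om_def fund_solution_ac_deriv(2)[OF q] algebra_simps)
    have "fund_solution q z x ** (sg ** (om x - sg)) = fund_solution q w x - fund_solution q z x"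
    proof -
      have "fund_solution q z x ** (sg ** om x) = (fund_solution q z x ** (sg ** adj (fund_solution q (cnj z) x) ** sg)) ** fund_solution q w x"
        by (simp add: om_def matrix_mul_assoc)
      also have "\<dots> = fund_solution q w x" by (simp add: fund_solution_inverse(2)[OF x])
      finally show ?thesis by (simp add: mm.diff_right sg_sg)
    qed
    then have "norm (fund_solution q w x - fund_solution q z x) \<le> norm (fund_solution q z x) * norm (om x - sg)"
      using norm_matrix_mult_le[of "fund_solution q z x" "sg ** (om x - sg)"] by simp
    also have "\<dots> \<le> B * (cmod (w - z) * (2 * (B * B)))" using B(1) B(2)[of z, OF _ x] 1 by (intro mult_mono) auto
    finally show "norm (fund_solution q w x - fund_solution q z x) \<le> B * (2 * (B * B)) * cmod (w - z)" by (simp add: mult_ac)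
  qed
qed

text \<open>
  The formula behind the Lipschitz estimate also identifies the derivative with respect to \<open>z\<close>: it is
  \<open>\<i> Y(x,z) \<sigma>\<close> times the integral of \<open>Y(t, cnj z)\<^sup>* Y(t,z)\<close> from \<open>0\<close> to \<open>x\<close>.
\<close>

lemma fund_solution_holomorphic:
  assumes x: "x \<in> {-1..1}"
  shows "(\<lambda>z. fund_solution q z x $ i $ j) holomorphic_on UNIV"
proof -
  have "\<exists>D. ((\<lambda>z. fund_solution q z x $ i $ j) has_field_derivative D) (at z)" for z
  proof -
    obtain B where B: "B \<ge> 0" "\<And>w x. cmod (w - z) < 1 \<Longrightarrow> x \<in> {-1..1} \<Longrightarrow> norm (fund_solution q w x) \<le> B"
      "\<And>x. x \<in> {-1..1} \<Longrightarrow> norm (fund_solution q (cnj z) x) \<le> B"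
      using fund_solution_locally_bounded[of z] by metis
    obtain C where C: "C \<ge> 0" "\<And>w x. cmod (w - z) < 1 \<Longrightarrow> x \<in> {-1..1} \<Longrightarrow> norm (fund_solution q w x - fund_solution q z x) \<le> C * cmod (w - z)"
      using fund_solution_Lipschitz[of z] by metis
    define F where "F t = adj (fund_solution q (cnj z) t) ** fund_solution q z t" for t
    have F: "ac_deriv (\<lambda>x. 0 + integral {-1..x} F) F"
      unfolding F_def[abs_def]
      by (intro ac_deriv_integral absolutely_integrable_continuous_real continuous_intros mm.continuous_on
          fund_solution_continuous bounded_linear.continuous_on[OF bounded_linear_adj])
    define H where "H x = integral {-1..x} F" for x
    have H: "ac_deriv H F" using F by (simp add: H_def[abs_def])
    define D where "D = fund_solution q z x ** (sg ** cscale \<i> (H x - H 0))"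
    have main: "norm (fund_solution q w x - fund_solution q z x - cscale (w - z) D) \<le> B * (2 * (B * C)) * (cmod (w - z))\<^sup>2"
      if w: "cmod (w - z) < 1" for w
    proof -
      define om where "om x = adj (fund_solution q (cnj z) x) ** (sg ** fund_solution q w x)" for x
      have om: "ac_deriv om (\<lambda>x. cscale (\<i> * (w - z)) (adj (fund_solution q (cnj z) x) ** fund_solution q w x))"
        using wronskian_matrix[OF fund_solution_ac_deriv(1)[OF q, of "cnj z"] fund_solution_ac_deriv(1)[OF q, of w]]
        by (simp add: om_def[abs_def])
      have V: "ac_deriv (\<lambda>x. om x + cscale (- (\<i> * (w - z))) (H x))
         (\<lambda>x. cscale (\<i> * (w - z)) (adj (fund_solution q (cnj z) x) ** fund_solution q w x) + cscale (- (\<i> * (w - z))) (F x))"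
        by (intro ac_deriv_add om ac_deriv_linear[OF bounded_linear_cscale] H)
      have "norm ((om x + cscale (- (\<i> * (w - z))) (H x)) - (om 0 + cscale (- (\<i> * (w - z))) (H 0)))
          \<le> integral {-1..1} (\<lambda>x::real. cmod (w - z) * (B * (C * cmod (w - z))))"
      proof (rule ac_deriv_diff_bound[OF V])
        fix t assume "t \<in> {min 0 x..max 0 x}"
        then have t: "t \<in> {-1..1}" using x by (auto simp: min_def max_def split: if_splits)
        have "norm (adj (fund_solution q (cnj z) t) ** (fund_solution q w t - fund_solution q z t)) \<le> B * (C * cmod (w - z))"
          by (rule order_trans[OF norm_matrix_mult_le]) (use B C t w in \<open>auto intro!: mult_mono\<close>)
        moreover have "cscale (\<i> * (w - z)) (adj (fund_solution q (cnj z) t) ** fund_solution q w t) + cscale (- (\<i> * (w - z))) (F t)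
            = cscale (\<i> * (w - z)) (adj (fund_solution q (cnj z) t) ** (fund_solution q w t - fund_solution q z t))"
          by (simp only: F_def mm.diff_right cscale_diff cscale_minus_left) simp
        ultimately show "norm (cscale (\<i> * (w - z)) (adj (fund_solution q (cnj z) t) ** fund_solution q w t) + cscale (- (\<i> * (w - z))) (F t))
            \<le> cmod (w - z) * (B * (C * cmod (w - z)))"
          by (simp only: norm_cscale norm_mult) (simp add: mult_left_mono)
      qed (use x B C in auto)
      moreover have "(om x + cscale (- (\<i> * (w - z))) (H x)) - (om 0 + cscale (- (\<i> * (w - z))) (H 0))
         = (om x - sg) - cscale (w - z) (cscale \<i> (H x - H 0))"
        by (simp add: om_def fund_solution_ac_deriv(2)[OF q] cscale_diff cscale_minus_left mult.commute)
      ultimately have 1: "norm ((om x - sg) - cscale (w - z) (cscale \<i> (H x - H 0))) \<le> 2 * (B * C) * (cmod (w - z))\<^sup>2"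
        by (simp add: power2_eq_square mult_ac)
      have "fund_solution q z x ** (sg ** ((om x - sg) - cscale (w - z) (cscale \<i> (H x - H 0))))
         = fund_solution q w x - fund_solution q z x - cscale (w - z) D"
      proof -
        have "fund_solution q z x ** (sg ** om x) = (fund_solution q z x ** (sg ** adj (fund_solution q (cnj z) x) ** sg)) ** fund_solution q w x"
          by (simp add: om_def matrix_mul_assoc)
        also have "\<dots> = fund_solution q w x" by (simp add: fund_solution_inverse(2)[OF x])
        finally show ?thesis by (simp add: mm.diff_right sg_sg D_def cscale_mult_right)
      qed
      then have "norm (fund_solution q w x - fund_solution q z x - cscale (w - z) D)
          \<le> norm (fund_solution q z x) * norm ((om x - sg) - cscale (w - z) (cscale \<i> (H x - H 0)))"
        by (metis norm_matrix_mult_le norm_sg_mult)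
      also have "\<dots> \<le> B * (2 * (B * C) * (cmod (w - z))\<^sup>2)" using B(1) B(2)[of z, OF _ x] 1 by (intro mult_mono) auto
      finally show ?thesis by (simp add: mult_ac)
    qed
    have "((\<lambda>z. fund_solution q z x $ i $ j) has_field_derivative D $ i $ j) (at z)"
    proof (rule field_derivative_quadratic_bound)
      fix w assume w: "cmod (w - z) < 1"
      have "cmod ((fund_solution q w x - fund_solution q z x - cscale (w - z) D) $ i $ j) \<le> norm (fund_solution q w x - fund_solution q z x - cscale (w - z) D)"
        by (meson Finite_Cartesian_Product.norm_nth_le order_trans)
      with main[OF w] show "cmod (fund_solution q w x $ i $ j - fund_solution q z x $ i $ j - D $ i $ j * (w - z)) \<le> B * (2 * (B * C)) * (cmod (w - z))\<^sup>2"
        by (simp add: mult.commute)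
    qed
    then show ?thesis by blast
  qed
  then show ?thesis unfolding holomorphic_on_def field_differentiable_def by simp
qed

end

subsection \<open>Asymptotics for large spectral parameter\<close>

text \<open>
  The fundamental solution for \<open>q = 0\<close>.
\<close>

definition free_solution :: "complex \<Rightarrow> real \<Rightarrow> complex^('r::finite + 'r)^('r + 'r)" where
  "free_solution z x = diag (\<lambda>i. exp (\<i> * z * of_real x * sg_fun i))"

lemma free_solution_add: "free_solution z x ** free_solution z y = free_solution z (x + y)"
  by (simp add: free_solution_def diag_mult_diag algebra_simps flip: exp_add)

lemma free_solution_0 [simp]: "free_solution z 0 = mat 1" by (simp add: free_solution_def diag_1)

lemma free_solution_sg: "free_solution z x ** sg = sg ** free_solution z x"
  by (simp add: free_solution_def sg_def diag_mult_diag mult.commute)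

lemma norm_free_solution_mult_le:
  fixes A :: "complex^'k^('r::finite + 'r)"
  shows "norm (free_solution z x ** A) \<le> exp (\<bar>Im z\<bar> * \<bar>x\<bar>) * norm A"
  unfolding free_solution_def
proof (rule norm_diag_mult_le)
  fix i :: "'r + 'r"
  have "Re (\<i> * z * of_real x * sg_fun i) \<le> \<bar>Im z\<bar> * \<bar>x\<bar>"
    by (cases i) (simp_all flip: abs_mult)
  then show "cmod (exp (\<i> * z * of_real x * sg_fun i)) \<le> exp (\<bar>Im z\<bar> * \<bar>x\<bar>)"
    by simp
qed

lemma ac_deriv_cexp: "ac_deriv (\<lambda>x. exp (c * of_real x)) (\<lambda>x. c * exp (c * of_real x))" for c :: complex
proof (rule ac_deriv_C1)
  show "((\<lambda>x. exp (c * complex_of_real x)) has_vector_derivative c * exp (c * of_real x)) (at x)" for x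
    by (rule has_vector_derivative_real_field) (auto intro!: derivative_eq_intros)
qed (intro continuous_intros)

lemma bounded_linear_cscale_left: "bounded_linear (\<lambda>c. cscale c A)"
  by (rule bounded_linear_intro[of _ "norm A"]) (auto simp: cscale_add_left norm_cscale scaleR_cscale scaleR_conv_of_real)

lemma ac_deriv_Ez: "ac_deriv (\<lambda>x. free_solution z (- x)) (\<lambda>x. cscale (- (\<i> * z)) (sg ** free_solution z (- x)))"
proof -
  have free_solution: "free_solution z (- x) = cscale (exp (- (\<i> * z) * of_real x)) P1 + cscale (exp ((\<i> * z) * of_real x)) P2" for x
    unfolding free_solution_def P1_diag P2_diag cscale_diag diag_add
    by (auto simp: vec_eq_iff diag_def sg_fun_def split: sum.splits)
  have 1: "ac_deriv (\<lambda>x. free_solution z (- x)) (\<lambda>x. cscale (- (\<i> * z) * exp (- (\<i> * z) * of_real x)) P1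
     + cscale ((\<i> * z) * exp ((\<i> * z) * of_real x)) P2)"
    unfolding free_solution by (intro ac_deriv_add ac_deriv_linear[OF bounded_linear_cscale_left] ac_deriv_cexp)
  have 2: "cscale (- (\<i> * z) * exp (- (\<i> * z) * of_real x)) P1 + cscale ((\<i> * z) * exp ((\<i> * z) * of_real x)) P2
     = cscale (- (\<i> * z)) (sg ** free_solution z (- x))" for x
    unfolding free_solution_def P1_diag P2_diag sg_def diag_mult_diag cscale_diag diag_add
    by (auto simp: vec_eq_iff diag_def sg_fun_def split: sum.splits)
  show ?thesis by (rule ac_deriv_cong[OF 1 refl]) (simp only: 2, simp)
qed

text \<open>
  Let \<open>W\<^sub>p\<close> belong to a polynomial \<open>p\<close> close to \<open>q\<close> in the mean, and put \<open>T = \<sigma> W\<^sub>p / (2\<i>)\<close>. Then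
  \<open>\<i> (T \<sigma> - \<sigma> T) = - W\<^sub>p\<close>, so for the modified solution \<open>(1 + T/z) Y\<close> the potential \<open>W\<close> is replaced by
  \<open>W - W\<^sub>p\<close>, which is small in the mean, up to terms of order \<open>1/z\<close>. Variation of constants with the free
  solution then estimates \<open>Y\<close>. No regularity of \<open>q\<close> enters, only the differentiability of \<open>p\<close>.
\<close>

lemma fund_solution_asymptotics:
  fixes q :: "real \<Rightarrow> complex^'r::finite^'r"
  assumes q: "q absolutely_integrable_on {-1..1}" and x: "x \<in> {-1..1}" and e: "e > 0"
  obtains R where "R > 0" "\<And>z. cmod z \<ge> R \<Longrightarrow> norm (fund_solution q z x - free_solution z x) \<le> e * exp (\<bar>Im z\<bar> * \<bar>x\<bar>)"
proof -
  define L where "L = norm (mat 1 :: complex^('r+'r)^('r+'r)) * exp (potential_mass q)"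
  have L0: "L \<ge> 0" by (simp add: L_def)
  have YL: "norm (fund_solution q z t) \<le> L * exp (\<bar>Im z\<bar> * \<bar>t\<bar>)" if "t \<in> {-1..1}" for z t
    using fund_solution_growth[OF q that] by (simp add: L_def)
  obtain \<beta> where \<beta>: "\<And>A. norm (potential_lin A :: complex^('r+'r)^('r+'r)) \<le> norm A * \<beta>" "\<beta> \<ge> 0"
    using bounded_linear.nonneg_bounded[OF bounded_linear_potential_lin] by metis
  define \<delta> where "\<delta> = e / (2 * (L * \<beta> + 1))"
  have Lb: "L * \<beta> \<ge> 0" using L0 \<beta>(2) by simp
  have \<delta>: "\<delta> > 0" "L * \<beta> * \<delta> \<le> e/2" using e Lb by (auto simp: \<delta>_def field_simps)
  obtain p where p: "polynomial_function p" "integral {-1..1} (\<lambda>x. norm (q x - p x)) < \<delta>"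
    using L1_polynomial_approximation[OF q \<delta>(1)] by metis
  obtain p' where p': "polynomial_function p'" "\<And>x. (p has_vector_derivative p' x) (at x)"
    using has_vector_derivative_polynomial_function[OF p(1)] by metis
  define Wp where "Wp t = (potential_lin (p t) :: complex^('r+'r)^('r+'r))" for t
  define T where "T t = cscale (- \<i> / 2) (sg ** Wp t)" for t
  define T' where "T' t = cscale (- \<i> / 2) (sg ** (potential_lin (p' t) :: complex^('r+'r)^('r+'r)))" for t
  have cp: "continuous_on {-1..1} p" "continuous_on {-1..1} p'" using p(1) p'(1) by (auto intro: continuous_on_polymonial_function)
  have blT: "bounded_linear (\<lambda>A. cscale (- \<i> / 2) (sg ** (potential_lin A :: complex^('r+'r)^('r+'r))))"
    by (intro bounded_linear_compose[OF bounded_linear_cscale] bounded_linear_compose[OF mm.bounded_linear_right] bounded_linear_potential_lin)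
  have "ac_deriv p p'" using ac_deriv_C1[of p p'] p'(2) cp by blast
  from ac_deriv_linear[OF blT this] have accT: "ac_deriv T T'" by (simp add: T_def[abs_def] T'_def[abs_def] Wp_def[abs_def])
  have cT: "continuous_on {-1..1} T" "continuous_on {-1..1} T'"
    unfolding T_def[abs_def] T'_def[abs_def] Wp_def[abs_def]
    by (rule bounded_linear.continuous_on[OF blT]; rule cp)+
  obtain b where b: "\<And>t. t \<in> {-1..1} \<Longrightarrow> norm (T t) \<le> b" "\<And>t. t \<in> {-1..1} \<Longrightarrow> norm (T' t) \<le> b"
  proof -
    have "bounded (T ` {-1..1} \<union> T' ` {-1..1})"
      using cT by (intro bounded_Un[THEN iffD2] conjI compact_imp_bounded compact_continuous_image) auto
    then obtain b where "\<forall>v\<in>T ` {-1..1} \<union> T' ` {-1..1}. norm v \<le> b" unfolding bounded_iff by blast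
    then show thesis by (intro that[of b]) auto
  qed
  have b0: "b \<ge> 0" using b(1)[of 0] order_trans[OF norm_ge_zero] by auto
  have comm: "cscale \<i> (T t ** sg) - cscale \<i> (sg ** T t) = - Wp t" for t
  proof -
    have "Wp t ** sg = - (sg ** Wp t)" unfolding Wp_def sg_potential_lin by simp
    then have "sg ** Wp t ** sg = - Wp t" by (simp add: mm.minus_right flip: matrix_mul_assoc)
    then have "cscale \<i> (T t ** sg) = cscale (- (1/2)) (Wp t)" "cscale \<i> (sg ** T t) = cscale (1/2) (Wp t)"
      by (simp_all add: T_def mm.minus_left mm.minus_right cscale_mult_left cscale_mult_right cscale_minus cscale_minus_left)
    then show ?thesis by (simp flip: cscale_diff_left) (simp add: cscale_minus_left)
  qed
  define M where "M = L * (2 * b + b * potential_mass q) + b * L + b"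
  have M0: "M \<ge> 0" using L0 b0 potential_mass_nonneg[OF q] by (simp add: M_def)
  have main: "norm (fund_solution q z x - free_solution z x) \<le> exp (\<bar>Im z\<bar> * \<bar>x\<bar>) * (L * \<beta> * \<delta> + M / cmod z)" if z: "z \<noteq> 0" for z
  proof -
    define Y where "Y = fund_solution q z"
    have Y: "ac_deriv Y (\<lambda>t. dirac_coeff q z t ** Y t)" "Y 0 = mat 1" using fund_solution_ac_deriv[OF q] by (auto simp: Y_def)
    define U where "U t = Y t + cscale (1/z) (T t ** Y t)" for t
    have U: "ac_deriv U (\<lambda>t. dirac_coeff q z t ** Y t + cscale (1/z) (T t ** (dirac_coeff q z t ** Y t) + T' t ** Y t))"
      unfolding U_def[abs_def]
      by (intro ac_deriv_add Y ac_deriv_linear[OF bounded_linear_cscale] ac_deriv_bilinear[OF bounded_bilinear_matrix_mult] accT)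
    define R0 where "R0 t = (potential q t - Wp t) + cscale (1/z) (T' t + T t ** potential q t)" for t
    have eq: "free_solution z (- t) ** (dirac_coeff q z t ** Y t + cscale (1/z) (T t ** (dirac_coeff q z t ** Y t) + T' t ** Y t))
       + cscale (- (\<i> * z)) (sg ** free_solution z (- t)) ** U t = free_solution z (- t) ** (R0 t ** Y t)" for t
    proof -
      have "dirac_coeff q z t ** Y t + cscale (1/z) (T t ** (dirac_coeff q z t ** Y t) + T' t ** Y t) + cscale (- (\<i> * z)) (sg ** U t)
         = potential q t ** Y t + (cscale \<i> (T t ** sg) - cscale \<i> (sg ** T t)) ** Y t + cscale (1/z) (T' t ** Y t + T t ** (potential q t ** Y t))"
        using z by (simp add: dirac_coeff_def U_def mm.add_left mm.add_right mm.diff_left cscale_mult_left cscale_mult_right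
            cscale_add cscale_diff cscale_minus_left matrix_mul_assoc)
      also have "\<dots> = R0 t ** Y t"
        unfolding comm by (simp add: R0_def mm.add_left mm.diff_left mm.minus_left cscale_mult_left matrix_mul_assoc cscale_add)
      finally have 1: "dirac_coeff q z t ** Y t + cscale (1/z) (T t ** (dirac_coeff q z t ** Y t) + T' t ** Y t) + cscale (- (\<i> * z)) (sg ** U t)
         = R0 t ** Y t" .
      have 2: "cscale (- (\<i> * z)) (sg ** free_solution z (- t)) ** U t = free_solution z (- t) ** cscale (- (\<i> * z)) (sg ** U t)"
        by (simp only: cscale_mult_left cscale_mult_right matrix_mul_assoc free_solution_sg)
      show ?thesis unfolding 2 1[symmetric] by (simp only: mm.add_right)
    qed
    have V0: "ac_deriv (\<lambda>t. free_solution z (- t) ** U t) (\<lambda>t. free_solution z (- t) ** (R0 t ** Y t))"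
      by (rule ac_deriv_cong[OF ac_deriv_bilinear[OF bounded_bilinear_matrix_mult ac_deriv_Ez U] refl]) (simp only: eq, simp)
    have V: "ac_deriv (\<lambda>t. free_solution z x ** (free_solution z (- t) ** U t)) (\<lambda>t. free_solution z x ** (free_solution z (- t) ** (R0 t ** Y t)))"
      by (rule ac_deriv_linear[OF mm.bounded_linear_right V0])
    define c where "c = exp (\<bar>Im z\<bar> * \<bar>x\<bar>) * L"
    have c0: "c \<ge> 0" using L0 by (simp add: c_def)
    define k where "k t = c * (\<beta> * norm (q t - p t) + (b + b * norm (potential q t)) / cmod z)" for t
    have pa: "p absolutely_integrable_on {-1..1}" by (rule absolutely_integrable_continuous_real[OF cp(1)])
    have i1: "(\<lambda>t. norm (q t - p t)) integrable_on {-1..1}"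
      using absolutely_integrable_norm[OF set_integral_diff(1)[OF q pa]] by (simp add: o_def absolutely_integrable_on_def)
    have i2: "(\<lambda>t. norm (potential q t)) integrable_on {-1..1}"
      using potential_integrable[OF q] by (simp add: absolutely_integrable_on_def)
    have ik: "(k has_integral c * (\<beta> * integral {-1..1} (\<lambda>t. norm (q t - p t)) + (b * 2 + b * potential_mass q) / cmod z)) {-1..1}"
    proof -
      have "((\<lambda>t::real. b) has_integral b * 2) {-1..1}" using has_integral_const_real[of b "-1" 1] by (simp add: mult.commute)
      then show ?thesis unfolding k_def[abs_def] potential_mass_def
        using i1 i2 by (intro has_integral_mult_right has_integral_add has_integral_divide integrable_integral)
    qed
    have "norm (free_solution z x ** (free_solution z (- x) ** U x) - free_solution z x ** (free_solution z (- 0) ** U 0)) \<le> integral {-1..1} k"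
    proof (rule ac_deriv_diff_bound[OF V])
      fix t assume t: "t \<in> {min 0 x..max 0 x}"
      then have t1: "t \<in> {-1..1}" using x by (auto simp: min_def max_def split: if_splits)
      \<comment> \<open>\<open>t\<close> lies between \<open>0\<close> and \<open>x\<close>, so the two growth factors combine without loss\<close>
      have xt: "\<bar>x - t\<bar> + \<bar>t\<bar> = \<bar>x\<bar>" using t by (auto simp: min_def max_def split: if_splits)
      have "norm (free_solution z x ** (free_solution z (- t) ** (R0 t ** Y t))) = norm (free_solution z (x - t) ** (R0 t ** Y t))"
        by (simp add: matrix_mul_assoc free_solution_add)
      also have "\<dots> \<le> exp (\<bar>Im z\<bar> * \<bar>x - t\<bar>) * norm (R0 t ** Y t)" by (rule norm_free_solution_mult_le)
      also have "\<dots> \<le> exp (\<bar>Im z\<bar> * \<bar>x - t\<bar>) * (norm (R0 t) * (L * exp (\<bar>Im z\<bar> * \<bar>t\<bar>)))"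
        unfolding Y_def
        by (intro mult_left_mono order_trans[OF norm_matrix_mult_le] YL[OF t1]) auto
      also have "\<dots> = exp (\<bar>Im z\<bar> * \<bar>x - t\<bar> + \<bar>Im z\<bar> * \<bar>t\<bar>) * L * norm (R0 t)" by (simp add: exp_add mult_ac)
      also have "\<bar>Im z\<bar> * \<bar>x - t\<bar> + \<bar>Im z\<bar> * \<bar>t\<bar> = \<bar>Im z\<bar> * \<bar>x\<bar>" using xt by (simp flip: distrib_left)
      also have "exp (\<bar>Im z\<bar> * \<bar>x\<bar>) * L * norm (R0 t) \<le> k t"
      proof -
        have "potential q t - Wp t = potential_lin (q t - p t)"
          by (simp add: potential_def Wp_def linear_diff bounded_linear.linear[OF bounded_linear_potential_lin])
        then have 1: "norm (potential q t - Wp t) \<le> \<beta> * norm (q t - p t)" using \<beta>(1)[of "q t - p t"] by (simp add: mult.commute)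
        have "norm (T' t + T t ** potential q t) \<le> b + b * norm (potential q t)"
          by (intro norm_triangle_mono order_trans[OF norm_matrix_mult_le] mult_right_mono b t1) auto
        then have 2: "norm (cscale (1/z) (T' t + T t ** potential q t)) \<le> (b + b * norm (potential q t)) / cmod z"
          by (simp add: norm_cscale norm_divide divide_right_mono)
        have "norm (R0 t) \<le> \<beta> * norm (q t - p t) + (b + b * norm (potential q t)) / cmod z"
          unfolding R0_def by (rule norm_triangle_mono[OF 1 2])
        then show ?thesis unfolding k_def c_def[symmetric] using c0 by (intro mult_left_mono)
      qed
      finally show "norm (free_solution z x ** (free_solution z (- t) ** (R0 t ** Y t))) \<le> k t" .
    next
      show "k integrable_on {-1..1}" using ik by blast
      show "0 \<le> k t" for t unfolding k_def using c0 \<beta>(2) b0 by simp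
    qed (use x in auto)
    also have "integral {-1..1} k = c * (\<beta> * integral {-1..1} (\<lambda>t. norm (q t - p t)) + (b * 2 + b * potential_mass q) / cmod z)"
      using ik by (rule integral_unique)
    also have "\<dots> \<le> c * (\<beta> * \<delta> + (b * 2 + b * potential_mass q) / cmod z)"
      using p(2) \<beta>(2) c0 by (intro mult_left_mono add_right_mono) auto
    finally have 1: "norm (U x - free_solution z x ** U 0) \<le> c * (\<beta> * \<delta> + (b * 2 + b * potential_mass q) / cmod z)"
      by (simp add: matrix_mul_assoc free_solution_add)
    have 2: "norm (cscale (1/z) (T x ** Y x)) \<le> b * (L * exp (\<bar>Im z\<bar> * \<bar>x\<bar>)) / cmod z"
    proof -
      have "norm (T x ** Y x) \<le> b * (L * exp (\<bar>Im z\<bar> * \<bar>x\<bar>))"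
        unfolding Y_def by (intro order_trans[OF norm_matrix_mult_le] mult_mono b YL x) (use b0 in auto)
      then show ?thesis by (simp add: norm_cscale norm_divide divide_right_mono)
    qed
    have 3: "norm (cscale (1/z) (free_solution z x ** T 0)) \<le> exp (\<bar>Im z\<bar> * \<bar>x\<bar>) * b / cmod z"
    proof -
      have "norm (free_solution z x ** T 0) \<le> exp (\<bar>Im z\<bar> * \<bar>x\<bar>) * b"
        by (intro order_trans[OF norm_free_solution_mult_le] mult_left_mono b) auto
      then show ?thesis by (simp add: norm_cscale norm_divide divide_right_mono)
    qed
    have YE: "Y x - free_solution z x = (U x - free_solution z x ** U 0) - cscale (1/z) (T x ** Y x) + cscale (1/z) (free_solution z x ** T 0)"
      by (simp add: U_def Y(2) mm.add_right cscale_mult_right)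
    have "norm (Y x - free_solution z x) \<le> c * (\<beta> * \<delta> + (b * 2 + b * potential_mass q) / cmod z)
       + b * (L * exp (\<bar>Im z\<bar> * \<bar>x\<bar>)) / cmod z + exp (\<bar>Im z\<bar> * \<bar>x\<bar>) * b / cmod z"
      using 1 2 3 norm_triangle_ineq4[of "U x - free_solution z x ** U 0" "cscale (1/z) (T x ** Y x)"]
        norm_triangle_ineq[of "(U x - free_solution z x ** U 0) - cscale (1/z) (T x ** Y x)" "cscale (1/z) (free_solution z x ** T 0)"]
      unfolding YE by linarith
    also have "\<dots> = exp (\<bar>Im z\<bar> * \<bar>x\<bar>) * (L * \<beta> * \<delta> + M / cmod z)"
      using z by (simp add: c_def M_def field_simps)
    finally show ?thesis by (simp add: Y_def)
  qed
  define R where "R = 2 * M / e + 1"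
  have R: "R > 0" using M0 e by (simp add: R_def add_nonneg_pos)
  show thesis
  proof (rule that[OF R])
    fix z assume z: "R \<le> cmod z"
    then have "cmod z > 0" using R by linarith
    have "2 * M / e \<le> cmod z" using z by (simp add: R_def)
    then have "M / cmod z \<le> e/2" using e \<open>cmod z > 0\<close> by (simp add: field_simps)
    then have "L * \<beta> * \<delta> + M / cmod z \<le> e" using \<delta>(2) by linarith
    then have "exp (\<bar>Im z\<bar> * \<bar>x\<bar>) * (L * \<beta> * \<delta> + M / cmod z) \<le> exp (\<bar>Im z\<bar> * \<bar>x\<bar>) * e" by (intro mult_left_mono) auto
    moreover have "z \<noteq> 0" using \<open>cmod z > 0\<close> by auto
    ultimately show "norm (fund_solution q z x - free_solution z x) \<le> e * exp (\<bar>Im z\<bar> * \<bar>x\<bar>)" using main[of z] unfolding mult.commute[of e] by linarith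
  qed
qed

section \<open>Spectral theory\<close>

subsection \<open>Orthogonal projectors\<close>

definition hinner :: "complex^'n \<Rightarrow> complex^'n \<Rightarrow> complex" where
  "hinner v w = (\<Sum>i\<in>UNIV. cnj (v $ i) * w $ i)"

lemma hinner_simps:
  "hinner v (w + w') = hinner v w + hinner v w'" "hinner v (w - w') = hinner v w - hinner v w'" "hinner v (c *s w) = c * hinner v w"
  "hinner (c *s v) w = cnj c * hinner v w" "hinner v 0 = 0"
  by (simp_all add: hinner_def sum.distrib sum_subtractf sum_distrib_left algebra_simps)

lemma hinner_adj: "hinner (A *v v) w = hinner v (adj A *v w)" for A :: "complex^'n^'m"
proof -
  have "hinner (A *v v) w = (\<Sum>i\<in>UNIV. \<Sum>k\<in>UNIV. cnj (A $ i $ k) * cnj (v $ k) * w $ i)"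
    by (simp add: hinner_def matrix_vector_mult_def sum_distrib_right sum_distrib_left mult_ac)
  also have "\<dots> = (\<Sum>k\<in>UNIV. \<Sum>i\<in>UNIV. cnj (A $ i $ k) * cnj (v $ k) * w $ i)" by (rule sum.swap)
  also have "\<dots> = hinner v (adj A *v w)"
    by (simp add: hinner_def matrix_vector_mult_def sum_distrib_left mult_ac)
  finally show ?thesis .
qed

lemma hinner_self: "hinner v v = of_real ((norm v)\<^sup>2)"
  unfolding hinner_def norm_vector_power2 of_real_sum complex_norm_square by (simp add: mult.commute)

lemma inner_hinner: "v \<bullet> w = Re (hinner v w)"
  by (simp add: hinner_def inner_vec_def inner_complex_def)

lemma matrix_eq_iff_vector: "A = B \<longleftrightarrow> (\<forall>v. A *v v = B *v v)" for A B :: "complex^'n^'m"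
  by (metis matrix_eq)

lemma hinner_eqI:
  assumes "\<And>v. hinner v w = hinner v w'" shows "w = w'"
proof -
  have "hinner (w - w') (w - w') = 0" using assms by (simp add: hinner_simps)
  then show ?thesis by (simp add: hinner_self)
qed

text \<open>
  The projection is the real-orthogonal one. The kernel is invariant under multiplication by \<open>\<i>\<close>, and a
  vector that is real-orthogonal to \<open>e\<close> and to \<open>\<i> e\<close> is orthogonal to \<open>e\<close> for the hermitian form; hence the
  projection is complex linear and self-adjoint.
\<close>

lemma orth_projector_mkernel:
  fixes A :: "complex^'n^'m"
  defines "P \<equiv> orth_projector (mkernel A)"
  shows "P ** P = P" "adj P = P" "range ((*v) P) = mkernel A"
proof -
  define E where "E = mkernel A"
  have sub: "subspace E" unfolding E_def mkernel_def subspace_def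
    by (auto simp: mv.add_right mv.scaleR_right)
  have Es: "c *s v \<in> E" if "v \<in> E" for c v using that by (simp add: E_def mkernel_def matrix_vector_smult)
  have Ea: "v + w \<in> E" "v - w \<in> E" if "v \<in> E" "w \<in> E" for v w
    using that sub by (auto simp: subspace_add subspace_diff)
  have "\<exists>y. y \<in> E \<and> (\<forall>e\<in>E. hinner e (x - y) = 0)" for x
  proof -
    obtain y z where yz: "y \<in> span E" "\<And>w. w \<in> span E \<Longrightarrow> orthogonal z w" "x = y + z"
      using orthogonal_subspace_decomp_exists[of E x] by metis
    have sE: "span E = E" using sub by (simp add: span_eq_iff)
    have "hinner e z = 0" if e: "e \<in> E" for e
    proof (rule complex_eqI)
      have "e \<bullet> z = 0" using yz(2)[of e] e sE by (simp add: orthogonal_def inner_commute)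
      then show "Re (hinner e z) = Re 0" by (simp add: inner_hinner)
      have "(\<i> *s e) \<bullet> z = 0" using yz(2)[of "\<i> *s e"] Es[OF e] sE by (simp add: orthogonal_def inner_commute)
      then show "Im (hinner e z) = Im 0" by (simp add: inner_hinner hinner_simps)
    qed
    then show ?thesis using yz sE by (intro exI[of _ y]) auto
  qed
  then obtain p where p: "\<And>x. p x \<in> E" "\<And>x e. e \<in> E \<Longrightarrow> hinner e (x - p x) = 0" by metis
  have uniq: "p x = y" if "y \<in> E" "\<And>e. e \<in> E \<Longrightarrow> hinner e (x - y) = 0" for x y
  proof -
    have u: "p x - y \<in> E" by (rule Ea(2)[OF p(1) that(1)])
    have "hinner (p x - y) ((x - y) - (x - p x)) = 0"
      unfolding hinner_simps(2)[of _ "x - y"] by (simp only: p(2)[OF u] that(2)[OF u] diff_self)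
    moreover have "(x - y) - (x - p x) = p x - y" by simp
    ultimately show ?thesis by (simp add: hinner_self)
  qed
  have add: "p (x + y) = p x + p y" for x y
  proof (rule uniq)
    fix e assume "e \<in> E"
    then have "hinner e ((x - p x) + (y - p y)) = 0" unfolding hinner_simps(1)[of _ "x - p x"] by (simp only: p(2) add_0_left)
    then show "hinner e (x + y - (p x + p y)) = 0" by (simp add: algebra_simps)
  qed (use p Ea in auto)
  have scale: "p (c *s x) = c *s p x" for c x
  proof (rule uniq)
    fix e assume "e \<in> E"
    then have "hinner e (c *s (x - p x)) = 0" unfolding hinner_simps(3) by (simp only: p(2) mult_zero_right)
    moreover have "c *s (x - p x) = c *s x - c *s p x" by (simp add: vec_eq_iff algebra_simps)
    ultimately show "hinner e (c *s x - c *s p x) = 0" by (simp only:)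
  qed (use p Es in auto)
  define P0 where "P0 = matrix p"
  have "Vector_Spaces.linear (*s) (*s) p"
    using add scale by (simp add: Vector_Spaces.linear_iff vec.vector_space_axioms)
  then have P0: "P0 *v x = p x" for x by (simp add: P0_def matrix_works)
  have pE: "p e = e" if "e \<in> E" for e by (rule uniq) (use that in \<open>auto simp: hinner_simps\<close>)
  have "P0 ** P0 = P0"
    unfolding matrix_eq_iff_vector by (simp add: P0 pE[OF p(1)] flip: matrix_vector_mul_assoc)
  moreover have "adj P0 = P0"
    unfolding matrix_eq_iff_vector
  proof
    fix x show "adj P0 *v x = P0 *v x"
    proof (rule hinner_eqI)
      fix v
      have "hinner v (adj P0 *v x) = hinner (p v) x" by (simp add: hinner_adj[symmetric] P0)
      also have "\<dots> = hinner (p v) (p x)" using p(2)[OF p(1), of v x] by (simp add: hinner_simps)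
      also have "\<dots> = hinner v (p x)"
      proof -
        have "hinner (p x) (v - p v) = 0" by (rule p(2)[OF p(1)])
        then have "cnj (hinner (p x) v) = cnj (hinner (p x) (p v))" by (simp add: hinner_simps)
        then show ?thesis by (simp add: hinner_def mult.commute)
      qed
      finally show "hinner v (adj P0 *v x) = hinner v (P0 *v x)" by (simp add: P0)
    qed
  qed
  moreover have "range ((*v) P0) = E"
  proof (intro subset_antisym subsetI)
    fix e assume "e \<in> E" then show "e \<in> range ((*v) P0)" using pE[of e] by (auto simp: P0 image_iff intro!: exI[of _ e])
  qed (use p in \<open>auto simp: P0\<close>)
  ultimately have ok: "P0 ** P0 = P0 \<and> adj P0 = P0 \<and> range ((*v) P0) = mkernel A" by (simp add: E_def)
  have "P = P0"
    unfolding P_def orth_projector_def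
  proof (rule the_equality[where a=P0])
    show "P0 ** P0 = P0 \<and> adj P0 = P0 \<and> range ((*v) P0) = mkernel A" by (rule ok)
    fix R :: "complex^'n^'n" assume R: "R ** R = R \<and> adj R = R \<and> range ((*v) R) = mkernel A"
    have "R *v (P0 *v x) = P0 *v x" for x
    proof -
      have "P0 *v x \<in> range ((*v) R)" using R ok by auto
      then obtain w where "P0 *v x = R *v w" by auto
      then show ?thesis using R by (metis matrix_vector_mul_assoc)
    qed
    then have 1: "R ** P0 = P0" unfolding matrix_eq_iff_vector by (simp flip: matrix_vector_mul_assoc)
    have "P0 *v (R *v x) = R *v x" for x
    proof -
      have "R *v x \<in> range ((*v) P0)" using R ok by auto
      then obtain w where "R *v x = P0 *v w" by auto
      then show ?thesis using ok by (metis matrix_vector_mul_assoc)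
    qed
    then have 2: "P0 ** R = R" unfolding matrix_eq_iff_vector by (simp flip: matrix_vector_mul_assoc)
    have "R = adj (P0 ** R)" using R 2 by simp
    also have "\<dots> = P0" using R ok 1 by (simp add: adj_mult)
    finally show "R = P0" .
  qed
  with ok show "P ** P = P" "adj P = P" "range ((*v) P) = mkernel A" by auto
qed

lemma mkernel_projector_iff:
  fixes A :: "complex^'n^'m" and X :: "complex^'k^'n"
  shows "A ** X = 0 \<longleftrightarrow> orth_projector (mkernel A) ** X = X"
proof -
  let ?P = "orth_projector (mkernel A)"
  note P = orth_projector_mkernel[of A]
  have AP: "A ** ?P = 0"
    unfolding matrix_eq_iff_vector
  proof
    fix v have "?P *v v \<in> mkernel A" using P(3) by auto
    then show "A ** ?P *v v = 0 *v v" by (simp add: mkernel_def flip: matrix_vector_mul_assoc)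
  qed
  show ?thesis
  proof
    assume AX: "A ** X = 0"
    show "?P ** X = X"
      unfolding matrix_eq_iff_vector
    proof
      fix v have "A *v (X *v v) = 0" using AX by (simp add: matrix_vector_mul_assoc)
      then have "X *v v \<in> range ((*v) ?P)" unfolding P(3) by (simp add: mkernel_def)
      then show "?P ** X *v v = X *v v" using P(1) by (metis (no_types, lifting) imageE matrix_vector_mul_assoc)
    qed
  next
    assume "?P ** X = X"
    then have "A ** X = (A ** ?P) ** X" by (simp flip: matrix_mul_assoc)
    then show "A ** X = 0" by (simp add: AP)
  qed
qed

subsection \<open>Determinants and inverses\<close>

lemma matrix_inv_right:
  fixes A :: "complex^'n^'n"
  assumes "det A \<noteq> 0" shows "A ** matrix_inv A = mat 1" "matrix_inv A ** A = mat 1"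
proof -
  have "\<exists>B. A ** B = mat 1 \<and> B ** A = mat 1" using assms invertible_det_nz[of A] by (auto simp: invertible_def)
  from someI_ex[OF this] show "A ** matrix_inv A = mat 1" "matrix_inv A ** A = mat 1" by (auto simp: matrix_inv_def)
qed

lemma det_nonzero_iff_ker: "det A \<noteq> 0 \<longleftrightarrow> (\<forall>v. A *v v = 0 \<longrightarrow> v = 0)" for A :: "complex^'n^'n"
  unfolding invertible_det_nz[symmetric] using matrix_left_invertible_ker[of A]
  by (metis invertible_def matrix_left_right_inverse)

lemma holomorphic_det:
  fixes F :: "complex \<Rightarrow> complex^'n^'n"
  assumes "\<And>i j. (\<lambda>z. F z $ i $ j) holomorphic_on S"
  shows "(\<lambda>z. det (F z)) holomorphic_on S"
  unfolding det_def by (intro holomorphic_intros assms)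

lemma continuous_on_det: "continuous_on S (det :: complex^'n^'n \<Rightarrow> complex)"
  unfolding det_def[abs_def] by (intro continuous_intros)

lemma holomorphic_matrix_mult:
  fixes F :: "complex \<Rightarrow> complex^'n^'m" and G :: "complex \<Rightarrow> complex^'k^'n"
  assumes "\<And>i j. (\<lambda>z. F z $ i $ j) holomorphic_on S" "\<And>i j. (\<lambda>z. G z $ i $ j) holomorphic_on S"
  shows "(\<lambda>z. (F z ** G z) $ i $ j) holomorphic_on S"
  unfolding matrix_matrix_mult_def by (simp, intro holomorphic_intros assms)

text \<open>
  Cramer's rule.
\<close>

lemma holomorphic_solve:
  fixes F :: "complex \<Rightarrow> complex^'n^'n" and X G :: "complex \<Rightarrow> complex^'k^'n"
  assumes F: "\<And>i j. (\<lambda>z. F z $ i $ j) holomorphic_on S" and G: "\<And>i j. (\<lambda>z. G z $ i $ j) holomorphic_on S"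
    and nz: "\<And>z. z \<in> S \<Longrightarrow> det (F z) \<noteq> 0" and eq: "\<And>z. z \<in> S \<Longrightarrow> F z ** X z = G z"
  shows "(\<lambda>z. X z $ i $ j) holomorphic_on S"
proof -
  have "(\<lambda>z. det (\<chi> a b. if b = i then G z $ a $ j else F z $ a $ b) / det (F z)) holomorphic_on S"
  proof (intro holomorphic_on_divide holomorphic_det F nz)
    show "(\<lambda>z. (\<chi> a b. if b = i then G z $ a $ j else F z $ a $ b) $ k $ l) holomorphic_on S" for k l
      using F G by (cases "l = i") auto
  qed
  moreover have "det (\<chi> a b. if b = i then G z $ a $ j else F z $ a $ b) / det (F z) = X z $ i $ j" if z: "z \<in> S" for z
  proof -
    have "F z *v (\<chi> a. X z $ a $ j) = (\<chi> a. G z $ a $ j)"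
      using eq[OF z, symmetric] by (simp add: vec_eq_iff matrix_vector_mult_def matrix_matrix_mult_def)
    then have "(\<chi> a. X z $ a $ j) = (\<chi> k. det (\<chi> a b. if b = k then (\<chi> a. G z $ a $ j) $ a else F z $ a $ b) / det (F z))"
      using cramer[OF nz[OF z]] by blast
    then have "(\<chi> a. X z $ a $ j) $ i = (\<chi> k. det (\<chi> a b. if b = k then (\<chi> a. G z $ a $ j) $ a else F z $ a $ b) / det (F z)) $ i"
      by simp
    then show ?thesis unfolding vec_lambda_beta by simp
  qed
  ultimately show ?thesis by (simp cong: holomorphic_cong)
qed

lemma norm_matrix_columns: "(norm A)\<^sup>2 = (\<Sum>j\<in>UNIV. (norm (A *v axis j 1))\<^sup>2)" for A :: "complex^'n^'m"
proof -
  have "(\<Sum>j\<in>UNIV. (norm (A *v axis j 1))\<^sup>2) = (\<Sum>j\<in>UNIV. \<Sum>i\<in>UNIV. (cmod (A $ i $ j))\<^sup>2)"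
    by (simp add: norm_vector_power2 matrix_vector_mult_def axis_def if_distrib cong: if_cong)
  then show ?thesis unfolding norm_matrix_power2 by (simp add: sum.swap[of "\<lambda>i j. (cmod (A $ i $ j))\<^sup>2"])
qed

lemma matrix_bounded_below:
  fixes A :: "complex^'n^'m" and X :: "complex^'k^'n"
  assumes "\<And>v. c * norm v \<le> norm (A *v v)" "c \<ge> 0" shows "c * norm X \<le> norm (A ** X)"
proof (rule power2_le_imp_le)
  have "(c * norm X)\<^sup>2 = (\<Sum>j\<in>UNIV. (c * norm (X *v axis j 1))\<^sup>2)"
    by (simp add: power_mult_distrib norm_matrix_columns[of X] sum_distrib_left)
  also have "\<dots> \<le> (\<Sum>j\<in>UNIV. (norm (A *v (X *v axis j 1)))\<^sup>2)"
    using assms by (intro sum_mono power_mono) auto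
  also have "\<dots> = (norm (A ** X))\<^sup>2"
    by (simp add: norm_matrix_columns[of "A ** X"] matrix_vector_mul_assoc)
  finally show "(c * norm X)\<^sup>2 \<le> (norm (A ** X))\<^sup>2" .
qed simp

subsection \<open>The characteristic matrix\<close>

definition char_mat :: "(real \<Rightarrow> complex^'r^'r) \<Rightarrow> complex^('r::finite + 'r)^('r + 'r) \<Rightarrow> complex \<Rightarrow> complex^('r::finite + 'r)^('r + 'r)" where
  "char_mat q U z = A_bc U ** fund_solution q z (-1) + B_bc U ** fund_solution q z 1"

text \<open>
  The numerator in the formula for the Weyl matrix.
\<close>

definition numer_mat :: "(real \<Rightarrow> complex^'r^'r) \<Rightarrow> complex^('r::finite + 'r)^('r + 'r) \<Rightarrow> complex \<Rightarrow> complex^('r::finite + 'r)^('r + 'r)" where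
  "numer_mat q U z = (B_bc U ** fund_solution q z 1 - A_bc U ** fund_solution q z (-1)) ** sg"

definition free_mat :: "complex^'n^'n \<Rightarrow> complex \<Rightarrow> complex^'n^'n" where
  "free_mat U z = cscale (exp (\<i> * z)) (mat 1) + cscale (exp (- (\<i> * z))) U"

lemma P1_P2: "P1 + P2 = mat 1"
  by (simp add: P1_diag P2_diag diag_add diag_1 flip: add_divide_distrib)

lemma P_free_solution: "P1 ** free_solution z x = cscale (exp (\<i> * z * of_real x)) P1" "P2 ** free_solution z x = cscale (exp (- (\<i> * z * of_real x))) P2"
  unfolding P1_diag P2_diag free_solution_def diag_mult_diag cscale_diag
  by (auto simp: vec_eq_iff diag_def sg_fun_def split: sum.splits)

lemma bc_free_solution: "A_bc U ** free_solution z (-1) + B_bc U ** free_solution z 1 = free_mat U z"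
proof -
  have "A_bc U ** free_solution z (-1) + B_bc U ** free_solution z 1
    = cscale (exp (\<i> * z)) (P1 + P2) + cscale (exp (- (\<i> * z))) (U ** (P1 + P2))"
    by (simp add: A_bc_def B_bc_def mm.add_left mm.add_right cscale_add P_free_solution cscale_mult_right flip: matrix_mul_assoc)
  then show ?thesis by (simp add: P1_P2 free_mat_def)
qed

lemma norm_unitary: "U \<in> unitaries \<Longrightarrow> norm (U *v v) = norm v" for U :: "complex^'n^'n"
proof -
  assume U: "U \<in> unitaries"
  have "hinner (U *v v) (U *v v) = hinner v v" using U by (simp add: hinner_adj matrix_vector_mul_assoc unitaries_def)
  then have "(norm (U *v v))\<^sup>2 = (norm v)\<^sup>2" unfolding hinner_self by (metis of_real_eq_iff)
  then show ?thesis by simp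
qed

text \<open>
  In terms of \<open>\<alpha> = P\<^sub>1 X' + P\<^sub>2 X\<close> and \<open>\<beta> = P\<^sub>1 X + P\<^sub>2 X'\<close> the boundary condition reads \<open>\<alpha> = - U \<beta>\<close>, and the
  difference of the two sides of the conclusion is the form \<open>\<alpha>\<^sup>* \<alpha> - \<beta>\<^sup>* \<beta>\<close>, which vanishes since \<open>U\<close> is unitary.
\<close>

lemma boundary_form:
  fixes X X' :: "complex^'k^('r::finite + 'r)" and Z Z' :: "complex^'l^('r + 'r)"
  assumes U: "U \<in> unitaries" and X: "A_bc U ** X + B_bc U ** X' = 0" and Z: "A_bc U ** Z + B_bc U ** Z' = 0"
  shows "adj X' ** (sg ** Z') = adj X ** (sg ** Z)"
proof -
  have split: "P1 ** V' + P2 ** V = - (U ** (P1 ** V + P2 ** V'))" if "A_bc U ** V + B_bc U ** V' = 0"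
    for V V' :: "complex^'m^('r+'r)"
  proof -
    have "(P1 ** V' + P2 ** V) + U ** (P1 ** V + P2 ** V') = 0"
      using that by (simp add: A_bc_def B_bc_def mm.add_left mm.add_right add_ac flip: matrix_mul_assoc)
    then show ?thesis by (simp add: eq_neg_iff_add_eq_0)
  qed
  have "adj (P1 ** X' + P2 ** X) ** (P1 ** Z' + P2 ** Z) = adj (P1 ** X + P2 ** X') ** (adj U ** U) ** (P1 ** Z + P2 ** Z')"
    unfolding split[OF X] split[OF Z] by (simp add: adj_minus mm.minus_left mm.minus_right adj_mult matrix_mul_assoc)
  then have 1: "adj (P1 ** X' + P2 ** X) ** (P1 ** Z' + P2 ** Z) = adj (P1 ** X + P2 ** X') ** (P1 ** Z + P2 ** Z')"
    using U by (simp add: unitaries_def)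
  have "adj X' ** (sg ** Z') - adj X ** (sg ** Z)
    = adj (P1 ** X' + P2 ** X) ** (P1 ** Z' + P2 ** Z) - adj (P1 ** X + P2 ** X') ** (P1 ** Z + P2 ** Z')"
  proof -
    have e: "cnj x' * (sg_fun i * z') - cnj x * (sg_fun i * z)
      = cnj ((1 + sg_fun i) / 2 * x' + (1 - sg_fun i) / 2 * x) * ((1 + sg_fun i) / 2 * z' + (1 - sg_fun i) / 2 * z)
        - cnj ((1 + sg_fun i) / 2 * x + (1 - sg_fun i) / 2 * x') * ((1 + sg_fun i) / 2 * z + (1 - sg_fun i) / 2 * z')"
      for x x' z z' and i :: "'r + 'r"
      by (cases i) simp_all
    have nth: "(adj V ** W) $ a $ b = (\<Sum>i\<in>UNIV. cnj (V $ i $ a) * W $ i $ b)"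
      for V :: "complex^'k^('r+'r)" and W :: "complex^'l^('r+'r)" and a b
      by (simp add: matrix_matrix_mult_def)
    show ?thesis
      unfolding vec_eq_iff vector_minus_component nth vector_add_component P1_diag P2_diag sg_def diag_mult_nth
      by (simp only: sum_subtractf[symmetric] e) simp
  qed
  with 1 show ?thesis by simp
qed

definition gram :: "(real \<Rightarrow> complex^'r^'r) \<Rightarrow> complex \<Rightarrow> complex \<Rightarrow> complex^('r::finite + 'r)^('r + 'r)" where
  "gram q w z = integral {-1..1} (\<lambda>t. adj (fund_solution q w t) ** fund_solution q z t)"

text \<open>
  Results on matrices are transferred to vectors by viewing these as matrices with one column.
\<close>

definition column_matrix :: "complex^'n \<Rightarrow> complex^1^'n" where "column_matrix v = (\<chi> i j. v $ i)"

lemma column_matrix: "A ** column_matrix v = column_matrix (A *v v)" "column_matrix v = 0 \<longleftrightarrow> v = 0" for A :: "complex^'n^'m"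
  by (auto simp: column_matrix_def vec_eq_iff matrix_matrix_mult_def matrix_vector_mult_def)

context
  fixes q :: "real \<Rightarrow> complex^'r::finite^'r"
  assumes q: "q absolutely_integrable_on {-1..1}"
begin

lemma char_mat_holomorphic: "(\<lambda>z. char_mat q U z $ i $ j) holomorphic_on UNIV"
  "(\<lambda>z. numer_mat q U z $ i $ j) holomorphic_on UNIV"
  unfolding char_mat_def numer_mat_def vector_add_component vector_minus_component
  by (intro holomorphic_intros holomorphic_matrix_mult fund_solution_holomorphic[OF q];
      (simp, intro holomorphic_intros holomorphic_matrix_mult fund_solution_holomorphic[OF q])?; simp)+

lemma gram_integrable: "(\<lambda>t. adj (fund_solution q w t) ** fund_solution q z t) integrable_on {-1..1}"
  by (intro integrable_continuous_real mm.continuous_on bounded_linear.continuous_on[OF bounded_linear_adj]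
      fund_solution_continuous[OF q])

lemma gram_wronskian:
  "adj (fund_solution q w 1) ** (sg ** fund_solution q z 1) - adj (fund_solution q w (-1)) ** (sg ** fund_solution q z (-1))
     = cscale (\<i> * (z - cnj w)) (gram q w z)"
proof -
  have "((\<lambda>t. cscale (\<i> * (z - cnj w)) (adj (fund_solution q w t) ** fund_solution q z t)) has_integral
     (adj (fund_solution q w 1) ** (sg ** fund_solution q z 1) - adj (fund_solution q w (-1)) ** (sg ** fund_solution q z (-1)))) {-1..1}"
    by (rule ac_deriv_FTC(2)[OF wronskian_matrix[OF fund_solution_ac_deriv(1)[OF q] fund_solution_ac_deriv(1)[OF q]]]) auto
  moreover have "((\<lambda>t. cscale (\<i> * (z - cnj w)) (adj (fund_solution q w t) ** fund_solution q z t)) has_integral cscale (\<i> * (z - cnj w)) (gram q w z)) {-1..1}"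
    using has_integral_linear[OF integrable_integral[OF gram_integrable] bounded_linear_cscale]
    by (simp add: gram_def o_def)
  ultimately show ?thesis by (rule has_integral_unique)
qed

text \<open>
  The trace of \<open>C\<^sup>* (gram q z z) C\<close> is the integral of \<open>|Y C|\<^sup>2\<close>, and \<open>|Y C|\<close> is bounded below by a multiple of
  \<open>|C|\<close> because \<open>Y\<close> has a bounded inverse.
\<close>

lemma gram_definite:
  fixes C :: "complex^'k^('r + 'r)"
  assumes "adj C ** (gram q z z ** C) = 0" shows "C = 0"
proof (rule ccontr)
  assume C: "C \<noteq> 0"
  define tr where "tr A = (\<Sum>j\<in>UNIV. Re (A $ j $ j))" for A :: "complex^'k^'k"
  have tr: "bounded_linear tr"
    unfolding linear_conv_bounded_linear[symmetric] tr_def[abs_def]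
    by (rule linearI) (auto simp: sum.distrib sum_distrib_left)
  have tr_norm: "tr (adj Z ** Z) = (norm Z)\<^sup>2" for Z :: "complex^'k^('r+'r)"
  proof -
    have "Re (cnj c * c) = (cmod c)\<^sup>2" for c by (simp add: cmod_def power2_eq_square)
    then have "tr (adj Z ** Z) = (\<Sum>j\<in>UNIV. \<Sum>i\<in>UNIV. (cmod (Z $ i $ j))\<^sup>2)"
      by (simp add: tr_def matrix_matrix_mult_def)
    then show ?thesis unfolding norm_matrix_power2 by (simp add: sum.swap[of "\<lambda>i j. (cmod (Z $ i $ j))\<^sup>2"])
  qed
  have bl: "bounded_linear (\<lambda>A. tr (adj C ** (A ** C)))"
    by (intro bounded_linear_compose[OF tr] bounded_linear_compose[OF mm.bounded_linear_right] mm.bounded_linear_left)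
  have hi: "((\<lambda>t. (norm (fund_solution q z t ** C))\<^sup>2) has_integral tr (adj C ** (gram q z z ** C))) {-1..1}"
  proof -
    have "((\<lambda>t. tr (adj C ** ((adj (fund_solution q z t) ** fund_solution q z t) ** C))) has_integral tr (adj C ** (gram q z z ** C))) {-1..1}"
      using has_integral_linear[OF integrable_integral[OF gram_integrable] bl, of z z] by (simp add: gram_def o_def)
    moreover have "tr (adj C ** ((adj (fund_solution q z t) ** fund_solution q z t) ** C)) = (norm (fund_solution q z t ** C))\<^sup>2" for t
      using tr_norm[of "fund_solution q z t ** C"] by (simp add: adj_mult matrix_mul_assoc)
    ultimately show ?thesis by simp
  qed
  obtain B where B: "B \<ge> 0" "\<And>x. x \<in> {-1..1} \<Longrightarrow> norm (fund_solution q (cnj z) x) \<le> B"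
    using fund_solution_locally_bounded[OF q, of z] by metis
  have low: "norm C \<le> B * norm (fund_solution q z t ** C)" if t: "t \<in> {-1..1}" for t
  proof -
    have "C = (sg ** adj (fund_solution q (cnj z) t) ** sg) ** (fund_solution q z t ** C)"
      using fund_solution_inverse(1)[OF q t, of z] by (simp add: matrix_mul_assoc)
    then have "norm C \<le> norm (sg ** adj (fund_solution q (cnj z) t) ** sg) * norm (fund_solution q z t ** C)"
      using norm_matrix_mult_le by metis
    also have "\<dots> = norm (fund_solution q (cnj z) t) * norm (fund_solution q z t ** C)" by simp
    also have "\<dots> \<le> B * norm (fund_solution q z t ** C)" using B(2)[OF t] by (intro mult_right_mono) auto
    finally show ?thesis .
  qed
  have "B > 0" using low[of 0] C B(1) by (cases "B = 0") auto
  have "((\<lambda>t::real. (norm C / B)\<^sup>2) has_integral (norm C / B)\<^sup>2 * 2) {-1..1}"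
    using has_integral_const_real[of "(norm C / B)\<^sup>2" "-1" 1] by (simp add: mult.commute)
  then have "(norm C / B)\<^sup>2 * 2 \<le> tr (adj C ** (gram q z z ** C))"
  proof (rule has_integral_le[OF _ hi])
    fix t :: real assume "t \<in> {-1..1}"
    then have "norm C / B \<le> norm (fund_solution q z t ** C)" using low[of t] \<open>B > 0\<close> by (simp add: field_simps)
    then show "(norm C / B)\<^sup>2 \<le> (norm (fund_solution q z t ** C))\<^sup>2" using \<open>B > 0\<close> by (intro power_mono) auto
  qed
  moreover have "tr (adj C ** (gram q z z ** C)) = 0" using assms by (simp add: tr_def)
  moreover have "0 < (norm C / B)\<^sup>2" using C \<open>B > 0\<close> by simp
  ultimately show False by linarith
qed

text \<open>
  The Lagrange identity for the eigenfunctions \<open>Y C\<close> paired with themselves, whose boundary terms cancel,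
  shows that \<open>z - cnj z\<close> times a definite form is zero.
\<close>

lemma char_mat_kernel_real:
  assumes U: "U \<in> unitaries" and C: "char_mat q U z ** C = 0" "C \<noteq> (0 :: complex^'k^('r+'r))"
  shows "Im z = 0"
proof -
  have bc: "A_bc U ** (fund_solution q z (-1) ** C) + B_bc U ** (fund_solution q z 1 ** C) = 0"
    using C(1) by (simp add: char_mat_def mm.add_left matrix_mul_assoc)
  from boundary_form[OF U bc bc]
  have "adj C ** ((adj (fund_solution q z 1) ** (sg ** fund_solution q z 1) - adj (fund_solution q z (-1)) ** (sg ** fund_solution q z (-1))) ** C) = 0"
    by (simp add: adj_mult mm.diff_left mm.diff_right matrix_mul_assoc)
  then have "cscale (\<i> * (z - cnj z)) (adj C ** (gram q z z ** C)) = 0"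
    by (simp add: gram_wronskian cscale_mult_left cscale_mult_right)
  moreover have "adj C ** (gram q z z ** C) \<noteq> 0" using gram_definite[of C z] C(2) by blast
  ultimately have "\<i> * (z - cnj z) = 0" by (metis norm_cscale norm_eq_zero mult_eq_0_iff)
  then show ?thesis by (simp add: complex_eq_iff)
qed

lemma det_char_mat_real:
  assumes U: "U \<in> unitaries" and d: "det (char_mat q U z) = 0" shows "Im z = 0"
proof -
  obtain v where "char_mat q U z *v v = 0" "v \<noteq> 0" using d det_nonzero_iff_ker by blast
  then show ?thesis using char_mat_kernel_real[OF U, of z "column_matrix v"] by (simp add: column_matrix)
qed

lemma T_eigenvalues_char_mat: "T_eigenvalues q U = {z. det (char_mat q U z) = 0}"
proof (intro set_eqI iffI)
  fix z assume "z \<in> T_eigenvalues q U"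
  then obtain y where y: "y \<in> W11" "A_bc U *v y (-1) + B_bc U *v y 1 = 0"
    "\<not> (AE x in leb_I. y x = 0)" "AE x in leb_I. dirac_expr q y x = z *s y x"
    by (auto simp: T_eigenvalues_def T_dom_def T_max_dom_def)
  have "AE x in leb_I. vector_derivative y (at x) = dirac_coeff q z x *v y x"
    using y(4) unfolding dirac_expr_def dirac_vector_iff .
  then have ay: "ac_deriv y (\<lambda>x. dirac_coeff q z x *v y x)" by (rule ac_deriv_cong[OF W11_ac_deriv[OF y(1)] refl])
  note yx = fund_solution_vector_unique[OF q ay]
  have "y 0 \<noteq> 0"
  proof
    assume "y 0 = 0"
    then have "y x = 0" if "x \<in> {-1..1}" for x using yx[OF that] by simp
    then show False using y(3) AE_leb_I_negligible[of "{}" "\<lambda>x. y x = 0"] by auto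
  qed
  moreover have "char_mat q U z *v y 0 = 0"
    using y(2) yx[of 1] yx[of "-1"] by (simp add: char_mat_def mv.add_left matrix_vector_mul_assoc)
  ultimately show "z \<in> {z. det (char_mat q U z) = 0}" using det_nonzero_iff_ker by blast
next
  fix z assume "z \<in> {z. det (char_mat q U z) = 0}"
  then obtain c where c: "char_mat q U z *v c = 0" "c \<noteq> 0" using det_nonzero_iff_ker by blast
  define y where "y x = fund_solution q z x *v c" for x
  have ay: "ac_deriv y (\<lambda>x. dirac_coeff q z x *v y x)"
    using ac_deriv_linear[OF mv.bounded_linear_left fund_solution_ac_deriv(1)[OF q, of z], of c]
    by (simp add: y_def[abs_def] matrix_vector_mul_assoc)
  have eq: "AE x in leb_I. dirac_expr q y x = z *s y x"
    using ac_deriv_AE_vector_derivative[OF ay] unfolding dirac_expr_def dirac_vector_iff .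
  have cy: "continuous_on {-1..1} (\<lambda>x. z *s y x)"
    unfolding y_def matrix_vector_smult[symmetric]
    by (intro bounded_linear.continuous_on[OF mv.bounded_linear_left] fund_solution_continuous[OF q])
  have "(\<lambda>x. z *s y x) \<in> Lp_fun 2"
  proof -
    have "(\<lambda>x. norm (z *s y x) powr 2) absolutely_integrable_on {-1..1}"
      by (intro absolutely_integrable_continuous_real continuous_on_powr' continuous_on_norm cy continuous_on_const) auto
    moreover have "(\<lambda>x. z *s y x) absolutely_integrable_on {-1..1}"
      by (intro absolutely_integrable_continuous_real cy)
    ultimately show ?thesis unfolding Lp_fun_def integrable_leb_I_iff[symmetric] by auto
  qed
  then have "dirac_expr q y \<in> Lp_fun 2"
    by (rule Lp_fun_cong_AE) (use eq in eventually_elim, simp)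
  then have dom: "y \<in> T_dom q U"
    using ac_deriv_W11[OF ay] c(1) by (simp add: T_dom_def T_max_dom_def y_def char_mat_def mv.add_left matrix_vector_mul_assoc)
  have "\<not> (AE x in leb_I. y x = 0)"
  proof
    assume ae: "AE x in leb_I. y x = 0"
    obtain N where N: "negligible N" "\<And>x. x \<in> {-1<..<1} - N \<Longrightarrow> y x = 0" using AE_leb_IE[OF ae] by blast
    have "\<not> {-1<..<1} \<subseteq> N"
      using N(1) negligible_subset[of N "box (-1) (1::real)"] negligible_interval(2)[of "-1::real" 1] by auto
    then obtain x where x: "x \<in> {-1<..<1}" "y x = 0" using N(2) by blast
    then have "fund_solution q z x *v c = 0" by (simp add: y_def)
    then have "(sg ** adj (fund_solution q (cnj z) x) ** sg) ** fund_solution q z x *v c = 0" by (simp flip: matrix_vector_mul_assoc)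
    then show False using fund_solution_inverse(1)[OF q, of x z] x c by simp
  qed
  with dom eq show "z \<in> T_eigenvalues q U" unfolding T_eigenvalues_def by blast
qed

end

subsection \<open>Norming matrices\<close>

lemma M_mat_gram: "cscale 2 (M_mat q z) = gram q z z"
  by (simp add: M_mat_def gram_def scaleR_cscale)

lemma E_space_char_mat: "E_space q U z = mkernel (char_mat q U z)"
  by (simp add: E_space_def char_mat_def)

lemma mkernel_gram_definite:
  fixes C :: "complex^'k^('r::finite + 'r)"
  assumes q: "q absolutely_integrable_on {-1..1}"
    and C: "Pi_mat q U z ** C = C" "Pi_mat q U z ** (gram q z z ** C) = 0"
  shows "C = 0"
proof (rule gram_definite[OF q])
  have "adj (Pi_mat q U z) = Pi_mat q U z"
    by (simp add: Pi_mat_def E_space_char_mat orth_projector_mkernel)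
  then have "adj C = adj C ** Pi_mat q U z" using arg_cong[OF C(1), of adj] by (simp add: adj_mult)
  then have "adj C ** (gram q z z ** C) = adj C ** (Pi_mat q U z ** (gram q z z ** C))"
    by (metis matrix_mul_assoc)
  then show "adj C ** (gram q z z ** C) = 0" by (simp add: C(2))
qed

text \<open>
  Let \<open>P\<close> be the projector onto the kernel and \<open>M\<close> the matrix \<open>M_mat\<close>. The inverse on the kernel of the
  compression of \<open>M\<close> is induced by the inverse of \<open>P M P + (1 - P)\<close>, which acts on the whole space and
  commutes with \<open>P\<close>. The two identities characterise the norming matrix, since \<open>M\<close> is definite.
\<close>

lemma norming_mat:
  assumes q: "q absolutely_integrable_on {-1..1}"
  shows "Pi_mat q U z ** norming_mat q U z = norming_mat q U z"
    "Pi_mat q U z ** (gram q z z ** norming_mat q U z) = cscale 2 (Pi_mat q U z)"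
proof -
  define P where "P = Pi_mat q U z"
  define M where "M = M_mat q z"
  have P: "P ** P = P" "adj P = P" "range ((*v) P) = E_space q U z"
    by (simp_all add: P_def Pi_mat_def E_space_char_mat orth_projector_mkernel)
  have gM: "gram q z z = cscale 2 M" by (simp add: M_def M_mat_gram)
  define N where "N = P ** M ** P + (mat 1 - P)"
  have PN: "P ** N = P ** M ** P" and NP: "N ** P = P ** M ** P"
    by (simp_all add: N_def mm.add_left mm.add_right mm.diff_left mm.diff_right P(1) matrix_mul_assoc)
       (simp_all add: P(1) flip: matrix_mul_assoc)
  have "det N \<noteq> 0"
    unfolding det_nonzero_iff_ker
  proof (intro allI impI)
    fix v assume Nv: "N *v v = 0"
    define C where "C = column_matrix v"
    have NC: "N ** C = 0" using Nv by (simp add: C_def column_matrix)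
    have "(P ** N) ** C = 0" by (simp add: NC flip: matrix_mul_assoc)
    then have 1: "P ** M ** P ** C = 0" by (simp only: PN)
    have "N ** C = P ** M ** P ** C + (C - P ** C)" by (simp add: N_def mm.add_left mm.diff_left)
    then have PC: "P ** C = C" using NC 1 by simp
    have "P ** (M ** (P ** C)) = 0" using 1 by (simp only: matrix_mul_assoc)
    then have "P ** (gram q z z ** C) = 0" by (simp add: gM PC cscale_mult_left cscale_mult_right)
    then have "C = 0" using mkernel_gram_definite[OF q, of U z C] PC by (simp add: P_def)
    then show "v = 0" by (simp add: C_def column_matrix)
  qed
  note Ni = matrix_inv_right[OF this]
  define X where "X = matrix_inv N ** P"
  have comm: "matrix_inv N ** P = P ** matrix_inv N"
  proof -
    have "matrix_inv N ** P = matrix_inv N ** (P ** N) ** matrix_inv N"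
      by (simp add: Ni flip: matrix_mul_assoc)
    also have "\<dots> = (matrix_inv N ** N) ** P ** matrix_inv N" by (simp only: PN NP[symmetric] matrix_mul_assoc)
    finally show ?thesis by (simp add: Ni)
  qed
  have PX: "P ** X = X" by (simp only: X_def comm matrix_mul_assoc P(1))
  have BX: "P ** M ** P ** X = P"
  proof -
    have "P ** M ** P ** X = N ** (P ** X)" by (simp only: NP[symmetric] matrix_mul_assoc)
    also have "\<dots> = N ** matrix_inv N ** P" by (simp only: PX) (simp add: X_def matrix_mul_assoc)
    finally show ?thesis by (simp add: Ni)
  qed
  have inv: "inv_into (E_space q U z) (B_op q U z) (P *v v) = X *v v" for v
  proof (rule inv_into_f_eq)
    show "inj_on (B_op q U z) (E_space q U z)"
    proof (rule inj_onI)
      fix v w assume v: "v \<in> E_space q U z" and w: "w \<in> E_space q U z" and eq: "B_op q U z v = B_op q U z w"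
      have fixP: "P *v u = u" if "u \<in> E_space q U z" for u
      proof -
        from that obtain y where "u = P *v y" using P(3) by blast
        then show ?thesis using P(1) by (simp add: matrix_vector_mul_assoc)
      qed
      have "(P ** M ** P) *v (v - w) = 0"
        using eq by (simp add: B_op_def P_def M_def mv.diff_right)
      then have "N *v (v - w) = 0" using fixP[OF v] fixP[OF w] by (simp add: N_def mv.add_left mv.diff_left mv.diff_right)
      then have "(matrix_inv N ** N) *v (v - w) = 0" by (simp flip: matrix_vector_mul_assoc)
      then show "v = w" by (simp add: Ni)
    qed
    show "X *v v \<in> E_space q U z" unfolding P(3)[symmetric] using PX by (metis matrix_vector_mul_assoc rangeI)
    show "B_op q U z (X *v v) = P *v v"
      using BX by (simp add: B_op_def P_def M_def matrix_vector_mul_assoc)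
  qed
  have nX: "norming_mat q U z = X"
    unfolding norming_mat_def P_def[symmetric] inv by (rule matrix_of_matrix_vector_mul)
  show "Pi_mat q U z ** norming_mat q U z = norming_mat q U z" by (simp add: nX PX flip: P_def)
  have "P ** (M ** (P ** X)) = P" using BX by (simp only: matrix_mul_assoc)
  then show "Pi_mat q U z ** (gram q z z ** norming_mat q U z) = cscale 2 (Pi_mat q U z)"
    by (simp add: nX gM PX cscale_mult_left cscale_mult_right flip: P_def)
qed

subsection \<open>The Weyl matrix and its residues\<close>

text \<open>
  The choice of \<open>m\<close> for which \<open>Y(x) (m + \<sigma>)\<close> on the right half and \<open>Y(x) (m - \<sigma>)\<close> on the left half together
  satisfy the boundary condition (\<open>weyl_boundary\<close>).
\<close>

definition weyl :: "(real \<Rightarrow> complex^'r^'r) \<Rightarrow> complex^('r::finite + 'r)^('r + 'r) \<Rightarrow> complex \<Rightarrow> complex^('r::finite + 'r)^('r + 'r)" where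
  "weyl q U z = - (matrix_inv (char_mat q U z) ** numer_mat q U z)"

lemma char_mat_weyl: "det (char_mat q U z) \<noteq> 0 \<Longrightarrow> char_mat q U z ** weyl q U z = - numer_mat q U z"
  by (simp add: weyl_def mm.minus_right matrix_mul_assoc matrix_inv_right)

lemma weyl_boundary:
  assumes "det (char_mat q U z) \<noteq> 0"
  shows "A_bc U ** (fund_solution q z (-1) ** (weyl q U z - sg)) + B_bc U ** (fund_solution q z 1 ** (weyl q U z + sg)) = 0"
proof -
  have "A_bc U ** (fund_solution q z (-1) ** (weyl q U z - sg)) + B_bc U ** (fund_solution q z 1 ** (weyl q U z + sg))
     = char_mat q U z ** weyl q U z + numer_mat q U z"
    by (simp add: char_mat_def numer_mat_def mm.add_left mm.add_right mm.diff_left mm.diff_right matrix_mul_assoc)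
  then show ?thesis by (simp add: char_mat_weyl[OF assms])
qed

context
  fixes q :: "real \<Rightarrow> complex^'r::finite^'r"
  assumes q: "q absolutely_integrable_on {-1..1}"
begin

lemma weyl_holomorphic:
  assumes "\<And>z. z \<in> S \<Longrightarrow> det (char_mat q U z) \<noteq> 0"
  shows "(\<lambda>z. weyl q U z $ i $ j) holomorphic_on S"
proof (rule holomorphic_solve[where F="char_mat q U" and G="\<lambda>z. - numer_mat q U z"])
  show "(\<lambda>z. char_mat q U z $ i $ j) holomorphic_on S" for i j
    by (rule holomorphic_on_subset[OF char_mat_holomorphic(1)[OF q]]) simp
  show "(\<lambda>z. (- numer_mat q U z) $ i $ j) holomorphic_on S" for i j
    using holomorphic_on_subset[OF char_mat_holomorphic(2)[OF q]] by (auto intro!: holomorphic_intros)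
qed (use assms char_mat_weyl in auto)

text \<open>
  The boundary terms of the Weyl solutions for \<open>z\<close> and \<open>cnj z\<close> cancel, and between the end points and \<open>0\<close>
  their Wronskian is constant.
\<close>

lemma weyl_adj:
  assumes U: "U \<in> unitaries" and nz: "det (char_mat q U z) \<noteq> 0" "det (char_mat q U (cnj z)) \<noteq> 0"
  shows "adj (weyl q U (cnj z)) = - weyl q U z"
proof -
  define m where "m = weyl q U z"
  define m' where "m' = weyl q U (cnj z)"
  have e: "adj (fund_solution q (cnj z) x ** V) ** (sg ** (fund_solution q z x ** W)) = adj V ** (sg ** W)" if "x \<in> {-1..1}" for x V W
  proof -
    have "adj (fund_solution q (cnj z) x ** V) ** (sg ** (fund_solution q z x ** W))
      = adj V ** ((adj (fund_solution q (cnj z) x) ** (sg ** fund_solution q z x)) ** W)" by (simp add: adj_mult matrix_mul_assoc)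
    then show ?thesis by (simp add: fund_solution_symplectic[OF q that])
  qed
  have "adj (m' + sg) ** (sg ** (m + sg)) = adj (m' - sg) ** (sg ** (m - sg))"
    using boundary_form[OF U weyl_boundary[OF nz(2)] weyl_boundary[OF nz(1)]]
    unfolding m_def[symmetric] m'_def[symmetric] by (simp add: e)
  moreover have "adj (m' + sg) ** (sg ** (m + sg)) = (adj m' ** (sg ** m) + sg) + (adj m' + m)"
    "adj (m' - sg) ** (sg ** (m - sg)) = (adj m' ** (sg ** m) + sg) - (adj m' + m)"
    by (simp_all add: adj_add adj_diff mm.add_left mm.add_right mm.diff_left mm.diff_right sg_sg)
  ultimately have "adj m' + m = - (adj m' + m)" by (metis add_left_imp_eq uminus_add_conv_diff add.commute)
  then have "2 *\<^sub>R (adj m' + m) = 0" unfolding scaleR_2 by (simp only: eq_neg_iff_add_eq_0)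
  then have "adj m' + m = 0" by simp
  then show ?thesis by (simp add: m_def m'_def eq_neg_iff_add_eq_0)
qed

lemma fund_solution_tendsto:
  assumes "x \<in> {-1..1}" shows "((\<lambda>z. fund_solution q z x) \<longlongrightarrow> fund_solution q w x) (at w)"
proof -
  obtain C where C: "C \<ge> 0" "\<And>z x. cmod (z - w) < 1 \<Longrightarrow> x \<in> {-1..1} \<Longrightarrow> norm (fund_solution q z x - fund_solution q w x) \<le> C * cmod (z - w)"
    using fund_solution_Lipschitz[OF q, of w] by metis
  have ev: "eventually (\<lambda>z. cmod (z - w) < 1) (at w)"
    unfolding eventually_at by (intro exI[of _ 1]) (auto simp: dist_norm)
  have "((\<lambda>z. fund_solution q z x - fund_solution q w x) \<longlongrightarrow> 0) (at w)"
  proof (rule Lim_null_comparison)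
    show "eventually (\<lambda>z. norm (fund_solution q z x - fund_solution q w x) \<le> C * cmod (z - w)) (at w)"
      using ev by eventually_elim (use C(2) assms in blast)
    have "((\<lambda>z. C * cmod (z - w)) \<longlongrightarrow> C * cmod (w - w)) (at w)" by (intro tendsto_intros)
    then show "((\<lambda>z. C * cmod (z - w)) \<longlongrightarrow> 0) (at w)" by simp
  qed
  then show ?thesis by (simp add: LIM_zero_iff)
qed

lemma gram_tendsto: "((\<lambda>z. gram q w z) \<longlongrightarrow> gram q w w) (at w)"
proof -
  obtain C where C: "C \<ge> 0" "\<And>z x. cmod (z - w) < 1 \<Longrightarrow> x \<in> {-1..1} \<Longrightarrow> norm (fund_solution q z x - fund_solution q w x) \<le> C * cmod (z - w)"
    using fund_solution_Lipschitz[OF q, of w] by metis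
  obtain B where B: "B \<ge> 0" "\<And>z x. cmod (z - w) < 1 \<Longrightarrow> x \<in> {-1..1} \<Longrightarrow> norm (fund_solution q z x) \<le> B"
    using fund_solution_locally_bounded[OF q, of w] by metis
  have ev: "eventually (\<lambda>z. cmod (z - w) < 1) (at w)"
    unfolding eventually_at by (intro exI[of _ 1]) (auto simp: dist_norm)
  have "((\<lambda>z. gram q w z - gram q w w) \<longlongrightarrow> 0) (at w)"
  proof (rule Lim_null_comparison)
    show "eventually (\<lambda>z. norm (gram q w z - gram q w w) \<le> 2 * (B * C) * cmod (z - w)) (at w)"
      using ev
    proof eventually_elim
      case (elim z)
      have "gram q w z - gram q w w = integral {-1..1} (\<lambda>t. adj (fund_solution q w t) ** fund_solution q z t - adj (fund_solution q w t) ** fund_solution q w t)"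
        unfolding gram_def by (rule integral_diff[symmetric]) (rule gram_integrable[OF q])+
      also have "norm \<dots> \<le> integral {-1..1} (\<lambda>t::real. B * (C * cmod (z - w)))"
      proof (rule integral_norm_bound_integral)
        fix t :: real assume t: "t \<in> {-1..1}"
        have "norm (adj (fund_solution q w t) ** (fund_solution q z t - fund_solution q w t)) \<le> B * (C * cmod (z - w))"
          by (rule order_trans[OF norm_matrix_mult_le]) (use B C t elim in \<open>auto intro!: mult_mono\<close>)
        then show "norm (adj (fund_solution q w t) ** fund_solution q z t - adj (fund_solution q w t) ** fund_solution q w t) \<le> B * (C * cmod (z - w))"
          by (simp add: mm.diff_right)
      qed (auto intro!: integrable_diff gram_integrable[OF q])
      finally show ?case by (simp add: mult_ac)
    qed
    have "((\<lambda>z. 2 * (B * C) * cmod (z - w)) \<longlongrightarrow> 2 * (B * C) * cmod (w - w)) (at w)" by (intro tendsto_intros)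
    then show "((\<lambda>z. 2 * (B * C) * cmod (z - w)) \<longlongrightarrow> 0) (at w)" by simp
  qed
  then show ?thesis by (simp add: LIM_zero_iff)
qed

text \<open>
  Put \<open>R(z) = (z - l) m(z)\<close>. The definition of \<open>m\<close> gives \<open>\<Delta>(z) R(z) = - (z - l) N(z)\<close> with the numerator \<open>N\<close>, and
  pairing the Weyl solution for \<open>z\<close> with the eigenfunctions for \<open>l\<close> gives a formula for
  \<open>P (gram q l z) R(z)\<close>. In the limit these are the equations \<open>\<Delta>(l) R = 0\<close> and
  \<open>P (gram q l l) R = 2 \<i> P\<close>, whose only solution is \<open>\<i>\<close> times the norming matrix. As the map that sends
  \<open>X\<close> to \<open>(\<Delta>(l) X, P (gram q l l) X)\<close> is injective, it stays bounded below near \<open>l\<close>, and \<open>R(z)\<close> converges;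
  nothing need be known about the order of the pole beforehand.
\<close>

lemma weyl_residue:
  assumes U: "U \<in> unitaries" and l: "cnj l = l" and ev: "eventually (\<lambda>z. det (char_mat q U z) \<noteq> 0) (at l)"
  shows "((\<lambda>z. cscale (z - l) (weyl q U z)) \<longlongrightarrow> cscale \<i> (norming_mat q U l)) (at l)"
proof -
  define P where "P = Pi_mat q U l"
  define A where "A = norming_mat q U l"
  have P: "P ** P = P" "adj P = P" "char_mat q U l ** X = 0 \<longleftrightarrow> P ** X = X" for X :: "complex^('r+'r)^('r+'r)"
    unfolding P_def Pi_mat_def E_space_char_mat by (rule orth_projector_mkernel mkernel_projector_iff)+
  have A: "P ** A = A" "P ** (gram q l l ** A) = cscale 2 P" using norming_mat[OF q] by (simp_all add: A_def P_def)
  define om where "om z = adj (fund_solution q l 1) ** (sg ** fund_solution q z 1) + adj (fund_solution q l (-1)) ** (sg ** fund_solution q z (-1))" for z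
  define R where "R z = cscale (z - l) (weyl q U z)" for z
  have charR: "char_mat q U z ** R z = cscale (z - l) (- numer_mat q U z)" if "det (char_mat q U z) \<noteq> 0" for z
    by (simp add: R_def cscale_mult_right char_mat_weyl[OF that])
  have gramR: "P ** (gram q l z ** R z) = cscale \<i> (P ** (om z ** sg))" if nz: "det (char_mat q U z) \<noteq> 0" for z
  proof -
    have "A_bc U ** (fund_solution q l (-1) ** P) + B_bc U ** (fund_solution q l 1 ** P) = char_mat q U l ** P"
      by (simp add: char_mat_def mm.add_left matrix_mul_assoc)
    then have bc: "A_bc U ** (fund_solution q l (-1) ** P) + B_bc U ** (fund_solution q l 1 ** P) = 0" using P(3)[of P] P(1) by simp
    define m where "m = weyl q U z"
    define o1 where "o1 = adj (fund_solution q l 1) ** (sg ** fund_solution q z 1)"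
    define o2 where "o2 = adj (fund_solution q l (-1)) ** (sg ** fund_solution q z (-1))"
    have "P ** (o1 ** (m + sg)) = P ** (o2 ** (m - sg))"
      using boundary_form[OF U bc weyl_boundary[OF nz]]
      by (simp add: adj_mult P(2) m_def o1_def o2_def matrix_mul_assoc)
    then have "P ** ((o1 - o2) ** m) = - (P ** ((o1 + o2) ** sg))"
      by (simp add: mm.add_left mm.add_right mm.diff_left mm.diff_right algebra_simps)
    moreover have "o1 - o2 = cscale (\<i> * (z - l)) (gram q l z)"
      using gram_wronskian[OF q, of l z] by (simp add: o1_def o2_def l)
    ultimately have "cscale \<i> (P ** (gram q l z ** R z)) = - (P ** (om z ** sg))"
      by (simp add: R_def om_def o1_def o2_def m_def cscale_mult_left cscale_mult_right mult.commute)
    then have "cscale (- \<i>) (cscale \<i> (P ** (gram q l z ** R z))) = cscale (- \<i>) (- (P ** (om z ** sg)))" by simp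
    then show ?thesis by (simp add: cscale_minus cscale_minus_left)
  qed
  obtain c where c: "c > 0" "\<And>X :: complex^('r+'r)^('r+'r). c * norm X \<le> norm (char_mat q U l ** X, P ** (gram q l l ** X))"
  proof -
    have lin: "linear (\<lambda>X :: complex^('r+'r)^('r+'r). (char_mat q U l ** X, P ** (gram q l l ** X)))"
      by (intro bounded_linear.linear bounded_linear_Pair mm.bounded_linear_right
          bounded_linear_compose[OF mm.bounded_linear_right mm.bounded_linear_right])
    have inj: "inj (\<lambda>X :: complex^('r+'r)^('r+'r). (char_mat q U l ** X, P ** (gram q l l ** X)))"
      unfolding linear_injective_0[OF lin]
    proof (intro allI impI)
      fix X :: "complex^('r+'r)^('r+'r)"
      assume "(char_mat q U l ** X, P ** (gram q l l ** X)) = 0"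
      then have "P ** X = X" "P ** (gram q l l ** X) = 0" using P(3) by (auto simp: zero_prod_def)
      then show "X = 0" using mkernel_gram_definite[OF q, of U l X] by (simp add: P_def)
    qed
    show thesis
    proof (rule linear_inj_bounded_below_pos[OF lin inj])
      fix B assume "B > 0" "\<And>X :: complex^('r+'r)^('r+'r). B * norm X \<le> norm (char_mat q U l ** X, P ** (gram q l l ** X))"
      then show thesis by (rule that)
    qed
  qed
  have tY: "((\<lambda>z. fund_solution q z 1) \<longlongrightarrow> fund_solution q l 1) (at l)" "((\<lambda>z. fund_solution q z (-1)) \<longlongrightarrow> fund_solution q l (-1)) (at l)"
    by (rule fund_solution_tendsto; simp)+
  have tchar: "((\<lambda>z. char_mat q U z) \<longlongrightarrow> char_mat q U l) (at l)"
    unfolding char_mat_def by (intro tendsto_add mm.tendsto tendsto_const tY)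
  have tnum: "((\<lambda>z. numer_mat q U z) \<longlongrightarrow> numer_mat q U l) (at l)"
    unfolding numer_mat_def by (intro tendsto_diff mm.tendsto tendsto_const tY)
  have "(om \<longlongrightarrow> adj (fund_solution q l 1) ** (sg ** fund_solution q l 1) + adj (fund_solution q l (-1)) ** (sg ** fund_solution q l (-1))) (at l)"
    unfolding om_def[abs_def] by (intro tendsto_add mm.tendsto tendsto_const tY)
  moreover have "adj (fund_solution q l x) ** (sg ** fund_solution q l x) = sg" if "x \<in> {-1..1}" for x
    using fund_solution_symplectic[OF q that, of l] by (simp add: l)
  ultimately have tom: "(om \<longlongrightarrow> sg + sg) (at l)" by simp
  define E where "E z = norm (cscale (z - l) (- numer_mat q U z) - char_mat q U z ** cscale \<i> A)
     + norm (cscale \<i> (P ** (om z ** sg)) - P ** (gram q l z ** cscale \<i> A))" for z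
  have tcs: "((\<lambda>z. cscale (z - l) (- numer_mat q U z)) \<longlongrightarrow> 0) (at l)"
  proof (rule Lim_null_comparison)
    show "eventually (\<lambda>z. norm (cscale (z - l) (- numer_mat q U z)) \<le> cmod (z - l) * norm (numer_mat q U z)) (at l)"
      by (simp add: norm_cscale)
    have "((\<lambda>z. cmod (z - l) * norm (numer_mat q U z)) \<longlongrightarrow> cmod (l - l) * norm (numer_mat q U l)) (at l)"
      by (intro tendsto_intros tnum)
    then show "((\<lambda>z. cmod (z - l) * norm (numer_mat q U z)) \<longlongrightarrow> 0) (at l)" by simp
  qed
  have "(E \<longlongrightarrow> norm (0 - char_mat q U l ** cscale \<i> A) + norm (cscale \<i> (P ** ((sg + sg) ** sg)) - P ** (gram q l l ** cscale \<i> A))) (at l)"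
    unfolding E_def[abs_def]
    by (intro tendsto_add tendsto_norm tendsto_diff tcs mm.tendsto tendsto_const tchar gram_tendsto tom
        bounded_linear.tendsto[OF bounded_linear_cscale])
  moreover have "char_mat q U l ** cscale \<i> A = 0" using P(3)[of A] A(1) by (simp add: cscale_mult_right)
  moreover have "cscale \<i> (P ** ((sg + sg) ** sg)) - P ** (gram q l l ** cscale \<i> A) = 0"
  proof -
    have "X + X = cscale 2 X" for X :: "complex^('r+'r)^('r+'r)" by (simp add: vec_eq_iff)
    then have "(sg + sg) ** sg = cscale 2 (mat 1 :: complex^('r+'r)^('r+'r))" unfolding mm.add_left sg_sg by blast
    then show ?thesis using A(2) by (simp add: cscale_mult_right)
  qed
  ultimately have tE: "(E \<longlongrightarrow> 0) (at l)" by simp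
  define D where "D z = norm (char_mat q U z - char_mat q U l) + norm P * norm (gram q l z - gram q l l)" for z
  have "(D \<longlongrightarrow> norm (char_mat q U l - char_mat q U l) + norm P * norm (gram q l l - gram q l l)) (at l)"
    unfolding D_def[abs_def] by (intro tendsto_intros tchar gram_tendsto)
  then have tD: "(D \<longlongrightarrow> 0) (at l)" by simp
  have evD: "eventually (\<lambda>z. D z < c/2) (at l)" using c(1) by (intro order_tendstoD(2)[OF tD]) simp
  have "((\<lambda>z. R z - cscale \<i> A) \<longlongrightarrow> 0) (at l)"
  proof (rule Lim_null_comparison)
    show "eventually (\<lambda>z. norm (R z - cscale \<i> A) \<le> 2 / c * E z) (at l)"
      using ev evD
    proof eventually_elim
      case (elim z)
      define X where "X = R z - cscale \<i> A"
      have "c * norm X \<le> norm (char_mat q U l ** X, P ** (gram q l l ** X))" by (rule c(2))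
      also have "\<dots> \<le> norm (char_mat q U l ** X) + norm (P ** (gram q l l ** X))" by (rule norm_Pair_le)
      also have "char_mat q U l ** X = char_mat q U z ** X - (char_mat q U z - char_mat q U l) ** X"
        by (simp add: mm.diff_left)
      also have "P ** (gram q l l ** X) = P ** (gram q l z ** X) - P ** ((gram q l z - gram q l l) ** X)"
        by (simp add: mm.diff_left mm.diff_right)
      also have "norm (char_mat q U z ** X - (char_mat q U z - char_mat q U l) ** X)
           + norm (P ** (gram q l z ** X) - P ** ((gram q l z - gram q l l) ** X))
         \<le> (norm (char_mat q U z ** X) + norm (char_mat q U z - char_mat q U l) * norm X)
          + (norm (P ** (gram q l z ** X)) + norm P * (norm (gram q l z - gram q l l) * norm X))"
        by (intro add_mono order_trans[OF norm_triangle_ineq4] order_refl norm_matrix_mult_le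
            order_trans[OF norm_matrix_mult_le] mult_left_mono norm_ge_zero)
      also have "\<dots> = E z + D z * norm X"
      proof -
        have e1: "char_mat q U z ** X = cscale (z - l) (- numer_mat q U z) - char_mat q U z ** cscale \<i> A"
          by (simp only: X_def mm.diff_right charR[OF elim(1)])
        have e2: "P ** (gram q l z ** X) = cscale \<i> (P ** (om z ** sg)) - P ** (gram q l z ** cscale \<i> A)"
          by (simp only: X_def mm.diff_right gramR[OF elim(1)])
        show ?thesis unfolding E_def D_def e1 e2 by (simp only: distrib_right mult.assoc add_ac)
      qed
      also have "\<dots> \<le> E z + c/2 * norm X" using elim(2) by (intro add_left_mono mult_right_mono) auto
      finally have "c/2 * norm X \<le> E z" by simp
      then show ?case using c(1) by (simp add: X_def field_simps)
    qed
    show "((\<lambda>z. 2 / c * E z) \<longlongrightarrow> 0) (at l)" using tendsto_mult_left[OF tE, of "2/c"] by simp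
  qed
  then show ?thesis by (simp add: LIM_zero_iff R_def A_def)
qed

end

subsection \<open>Lower bounds for the characteristic matrix\<close>

lemma norm_smult: "norm (c *s v) = cmod c * norm v" for v :: "complex^'n"
proof (rule power2_eq_imp_eq)
  show "(norm (c *s v))\<^sup>2 = (cmod c * norm v)\<^sup>2"
    by (simp add: norm_vector_power2 norm_mult power_mult_distrib sum_distrib_left)
qed auto

lemma free_mat_vector: "free_mat U z *v v = exp (\<i> * z) *s v + exp (- (\<i> * z)) *s (U *v v)"
  by (simp add: free_mat_def mv.add_left cscale_vector)

lemma free_mat_periodic: "free_mat U (z + 2 * of_real pi * of_int k) = free_mat U z"
proof -
  have "exp (\<i> * (z + 2 * of_real pi * of_int k)) = exp (\<i> * z) * exp ((2 * of_int k * pi) * \<i>)"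
    by (simp add: algebra_simps flip: exp_add)
  also have "exp ((2 * of_int k * pi) * \<i>) = 1" using exp_integer_2pi[of "of_int k"] by simp
  finally have "exp (\<i> * (z + 2 * of_real pi * of_int k)) = exp (\<i> * z)" by simp
  then show ?thesis by (simp add: free_mat_def exp_minus)
qed

text \<open>
  The two terms of the free matrix are multiples of isometries, by factors of different moduli.
\<close>

lemma free_mat_lower_nonreal:
  fixes U :: "complex^'n^'n"
  assumes U: "U \<in> unitaries"
  shows "\<bar>exp (Im z) - exp (- Im z)\<bar> * norm v \<le> norm (free_mat U z *v v)"
proof -
  have "\<bar>norm (exp (- (\<i> * z)) *s (U *v v)) - norm (- (exp (\<i> * z) *s v))\<bar> \<le> norm (exp (- (\<i> * z)) *s (U *v v) - - (exp (\<i> * z) *s v))"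
    by (rule norm_triangle_ineq3)
  also have "exp (- (\<i> * z)) *s (U *v v) - - (exp (\<i> * z) *s v) = free_mat U z *v v"
    by (simp add: free_mat_vector)
  also have "norm (exp (- (\<i> * z)) *s (U *v v)) - norm (- (exp (\<i> * z) *s v)) = (exp (Im z) - exp (- Im z)) * norm v"
    by (simp add: norm_smult norm_unitary[OF U] left_diff_distrib)
  finally show ?thesis by (simp add: abs_mult)
qed

lemma det_free_mat_nonreal:
  fixes U :: "complex^'n^'n"
  assumes "U \<in> unitaries" "Im z \<noteq> 0" shows "det (free_mat U z) \<noteq> 0"
  unfolding det_nonzero_iff_ker
proof (intro allI impI)
  fix v assume "free_mat U z *v v = 0"
  then have "\<bar>exp (Im z) - exp (- Im z)\<bar> * norm v \<le> 0" using free_mat_lower_nonreal[OF assms(1), of z v] by simp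
  moreover have "0 < \<bar>exp (Im z) - exp (- Im z)\<bar>" using assms(2) by simp
  ultimately show "v = 0" by (metis mult_le_0_iff norm_le_zero_iff not_le)
qed

text \<open>
  Every bounded set is surrounded by a large rectangle with sides in the grid. If \<open>\<xi>\<close> is not a zero of the
  determinant of the free matrix, which has the period \<open>2 \<pi>\<close>, then there are no zeros on the grid.
\<close>

definition grid :: "real \<Rightarrow> complex set" where
  "grid \<xi> = {z. 1 \<le> \<bar>Im z\<bar> \<or> (\<exists>k::int. Re z = \<xi> + 2 * pi * of_int k)}"

lemma free_mat_continuous: "continuous_on S (\<lambda>z. free_mat U z)"
  unfolding free_mat_def
  by (intro continuous_on_add bounded_linear.continuous_on[OF bounded_linear_cscale_left] continuous_intros)

text \<open>
  The two exponentials differ enough where \<open>|Im z| \<ge> 1\<close>. On the vertical lines with \<open>|Im z| \<le> 1\<close> periodicity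
  reduces the claim to a compact segment on which the matrix is invertible.
\<close>

lemma free_mat_lower:
  fixes U :: "complex^'n^'n"
  assumes U: "U \<in> unitaries" and \<xi>: "det (free_mat U (of_real \<xi>)) \<noteq> 0"
  obtains c where "c > 0" "\<And>z v. z \<in> grid \<xi> \<Longrightarrow> c * exp \<bar>Im z\<bar> * norm v \<le> norm (free_mat U z *v v)"
proof -
  define K where "K = {-1..1::real} \<times> sphere (0 :: complex^'n) 1"
  define f where "f p = norm (free_mat U (Complex \<xi> (fst p)) *v snd p)" for p
  have cK: "compact K" unfolding K_def by (intro compact_Times compact_Icc compact_sphere)
  have neK: "K \<noteq> {}"
  proof -
    have "(axis undefined 1 :: complex^'n) \<in> sphere 0 1" by (simp add: norm_axis_1)
    then show ?thesis by (auto simp: K_def)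
  qed
  have "continuous_on K (\<lambda>p. Complex \<xi> (fst p))"
    by (simp add: Complex_eq) (intro continuous_intros)
  then have cf: "continuous_on K f"
    unfolding f_def[abs_def]
    by (intro continuous_on_norm mv.continuous_on continuous_on_snd continuous_on_id
        continuous_on_compose2[OF free_mat_continuous[of UNIV]]) auto
  obtain p where p: "p \<in> K" "\<And>p'. p' \<in> K \<Longrightarrow> f p \<le> f p'"
    using continuous_attains_inf[OF cK neK cf] by blast
  have "det (free_mat U (Complex \<xi> (fst p))) \<noteq> 0"
  proof (cases "fst p = 0")
    case True then show ?thesis using \<xi> by (simp add: complex_of_real_def)
  next
    case False then show ?thesis using det_free_mat_nonreal[OF U] by simp
  qed
  moreover have "snd p \<noteq> 0" using p(1) by (auto simp: K_def)
  ultimately have fp: "f p > 0" using det_nonzero_iff_ker by (auto simp: f_def)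
  have low1: "f p * norm v \<le> norm (free_mat U z *v v)" if z: "\<bar>Im z\<bar> \<le> 1" "Re z = \<xi> + 2 * pi * of_int k" for z v and k :: int
  proof (cases "v = 0")
    case False
    define w where "w = (1 / norm v) *\<^sub>R v"
    have "(Im z, w) \<in> K" using z(1) False by (simp add: K_def w_def abs_le_iff)
    then have "f p \<le> f (Im z, w)" by (rule p(2))
    also have "f (Im z, w) = norm (free_mat U z *v w)"
    proof -
      have "z = Complex \<xi> (Im z) + 2 * of_real pi * of_int k" using z(2) by (simp add: complex_eq_iff)
      then have "free_mat U z = free_mat U (Complex \<xi> (Im z))" by (metis free_mat_periodic)
      then show ?thesis by (simp add: f_def)
    qed
    also have "\<dots> = norm (free_mat U z *v v) / norm v" by (simp add: w_def mv.scaleR_right)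
    finally show ?thesis using False by (simp add: field_simps)
  qed simp
  define c where "c = min (f p * exp (-1)) (1/2)"
  have c: "c > 0" using fp by (simp add: c_def)
  show thesis
  proof (rule that[OF c])
    fix z and v :: "complex^'n" assume z: "z \<in> grid \<xi>"
    show "c * exp \<bar>Im z\<bar> * norm v \<le> norm (free_mat U z *v v)"
    proof (cases "1 \<le> \<bar>Im z\<bar>")
      case True
      define t where "t = \<bar>Im z\<bar>"
      have t: "t \<ge> 1" using True by (simp add: t_def)
      have "exp (- t) \<le> 1/2 * exp t"
      proof -
        have "2 \<le> exp (2 * t)" using exp_ge_add_one_self[of "2*t"] t by linarith
        then have "2 * exp (-t) \<le> exp (2 * t) * exp (-t)" by (intro mult_right_mono) auto
        also have "\<dots> = exp t" by (simp flip: exp_add)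
        finally show ?thesis by simp
      qed
      moreover have "\<bar>exp (Im z) - exp (- Im z)\<bar> \<ge> exp t - exp (- t)" by (auto simp: t_def abs_if)
      moreover have "c * exp t \<le> 1/2 * exp t" by (intro mult_right_mono) (auto simp: c_def)
      ultimately have "c * exp t \<le> \<bar>exp (Im z) - exp (- Im z)\<bar>" by linarith
      then have "c * exp t * norm v \<le> \<bar>exp (Im z) - exp (- Im z)\<bar> * norm v" by (intro mult_right_mono) auto
      also have "\<dots> \<le> norm (free_mat U z *v v)" by (rule free_mat_lower_nonreal[OF U])
      finally show ?thesis by (simp add: t_def)
    next
      case False
      then obtain k :: int where k: "Re z = \<xi> + 2 * pi * of_int k" using z by (auto simp: grid_def)
      have "c * exp \<bar>Im z\<bar> \<le> f p * exp (-1) * exp 1" using False c fp by (intro mult_mono) (auto simp: c_def)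
      also have "\<dots> = f p" by (simp add: mult.assoc flip: exp_add)
      finally have "c * exp \<bar>Im z\<bar> * norm v \<le> f p * norm v" by (intro mult_right_mono) auto
      also have "\<dots> \<le> norm (free_mat U z *v v)" using False by (intro low1[OF _ k]) auto
      finally show ?thesis .
    qed
  qed
qed

lemma free_mat_holomorphic: "(\<lambda>z. free_mat U z $ i $ j) holomorphic_on S"
  unfolding free_mat_def by (simp, intro holomorphic_intros)

lemma det_diag_mult: "det (cscale w A) = w ^ CARD('n) * det A" for A :: "complex^'n^'n"
proof -
  have "cscale w A = diag (\<lambda>_. w) ** A" by (simp add: vec_eq_iff)
  then have "det (cscale w A) = det (diag (\<lambda>_. w) :: complex^'n^'n) * det A" by (simp add: det_mul)
  moreover have "det (diag (\<lambda>_. w) :: complex^'n^'n) = w ^ CARD('n)"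
    by (subst det_diagonal) (auto simp: diag_def)
  ultimately show ?thesis by simp
qed

text \<open>
  Up to a factor without zeros the determinant is the characteristic polynomial of \<open>- U\<close>, evaluated at
  \<open>exp (2 \<i> z)\<close>; this polynomial has a root, and the root is not \<open>0\<close> because \<open>U\<close> is invertible.
\<close>

lemma free_mat_zero_exists:
  fixes U :: "complex^'n^'n"
  assumes U: "U \<in> unitaries"
  obtains z where "det (free_mat U z) = 0"
proof -
  define p where "p w = det (cscale w (mat 1) + U)" for w
  have hol: "p holomorphic_on UNIV"
    unfolding p_def[abs_def] by (rule holomorphic_det) (simp, intro holomorphic_intros)
  have "\<exists>w. p w = 0"
  proof (rule ccontr)
    assume nz: "\<nexists>w. p w = 0"
    show False
    proof (rule Liouville_weak_inverse[OF hol])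
      fix B :: real
      have inv0: "((\<lambda>w::complex. inverse w) \<longlongrightarrow> 0) at_infinity" by (rule tendsto_inverse_0)
      have "((\<lambda>w. mat 1 + cscale (inverse w) U) \<longlongrightarrow> mat 1 + cscale 0 U) at_infinity"
        by (intro tendsto_add tendsto_const bounded_linear.tendsto[OF bounded_linear_cscale_left] inv0)
      then have "((\<lambda>w. det (mat 1 + cscale (inverse w) U)) \<longlongrightarrow> det (mat 1 :: complex^'n^'n)) at_infinity"
        using continuous_on_tendsto_compose[OF continuous_on_det[of UNIV], of "\<lambda>w. mat 1 + cscale (inverse w) U" "mat 1"] by simp
      then have "((\<lambda>w. cmod (det (mat 1 + cscale (inverse w) U))) \<longlongrightarrow> 1) at_infinity"
        using tendsto_norm by force
      then have 1: "eventually (\<lambda>w. 1/2 < cmod (det (mat 1 + cscale (inverse w) U))) at_infinity"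
        by (intro order_tendstoD(1)) auto
      have 2: "eventually (\<lambda>w::complex. max 1 (2 * \<bar>B\<bar>) \<le> cmod w) at_infinity"
        unfolding eventually_at_infinity by (intro exI[of _ "max 1 (2 * \<bar>B\<bar>)"]) auto
      show "eventually (\<lambda>w. B \<le> cmod (p w)) at_infinity"
        using 1 2
      proof eventually_elim
        case (elim w)
        then have w: "w \<noteq> 0" "1 \<le> cmod w" "2 * \<bar>B\<bar> \<le> cmod w" by auto
        have "cscale w (mat 1) + U = cscale w (mat 1 + cscale (inverse w) U)"
          using w by (simp add: cscale_add)
        then have "cmod (p w) = cmod w ^ CARD('n) * cmod (det (mat 1 + cscale (inverse w) U))"
          by (simp add: p_def det_diag_mult norm_mult norm_power)
        also have "\<dots> \<ge> cmod w * (1/2)"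
        proof (rule mult_mono)
          have "cmod w ^ 1 \<le> cmod w ^ CARD('n)" using w(2) by (intro power_increasing) auto
          then show "cmod w \<le> cmod w ^ CARD('n)" by simp
        qed (use elim in auto)
        finally show ?case using w(3) by linarith
      qed
    next
      fix w assume "p w = 0" then show False using nz by blast
    qed
  qed
  then obtain w where "p w = 0" by blast
  then obtain v where v: "(cscale w (mat 1) + U) *v v = 0" "v \<noteq> 0" unfolding p_def using det_nonzero_iff_ker by blast
  have "w \<noteq> 0"
  proof
    assume "w = 0"
    then have "U *v v = 0" using v(1) by simp
    then show False using norm_unitary[OF U, of v] v(2) by simp
  qed
  define z where "z = Ln w / (2 * \<i>)"
  have "2 * \<i> * z = Ln w" by (simp add: z_def)
  then have ew: "exp (2 * \<i> * z) = w" using \<open>w \<noteq> 0\<close> by simp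
  have "free_mat U z *v v = exp (- (\<i> * z)) *s ((cscale w (mat 1) + U) *v v)"
  proof -
    have "exp (\<i> * z) = exp (- (\<i> * z)) * w" unfolding ew[symmetric] by (simp flip: exp_add)
    then show ?thesis by (simp add: free_mat_vector mv.add_left cscale_vector vec_eq_iff algebra_simps)
  qed
  then have "free_mat U z *v v = 0" by (simp add: v(1))
  then have "det (free_mat U z) = 0" using v(2) det_nonzero_iff_ker by blast
  then show thesis by (rule that)
qed

context
  fixes q :: "real \<Rightarrow> complex^'r::finite^'r"
  assumes q: "q absolutely_integrable_on {-1..1}"
begin

lemma char_mat_asymptotics:
  assumes e: "e > 0"
  obtains R where "R > 0" "\<And>z. cmod z \<ge> R \<Longrightarrow> norm (char_mat q U z - free_mat U z) \<le> e * exp \<bar>Im z\<bar>"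
proof -
  define b where "b = norm (A_bc U) + norm (B_bc U) + 1"
  have b: "b > 0" by (simp add: b_def add_nonneg_pos)
  have eb: "e / b > 0" using e b by simp
  obtain R1 where R1: "R1 > 0" "\<And>z. cmod z \<ge> R1 \<Longrightarrow> norm (fund_solution q z 1 - free_solution z 1) \<le> e / b * exp (\<bar>Im z\<bar> * \<bar>1\<bar>)"
    using fund_solution_asymptotics[OF q _ eb, of 1] by auto
  obtain R2 where R2: "R2 > 0" "\<And>z. cmod z \<ge> R2 \<Longrightarrow> norm (fund_solution q z (-1) - free_solution z (-1)) \<le> e / b * exp (\<bar>Im z\<bar> * \<bar>-1\<bar>)"
    using fund_solution_asymptotics[OF q _ eb, of "-1"] by auto
  show thesis
  proof (rule that[of "max R1 R2"])
    show "max R1 R2 > 0" using R1 by simp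
    fix z assume z: "max R1 R2 \<le> cmod z"
    have "char_mat q U z - free_mat U z = A_bc U ** (fund_solution q z (-1) - free_solution z (-1)) + B_bc U ** (fund_solution q z 1 - free_solution z 1)"
      unfolding bc_free_solution[symmetric] char_mat_def by (simp add: mm.diff_right)
    also have "norm \<dots> \<le> norm (A_bc U) * (e / b * exp \<bar>Im z\<bar>) + norm (B_bc U) * (e / b * exp \<bar>Im z\<bar>)"
      using R1(2)[of z] R2(2)[of z] z
      by (intro norm_triangle_mono order_trans[OF norm_matrix_mult_le] mult_left_mono) auto
    also have "\<dots> = (norm (A_bc U) + norm (B_bc U)) * (e / b * exp \<bar>Im z\<bar>)" by (rule distrib_right[symmetric])
    also have "\<dots> \<le> b * (e / b * exp \<bar>Im z\<bar>)" 
    proof (rule mult_right_mono)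
      show "0 \<le> e / b * exp \<bar>Im z\<bar>" using e b by simp
    qed (simp add: b_def)
    also have "\<dots> = e * exp \<bar>Im z\<bar>" using b by simp
    finally show "norm (char_mat q U z - free_mat U z) \<le> e * exp \<bar>Im z\<bar>" .
  qed
qed

lemma char_mat_lower:
  assumes U: "U \<in> unitaries" and \<xi>: "det (free_mat U (of_real \<xi>)) \<noteq> 0"
  obtains c R where "c > 0" "R > 0"
    "\<And>z v. z \<in> grid \<xi> \<Longrightarrow> R \<le> cmod z \<Longrightarrow> c * exp \<bar>Im z\<bar> * norm v \<le> norm (char_mat q U z *v v)"
proof -
  obtain c where c: "c > 0" "\<And>z v. z \<in> grid \<xi> \<Longrightarrow> c * exp \<bar>Im z\<bar> * norm v \<le> norm (free_mat U z *v v)"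
    using free_mat_lower[OF U \<xi>] by metis
  have "c/2 > 0" using c by simp
  then obtain R where R: "R > 0" "\<And>z. cmod z \<ge> R \<Longrightarrow> norm (char_mat q U z - free_mat U z) \<le> c/2 * exp \<bar>Im z\<bar>"
    using char_mat_asymptotics by metis
  show thesis
  proof (rule that[OF \<open>c/2 > 0\<close> R(1)])
    fix z and v :: "complex^('r+'r)" assume z: "z \<in> grid \<xi>" "R \<le> cmod z"
    have "norm ((char_mat q U z - free_mat U z) *v v) \<le> c/2 * exp \<bar>Im z\<bar> * norm v"
      by (rule order_trans[OF norm_matrix_vector_le]) (intro mult_right_mono R(2) z, simp)
    moreover have "free_mat U z *v v = char_mat q U z *v v - (char_mat q U z - free_mat U z) *v v"
      by (simp add: mv.diff_left)
    then have "norm (free_mat U z *v v) \<le> norm (char_mat q U z *v v) + norm ((char_mat q U z - free_mat U z) *v v)"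
      by (simp add: norm_triangle_ineq4)
    ultimately show "c/2 * exp \<bar>Im z\<bar> * norm v \<le> norm (char_mat q U z *v v)"
      using c(2)[OF z(1), of v] by (simp add: algebra_simps)
  qed
qed

lemma det_char_mat_holomorphic: "(\<lambda>z. det (char_mat q U z)) holomorphic_on S"
  by (rule holomorphic_det, rule holomorphic_on_subset[OF char_mat_holomorphic(1)[OF q]]) simp

lemma char_mat_zeros_finite:
  assumes U: "U \<in> unitaries" and K: "compact K"
  shows "finite {z\<in>K. det (char_mat q U z) = 0}"
proof -
  have nc: "\<not> (\<lambda>z. det (char_mat q U z)) constant_on UNIV \<or> (\<forall>z. det (char_mat q U z) \<noteq> 0)"
    using det_char_mat_real[OF q U] by (metis UNIV_I constant_on_def imaginary_unit.simps(2) one_neq_zero)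
  show ?thesis
  proof (cases "\<forall>z. det (char_mat q U z) \<noteq> 0")
    case False
    then have "\<not> (\<lambda>z. det (char_mat q U z)) constant_on UNIV" using nc by blast
    from holomorphic_compact_finite_zeros[OF det_char_mat_holomorphic open_UNIV connected_UNIV K _ this]
    show ?thesis by simp
  qed simp
qed

lemma eventually_det_char_mat_nz:
  assumes U: "U \<in> unitaries"
  shows "eventually (\<lambda>z. det (char_mat q U z) \<noteq> 0) (at w)"
proof -
  have fin: "finite ({z\<in>cball w 1. det (char_mat q U z) = 0} - {w})"
    using char_mat_zeros_finite[OF U compact_cball] by simp
  have "open (ball w 1 - ({z\<in>cball w 1. det (char_mat q U z) = 0} - {w}))"
    using finite_imp_closed[OF fin] by (intro open_Diff open_ball)
  moreover have "w \<in> ball w 1 - ({z\<in>cball w 1. det (char_mat q U z) = 0} - {w})" by simp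
  ultimately show ?thesis
    unfolding eventually_at_topological by (intro exI[of _ "ball w 1 - ({z\<in>cball w 1. det (char_mat q U z) = 0} - {w})"]) auto
qed

text \<open>
  The functions \<open>det \<Delta>(z + 2 \<pi> s k)\<close> converge locally uniformly, as \<open>k\<close> tends to infinity, to the determinant
  of the free matrix, which has a zero. If the real zeros of \<open>det \<Delta>\<close> were bounded in the direction \<open>s\<close>,
  then, all zeros being real, Hurwitz's theorem would exclude a zero of the limit.
\<close>

lemma char_mat_zero_shifted:
  assumes U: "U \<in> unitaries" and s: "s = 1 \<or> s = (-1::real)"
  obtains l :: real where "s * l > N" "det (char_mat q U (of_real l)) = 0"
proof -
  have "\<exists>l. s * l > N \<and> det (char_mat q U (of_real l)) = 0"
  proof (rule ccontr)
    assume no: "\<nexists>l. s * l > N \<and> det (char_mat q U (of_real l)) = 0"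
    obtain z0 where z0: "det (free_mat U z0) = 0" using free_mat_zero_exists[OF U] by blast
    obtain n0 :: nat where n0: "\<bar>N\<bar> + cmod z0 + 1 < real n0" using reals_Archimedean2 by blast
    define a where "a n = complex_of_real (2 * pi * of_int (int (n + n0)) * s)" for n :: nat
    have a: "\<exists>k::int. a n = 2 * of_real pi * of_int k" for n
      using s by (auto simp: a_def intro: exI[of _ "int (n+n0)"] exI[of _ "- int (n+n0)"])
    have ra: "s * Re (a n) \<ge> real (n + n0)" for n
    proof -
      have "s * Re (a n) = 2 * pi * real (n + n0)" using s by (auto simp: a_def)
      also have "\<dots> \<ge> 1 * real (n + n0)" using pi_gt3 by (intro mult_right_mono) auto
      finally show ?thesis by simp
    qed
    have sx: "s * x \<ge> - \<bar>x\<bar>" for x using s by auto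
    have "det (free_mat U z0) \<noteq> 0"
    proof (rule Hurwitz_no_zeros[of "ball z0 1" "\<lambda>n z. det (char_mat q U (z + a n))" "\<lambda>z. det (free_mat U z)"])
      show "(\<lambda>z. det (char_mat q U (z + a n))) holomorphic_on ball z0 1" for n
      proof -
        have "(\<lambda>z. z + a n) holomorphic_on ball z0 1" by (intro holomorphic_intros)
        from holomorphic_on_compose[OF this det_char_mat_holomorphic[of U]] show ?thesis by (simp add: o_def)
      qed
      show "(\<lambda>z. det (free_mat U z)) holomorphic_on ball z0 1"
        by (rule holomorphic_det) (rule free_mat_holomorphic)
      show "\<not> (\<lambda>z. det (free_mat U z)) constant_on ball z0 1"
      proof
        assume "(\<lambda>z. det (free_mat U z)) constant_on ball z0 1"
        then have z: "det (free_mat U z) = 0" if "z \<in> ball z0 1" for z using z0 that unfolding constant_on_def by (metis centre_in_ball zero_less_one)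
        have "Im z0 = 0" using z0 det_free_mat_nonreal[OF U, of z0] by blast
        then have "det (free_mat U (z0 + \<i> / 2)) \<noteq> 0" by (intro det_free_mat_nonreal[OF U]) simp
        moreover have "z0 + \<i> / 2 \<in> ball z0 1" by (simp add: dist_norm)
        ultimately show False using z by blast
      qed
      show "det (char_mat q U (z + a n)) \<noteq> 0" if z: "z \<in> ball z0 1" for n z
      proof
        assume d: "det (char_mat q U (z + a n)) = 0"
        then have "Im (z + a n) = 0" by (rule det_char_mat_real[OF q U])
        then have re: "z + a n = of_real (Re (z + a n))" by (simp add: complex_eq_iff)
        have "cmod z \<le> cmod z0 + 1" using z norm_triangle_ineq2[of z z0] by (simp add: dist_norm norm_minus_commute)
        then have "\<bar>Re z\<bar> \<le> cmod z0 + 1" using abs_Re_le_cmod[of z] by linarith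
        then have "s * Re (z + a n) > N" using ra[of n] n0 sx[of "Re z"] by (simp add: distrib_left)
        then show False using no d re by metis
      qed
      fix K assume K: "compact K" "K \<subseteq> ball z0 1"
      obtain B where B: "\<And>z. z \<in> K \<Longrightarrow> norm (free_mat U z) \<le> B"
      proof -
        have "bounded ((\<lambda>z. free_mat U z) ` K)"
          using K(1) by (intro compact_imp_bounded compact_continuous_image free_mat_continuous)
        then obtain B where "\<forall>v\<in>(\<lambda>z. free_mat U z) ` K. norm v \<le> B" unfolding bounded_iff by blast
        then show thesis by (intro that[of B]) auto
      qed
      have Kz: "cmod z \<le> cmod z0 + 1" if "z \<in> K" for z
        using K(2) that norm_triangle_ineq2[of z z0] by (fastforce simp: dist_norm norm_minus_commute)
      have small: "\<forall>\<^sub>F n in sequentially. \<forall>z\<in>K. norm (char_mat q U (z + a n) - free_mat U z) < e" if e: "e > 0" for e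
      proof -
        define e' where "e' = e / (2 * exp (cmod z0 + 1))"
        have e': "e' > 0" using e by (simp add: e'_def)
        obtain R where R: "R > 0" "\<And>z. cmod z \<ge> R \<Longrightarrow> norm (char_mat q U z - free_mat U z) \<le> e' * exp \<bar>Im z\<bar>"
          using char_mat_asymptotics[OF e'] by metis
        obtain n1 :: nat where n1: "R + cmod z0 + 1 < real n1" using reals_Archimedean2 by blast
        show ?thesis
        proof (rule eventually_sequentiallyI[of n1], intro ballI)
          fix n z assume n: "n1 \<le> n" and z: "z \<in> K"
          have "real n1 \<le> real (n + n0)" using n by simp
          also have "\<dots> \<le> s * Re (a n)" by (rule ra)
          also have "\<dots> \<le> cmod (a n)" using s abs_Re_le_cmod[of "a n"] by auto
          finally have "cmod (z + a n) \<ge> R"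
            using norm_triangle_ineq2[of "a n" "- z"] Kz[OF z] n1 by (simp add: add.commute)
          then have "norm (char_mat q U (z + a n) - free_mat U (z + a n)) \<le> e' * exp \<bar>Im (z + a n)\<bar>" by (rule R(2))
          moreover have "free_mat U (z + a n) = free_mat U z" using a[of n] free_mat_periodic by metis
          moreover have "\<bar>Im (z + a n)\<bar> \<le> cmod z0 + 1" using abs_Im_le_cmod[of z] Kz[OF z] by (simp add: a_def)
          then have "e' * exp \<bar>Im (z + a n)\<bar> \<le> e' * exp (cmod z0 + 1)" using e' by (intro mult_left_mono) auto
          moreover have "e' * exp (cmod z0 + 1) < e" using e by (simp add: e'_def)
          ultimately show "norm (char_mat q U (z + a n) - free_mat U z) < e" by simp
        qed
      qed
      show "uniform_limit K (\<lambda>n z. det (char_mat q U (z + a n))) (\<lambda>z. det (free_mat U z)) sequentially"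
      proof (rule uniform_limit_compose_uniformly_continuous_on[where B="cball 0 (B+1)" and f=det
            and g="\<lambda>n z. char_mat q U (z + a n)" and g'="free_mat U"])
        show "uniform_limit K (\<lambda>n z. char_mat q U (z + a n)) (free_mat U) sequentially"
          by (rule uniform_limitI) (use small in \<open>simp add: dist_norm\<close>)
        show "uniformly_continuous_on (cball 0 (B+1)) (det :: complex^('r+'r)^('r+'r) \<Rightarrow> complex)"
          by (rule compact_uniformly_continuous[OF continuous_on_det compact_cball])
        show "\<forall>\<^sub>F n in sequentially. \<forall>z\<in>K. char_mat q U (z + a n) \<in> cball 0 (B+1)"
          using small[OF zero_less_one]
        proof eventually_elim
          case (elim n)
          show ?case
          proof
            fix z assume z: "z \<in> K"
            have "norm (char_mat q U (z + a n)) \<le> norm (char_mat q U (z + a n) - free_mat U z) + norm (free_mat U z)"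
              using norm_triangle_ineq[of "char_mat q U (z + a n) - free_mat U z" "free_mat U z"] by simp
            then show "char_mat q U (z + a n) \<in> cball 0 (B+1)" using elim z B[OF z] by force
          qed
        qed
      qed auto
    qed auto
    then show False using z0 by simp
  qed
  then show thesis using that by blast
qed

end

subsection \<open>Enumeration of the eigenvalues\<close>

lemma locally_finite_enumeration:
  fixes E :: "real set"
  assumes fin: "\<And>b. finite {x\<in>E. x \<le> b}" and unb: "\<And>b. \<exists>x\<in>E. b < x"
  obtains e :: "nat \<Rightarrow> real" where "strict_mono e" "range e = E"
proof -
  define nx where "nx b = Min {x\<in>E. b < x \<and> x \<le> (SOME y. y \<in> E \<and> b < y)}" for b
  have nx: "nx b \<in> E" "b < nx b" "\<And>x. x \<in> E \<Longrightarrow> b < x \<Longrightarrow> nx b \<le> x" for b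
  proof -
    define y where "y = (SOME y. y \<in> E \<and> b < y)"
    have y: "y \<in> E" "b < y" using someI_ex[of "\<lambda>y. y \<in> E \<and> b < y"] unb[of b] by (auto simp: y_def)
    define S where "S = {x\<in>E. b < x \<and> x \<le> y}"
    have S: "finite S" "S \<noteq> {}" using finite_subset[OF _ fin[of y], of S] y by (auto simp: S_def)
    have eq: "nx b = Min S" by (simp add: nx_def S_def y_def)
    show "nx b \<in> E" "b < nx b" using Min_in[OF S] by (auto simp: eq S_def)
    show "nx b \<le> x" if "x \<in> E" "b < x" for x
    proof (cases "x \<le> y")
      case True then show ?thesis using S that by (auto simp: eq S_def intro!: Min_le)
    next
      case False then show ?thesis using Min_in[OF S] by (auto simp: eq S_def)
    qed
  qed
  obtain x0 where x0: "x0 \<in> E" using unb by blast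
  have low: "\<exists>b. \<forall>x\<in>E. b < x"
  proof -
    have "\<forall>x\<in>E. Min {x\<in>E. x \<le> x0} - 1 < x"
    proof
      fix x assume x: "x \<in> E"
      have "Min {x\<in>E. x \<le> x0} \<le> x0" using fin[of x0] x0 by (intro Min_le) auto
      then show "Min {x\<in>E. x \<le> x0} - 1 < x"
      proof (cases "x \<le> x0")
        case True
        then have "Min {x\<in>E. x \<le> x0} \<le> x" using fin[of x0] x by (intro Min_le) auto
        then show ?thesis by simp
      qed auto
    qed
    then show ?thesis by blast
  qed
  then obtain b0 where b0: "\<And>x. x \<in> E \<Longrightarrow> b0 < x" by blast
  define e where "e = rec_nat (nx b0) (\<lambda>_ x. nx x)"
  have e0: "e 0 = nx b0" and eS: "e (Suc n) = nx (e n)" for n by (simp_all add: e_def)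
  have sm: "strict_mono e" unfolding strict_mono_Suc_iff by (simp add: eS nx(2))
  have eE: "e n \<in> E" for n by (cases n) (simp_all add: e0 eS nx(1))
  have "x \<in> range e" if x: "x \<in> E" for x
  proof (rule ccontr)
    assume nr: "x \<notin> range e"
    have lt: "e n < x" for n
    proof (induction n)
      case 0
      have "e 0 \<le> x" unfolding e0 by (rule nx(3)[OF x b0[OF x]])
      then show ?case using nr by (metis order_le_less rangeI)
    next
      case (Suc n)
      have "e (Suc n) \<le> x" unfolding eS by (rule nx(3)[OF x Suc])
      then show ?case using nr by (metis order_le_less rangeI)
    qed
    then have "range e \<subseteq> {y\<in>E. y \<le> x}" using eE by (auto intro: less_imp_le)
    then have "finite (range e)" using fin finite_subset by blast
    moreover have "inj e" using sm by (simp add: strict_mono_imp_inj_on)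
    ultimately show False using range_inj_infinite by blast
  qed
  then have "range e = E" using eE by auto
  with sm that show thesis by blast
qed

text \<open>
  The nonnegative and the negative elements are enumerated separately, both starting next to \<open>0\<close>. Two
  strictly increasing enumerations by the integers differ by a shift, which the normalisation
  determines.
\<close>

lemma int_enumeration:
  fixes E :: "real set"
  assumes fin: "\<And>a b. finite {x\<in>E. a \<le> x \<and> x \<le> b}" and up: "\<And>b. \<exists>x\<in>E. b < x" and dn: "\<And>b. \<exists>x\<in>E. x < b"
  shows "\<exists>!l :: int \<Rightarrow> real. strict_mono l \<and> range l = E \<and> l 0 < 0 \<and> 0 \<le> l 1"
proof -
  obtain p :: "nat \<Rightarrow> real" where p: "strict_mono p" "range p = {x\<in>E. 0 \<le> x}"
  proof (rule locally_finite_enumeration[of "{x\<in>E. 0 \<le> x}"])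
    show "finite {x \<in> {x \<in> E. 0 \<le> x}. x \<le> b}" for b using fin[of 0 b] by (simp add: conj_assoc)
    show "\<exists>x\<in>{x \<in> E. 0 \<le> x}. b < x" for b using up[of "max 0 b"] by (auto intro: less_imp_le)
  next
    fix e :: "nat \<Rightarrow> real" assume "strict_mono e" "range e = {x \<in> E. 0 \<le> x}"
    then show thesis by (rule that)
  qed
  obtain m :: "nat \<Rightarrow> real" where m: "strict_mono m" "range m = {x. - x \<in> E \<and> 0 < x}"
  proof (rule locally_finite_enumeration[of "{x. - x \<in> E \<and> 0 < x}"])
    show "finite {x \<in> {x. - x \<in> E \<and> 0 < x}. x \<le> b}" for b
      by (rule finite_subset[OF _ finite_imageI[OF fin[of "-b" 0], of uminus]]) (force simp: image_iff intro: minus_minus[symmetric])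
    show "\<exists>x\<in>{x. - x \<in> E \<and> 0 < x}. b < x" for b
    proof -
      obtain x where "x \<in> E" "x < min 0 (-b)" using dn by blast
      then show ?thesis by (intro bexI[of _ "-x"]) auto
    qed
  next
    fix e :: "nat \<Rightarrow> real" assume "strict_mono e" "range e = {x. - x \<in> E \<and> 0 < x}"
    then show thesis by (rule that)
  qed
  have p0: "p n \<in> E" "0 \<le> p n" for n using p(2) by blast+
  have m0: "- m n \<in> E" "0 < m n" for n using m(2) by blast+
  define l where "l j = (if 1 \<le> j then p (nat (j - 1)) else - m (nat (- j)))" for j :: int
  have l_mono: "strict_mono l"
  proof (rule strict_monoI)
    fix i j :: int assume ij: "i < j"
    consider "1 \<le> i" | "i < 1" "1 \<le> j" | "j < 1" by linarith
    then show "l i < l j"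
    proof cases
      case 1 then show ?thesis using ij strict_monoD[OF p(1), of "nat (i-1)" "nat (j-1)"] by (simp add: l_def)
    next
      case 2 then show ?thesis using p0(2)[of "nat (j-1)"] m0(2)[of "nat (-i)"] by (simp add: l_def)
    next
      case 3 then show ?thesis using ij strict_monoD[OF m(1), of "nat (-j)" "nat (-i)"] by (simp add: l_def)
    qed
  qed
  have "range l = E"
  proof (intro subset_antisym subsetI)
    fix x assume x: "x \<in> E"
    show "x \<in> range l"
    proof (cases "0 \<le> x")
      case True
      then obtain n where "x = p n" using x p(2) by blast
      then have "x = l (int n + 1)" by (simp add: l_def)
      then show ?thesis by blast
    next
      case False
      then have "- x \<in> range m" using x m(2) by simp
      then obtain n where "- x = m n" by blast
      then have "x = l (- int n)" by (simp add: l_def)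
      then show ?thesis by blast
    qed
  qed (use p0 m0 in \<open>auto simp: l_def\<close>)
  with l_mono have ex: "strict_mono l \<and> range l = E \<and> l 0 < 0 \<and> 0 \<le> l 1"
    using p0(2)[of 0] m0(2)[of 0] by (simp add: l_def)
  have uniq: "l' = l" if l': "strict_mono l' \<and> range l' = E \<and> l' 0 < 0 \<and> 0 \<le> l' 1" for l' :: "int \<Rightarrow> real"
  proof -
    have "\<forall>j. \<exists>i. l i = l' j" using l' ex by (metis rangeI rangeE)
    then obtain h where h: "\<And>j. l (h j) = l' j" by metis
    have lm: "l i < l j \<longleftrightarrow> i < j" for i j using ex strict_mono_less by blast
    have hm: "h i < h j" if "i < j" for i j using l' that by (simp add: lm[symmetric] h strict_mono_less)
    have hstep: "h (j + 1) = h j + 1" for j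
    proof -
      obtain k where k: "l' k = l (h j + 1)" using l' ex by (metis rangeI rangeE)
      then have "l (h k) = l (h j + 1)" by (simp add: h)
      then have hk: "h k = h j + 1" using ex by (simp add: strict_mono_eq)
      have "j < k"
      proof (rule ccontr)
        assume "\<not> j < k"
        then have "k = j \<or> k < j" by auto
        then have "h k \<le> h j" using hm[of k j] by fastforce
        then show False unfolding hk by simp
      qed
      then have "h (j + 1) \<le> h k" using hm[of "j+1" k] by (cases "j + 1 = k") auto
      moreover have "h j < h (j+1)" by (rule hm) simp
      ultimately show ?thesis using hk by simp
    qed
    have hlin: "h j = h 0 + j" for j
    proof (induction j rule: int_induct[where k=0])
      case base show ?case by simp
    next
      case (step1 i) then show ?case by (simp add: hstep)
    next
      case (step2 i) then show ?case using hstep[of "i - 1"] by simp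
    qed
    have "l (h 0) < l 1" using l' ex h[of 0] by linarith
    then have "h 0 < 1" by (simp add: lm)
    moreover have "l 0 < l (h 1)" using l' ex h[of 1] by linarith
    then have "0 < h 1" by (simp add: lm)
    ultimately have "h 0 = 0" using hstep[of 0] by simp
    then show "l' = l" using h hlin by (intro ext) (metis add_0)
  qed
  show ?thesis
  proof (rule ex1I)
    show "strict_mono l \<and> range l = E \<and> l 0 < 0 \<and> 0 \<le> l 1" by (rule ex)
  qed (rule uniq)
qed

lemma eigenvalue_seq:
  fixes q :: "real \<Rightarrow> complex^'r::finite^'r"
  assumes q: "q absolutely_integrable_on {-1..1}" and U: "U \<in> unitaries"
  shows "range (\<lambda>j. complex_of_real (eigenvalue_seq q U j)) = {z. det (char_mat q U z) = 0}"
proof -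
  define E where "E = {x. det (char_mat q U (complex_of_real x)) = 0}"
  have TE: "T_eigenvalues q U = of_real ` E"
  proof -
    have "z \<in> of_real ` E" if "det (char_mat q U z) = 0" for z
    proof -
      have zz: "complex_of_real (Re z) = z" using det_char_mat_real[OF q U that] by (simp add: complex_eq_iff)
      have "Re z \<in> E" by (simp add: E_def zz that)
      then have "complex_of_real (Re z) \<in> of_real ` E" by (rule imageI)
      then show ?thesis by (simp only: zz)
    qed
    then show ?thesis unfolding T_eigenvalues_char_mat[OF q] by (auto simp: E_def)
  qed
  have "\<exists>!l :: int \<Rightarrow> real. strict_mono l \<and> range l = E \<and> l 0 < 0 \<and> 0 \<le> l 1"
  proof (rule int_enumeration)
    fix a b :: real
    have "finite {z\<in>of_real ` {a..b}. det (char_mat q U z) = 0}"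
      by (rule char_mat_zeros_finite[OF q U]) (intro compact_continuous_image continuous_intros compact_Icc)
    then have "finite (complex_of_real -` {z\<in>of_real ` {a..b}. det (char_mat q U z) = 0})"
      by (rule finite_vimageI) (simp add: inj_def)
    then show "finite {x\<in>E. a \<le> x \<and> x \<le> b}" by (rule finite_subset[rotated]) (auto simp: E_def)
  next
    fix b :: real
    obtain l where "1 * l > b" "det (char_mat q U (of_real l)) = 0" using char_mat_zero_shifted[OF q U, of 1] by auto
    then show "\<exists>x\<in>E. b < x" by (auto simp: E_def)
    obtain l where "- 1 * l > - b" "det (char_mat q U (of_real l)) = 0" using char_mat_zero_shifted[OF q U, where s="-1" and N="-b"] by auto
    then show "\<exists>x\<in>E. x < b" by (auto simp: E_def)
  qed
  moreover have "(range (\<lambda>j. complex_of_real (l j)) = T_eigenvalues q U) = (range l = E)" for l :: "int \<Rightarrow> real"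
    unfolding TE image_image[symmetric, of of_real l] by (rule inj_image_eq_iff) (simp add: inj_def)
  ultimately have "\<exists>!l. strict_mono l \<and> range (\<lambda>j. complex_of_real (l j)) = T_eigenvalues q U \<and> l 0 < 0 \<and> 0 \<le> l (1::int)"
    by simp
  from theI'[OF this, folded eigenvalue_seq_def]
  have "range (\<lambda>j. complex_of_real (eigenvalue_seq q U j)) = T_eigenvalues q U" by (elim conjE)
  then show ?thesis by (simp only: T_eigenvalues_char_mat[OF q])
qed

section \<open>Uniqueness\<close>

subsection \<open>Entire functions bounded on the grid\<close>

lemma grid_cnj: "z \<in> grid \<xi> \<Longrightarrow> cnj z \<in> grid \<xi>" by (simp add: grid_def)

text \<open>
  Riemann's theorem on removable singularities, at all points of the discrete set \<open>A\<close>.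
\<close>

lemma entire_extension:
  assumes hol: "f holomorphic_on - A"
    and iso: "\<And>a. eventually (\<lambda>z. z \<notin> A) (at a)"
    and lim: "\<And>a. a \<in> A \<Longrightarrow> ((\<lambda>z. (z - a) * f z) \<longlongrightarrow> 0) (at a)"
  obtains g where "g holomorphic_on UNIV" "\<And>z. z \<notin> A \<Longrightarrow> g z = f z"
proof -
  define g where "g z = (if z \<in> A then Lim (at z) f else f z)" for z
  have "g field_differentiable at a" for a
  proof -
    obtain e where e: "e > 0" "\<And>z. z \<in> ball a e \<Longrightarrow> z \<noteq> a \<Longrightarrow> z \<notin> A"
      using iso[of a] unfolding eventually_at by (auto simp: dist_commute)
    have hol1: "f holomorphic_on ball a e - {a}" by (rule holomorphic_on_subset[OF hol]) (use e(2) in auto)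
    have "\<exists>h. h holomorphic_on ball a e \<and> (\<forall>z\<in>ball a e. h z = g z)"
    proof (cases "a \<in> A")
      case True
      obtain h where h: "h holomorphic_on ball a e" "\<forall>z\<in>ball a e - {a}. h z = f z"
        using holomorphic_on_extend_lim[OF hol1] lim[OF True] e(1) by auto
      have "isCont h a" using h(1) e(1) holomorphic_on_imp_continuous_on continuous_on_interior by fastforce
      then have "(h \<longlongrightarrow> h a) (at a)" by (simp add: isCont_def)
      then have "(f \<longlongrightarrow> h a) (at a)"
        by (rule Lim_transform_within_open[where s="ball a e"]) (use h(2) e(1) in auto)
      then have "Lim (at a) f = h a" by (intro tendsto_Lim) auto
      then have "h z = g z" if "z \<in> ball a e" for z using h(2) that e(2) True by (cases "z = a") (auto simp: g_def)
      then show ?thesis using h(1) by blast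
    next
      case False
      have "f holomorphic_on ball a e"
        by (rule holomorphic_on_subset[OF hol], rule subsetI) (metis ComplI False e(2))
      moreover have "f z = g z" if "z \<in> ball a e" for z using that e(2) False by (cases "z = a") (auto simp: g_def)
      ultimately show ?thesis by blast
    qed
    then obtain h where h: "h holomorphic_on ball a e" "\<And>z. z \<in> ball a e \<Longrightarrow> h z = g z" by blast
    then have "g holomorphic_on ball a e" using holomorphic_transform by blast
    then show ?thesis using e(1) holomorphic_on_imp_differentiable_at[of g "ball a e" a] by auto
  qed
  then have "g holomorphic_on UNIV" by (simp add: holomorphic_on_def field_differentiable_at_within)
  with that show thesis by (auto simp: g_def)
qed

text \<open>
  The maximum principle on large rectangles carries the bound from the grid to the whole plane.
\<close>

lemma entire_bounded_on_grid_constant: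
  assumes hol: "f holomorphic_on UNIV" and bnd: "\<And>z. z \<in> grid \<xi> \<Longrightarrow> R \<le> cmod z \<Longrightarrow> cmod (f z) \<le> C"
  obtains a where "\<And>z. f z = a"
proof -
  have "cmod (f z0) \<le> C" for z0
  proof -
    obtain N :: nat where N: "\<bar>R\<bar> + \<bar>\<xi>\<bar> + cmod z0 + 1 < real N" using reals_Archimedean2 by blast
    define a where "a = Complex (\<xi> - 2 * pi * real N) (- real N)"
    define b where "b = Complex (\<xi> + 2 * pi * real N) (real N)"
    have N2: "real N \<le> 2 * pi * real N" using mult_right_mono[of 1 "2*pi" "real N"] pi_gt3 by simp
    have in_cbox: "z \<in> cbox a b \<longleftrightarrow> \<bar>Re z - \<xi>\<bar> \<le> 2 * pi * real N \<and> \<bar>Im z\<bar> \<le> real N" for z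
      by (auto simp: in_cbox_complex_iff a_def b_def abs_le_iff)
    have in_box: "z \<in> box a b \<longleftrightarrow> \<bar>Re z - \<xi>\<bar> < 2 * pi * real N \<and> \<bar>Im z\<bar> < real N" for z
      by (auto simp: in_box_complex_iff a_def b_def abs_less_iff)
    show ?thesis
    proof (rule maximum_modulus_frontier[of f "cbox a b" C z0])
      show "f holomorphic_on interior (cbox a b)" by (rule holomorphic_on_subset[OF hol]) simp
      show "continuous_on (closure (cbox a b)) f"
        by (rule holomorphic_on_imp_continuous_on[OF holomorphic_on_subset[OF hol]]) simp
      show "bounded (cbox a b)" by (rule bounded_cbox)
      show "z0 \<in> cbox a b"
        unfolding in_cbox using N N2 abs_Re_le_cmod[of z0] abs_Im_le_cmod[of z0] by linarith
      fix z assume "z \<in> frontier (cbox a b)"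
      then have z: "z \<in> cbox a b" "z \<notin> box a b" by (auto simp: frontier_cbox)
      then consider "\<bar>Im z\<bar> = real N" | "\<bar>Re z - \<xi>\<bar> = 2 * pi * real N" unfolding in_cbox in_box by linarith
      then show "cmod (f z) \<le> C"
      proof cases
        case 1
        show ?thesis
        proof (rule bnd)
          show "z \<in> grid \<xi>" unfolding grid_def using 1 N norm_ge_zero[of z0] by (intro CollectI disjI1) linarith
          show "R \<le> cmod z" using 1 N abs_Im_le_cmod[of z] norm_ge_zero[of z0] by linarith
        qed
      next
        case 2
        show ?thesis
        proof (rule bnd)
          have "Re z = \<xi> + 2 * pi * of_int (int N) \<or> Re z = \<xi> + 2 * pi * of_int (- int N)" using 2 by (auto simp: abs_if split: if_splits)
          then show "z \<in> grid \<xi>" unfolding grid_def by blast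
          show "R \<le> cmod z" using 2 N N2 abs_Re_le_cmod[of z] norm_ge_zero[of z0] by linarith
        qed
      qed
    qed
  qed
  then have "bounded (range f)" by (auto simp: bounded_iff)
  from Liouville_theorem[OF hol this] show thesis using that unfolding constant_on_def by auto
qed

subsection \<open>Bounds for the Weyl matrix and the Weyl solution\<close>

lemma common_regular_point:
  fixes U1 U2 :: "complex^'n^'n"
  assumes U1: "U1 \<in> unitaries" and U2: "U2 \<in> unitaries"
  obtains \<xi> :: real where "det (free_mat U1 (of_real \<xi>)) \<noteq> 0" "det (free_mat U2 (of_real \<xi>)) \<noteq> 0"
proof -
  define f where "f z = det (free_mat U1 z) * det (free_mat U2 z)" for z
  have hol: "f holomorphic_on UNIV" unfolding f_def
    by (intro holomorphic_intros holomorphic_det free_mat_holomorphic)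
  obtain z0 where "f z0 = 0" using free_mat_zero_exists[OF U1] unfolding f_def by (metis mult_zero_left)
  moreover have "f \<i> \<noteq> 0" unfolding f_def using det_free_mat_nonreal[OF U1, of \<i>] det_free_mat_nonreal[OF U2, of \<i>] by simp
  ultimately have nc: "\<not> f constant_on UNIV" unfolding constant_on_def by (metis UNIV_I)
  define K where "K = complex_of_real ` {0..1}"
  have "compact K" unfolding K_def by (intro compact_continuous_image continuous_intros compact_Icc)
  from holomorphic_compact_finite_zeros[OF hol open_UNIV connected_UNIV this _ nc]
  have "finite {z\<in>K. f z = 0}" by simp
  moreover have "infinite K"
    unfolding K_def by (subst finite_image_iff) (auto simp: inj_on_def infinite_Icc)
  ultimately have "K - {z\<in>K. f z = 0} \<noteq> {}" by (metis finite.emptyI infinite_super Diff_infinite_finite)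
  then obtain \<xi> where "f (complex_of_real \<xi>) \<noteq> 0" by (auto simp: K_def)
  then show thesis using that by (auto simp: f_def)
qed

lemma one_plus_sg: "mat 1 + sg = cscale 2 P1" "mat 1 - sg = cscale 2 P2"
  by (simp_all add: sg_def P1_diag P2_diag diag_1 diag_add diag_diff cscale_diag add_divide_distrib diff_divide_distrib)

lemma free_solution_P: "free_solution z 1 ** P1 = cscale (exp (\<i> * z)) P1" "free_solution z (-1) ** P2 = cscale (exp (\<i> * z)) P2"
  unfolding free_solution_def P1_diag P2_diag diag_mult_diag cscale_diag
  by (auto simp: vec_eq_iff diag_def sg_fun_def split: sum.splits)

text \<open>
  For the Weyl solution, this is the combination \<open>\<beta>\<close> of its boundary values for which the boundary
  condition has the form \<open>\<alpha> = - U \<beta>\<close>.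
\<close>

definition boundary_trace :: "(real \<Rightarrow> complex^'r^'r) \<Rightarrow> complex^('r::finite + 'r)^('r + 'r) \<Rightarrow> complex \<Rightarrow> complex^('r::finite + 'r)^('r + 'r)" where
  "boundary_trace q U z = P1 ** (fund_solution q z (-1) ** (weyl q U z - sg)) + P2 ** (fund_solution q z 1 ** (weyl q U z + sg))"

context
  fixes q :: "real \<Rightarrow> complex^'r::finite^'r" and U :: "complex^('r+'r)^('r+'r)" and \<xi> :: real
  assumes q: "q absolutely_integrable_on {-1..1}" and U: "U \<in> unitaries"
    and \<xi>: "det (free_mat U (of_real \<xi>)) \<noteq> 0"
begin

lemma weyl_bounded_on_grid:
  obtains C R where "C \<ge> 0" "R > 0"
    "\<And>z. z \<in> grid \<xi> \<Longrightarrow> R \<le> cmod z \<Longrightarrow> det (char_mat q U z) \<noteq> 0"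
    "\<And>z. z \<in> grid \<xi> \<Longrightarrow> R \<le> cmod z \<Longrightarrow> norm (weyl q U z) \<le> C"
    "\<And>z. z \<in> grid \<xi> \<Longrightarrow> R \<le> cmod z \<Longrightarrow> norm (matrix_inv (char_mat q U z)) \<le> C * exp (- \<bar>Im z\<bar>)"
proof -
  obtain c R where c: "c > 0" "R > 0"
    "\<And>z v. z \<in> grid \<xi> \<Longrightarrow> R \<le> cmod z \<Longrightarrow> c * exp \<bar>Im z\<bar> * norm v \<le> norm (char_mat q U z *v v)"
    using char_mat_lower[OF q U \<xi>] by metis
  define L where "L = norm (mat 1 :: complex^('r+'r)^('r+'r)) * exp (potential_mass q)"
  define C1 where "C1 = (norm (B_bc U) + norm (A_bc U)) * L"
  define n where "n = norm (mat 1 :: complex^('r+'r)^('r+'r))"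
  define C where "C = max (C1 / c) (n / c)"
  have nz: "det (char_mat q U z) \<noteq> 0" if "z \<in> grid \<xi>" "R \<le> cmod z" for z
    unfolding det_nonzero_iff_ker
  proof (intro allI impI)
    fix v assume "char_mat q U z *v v = 0"
    then have "c * exp \<bar>Im z\<bar> * norm v \<le> 0" using c(3)[OF that, of v] by simp
    then show "v = 0" using c(1) by (simp add: mult_le_0_iff)
  qed
  show thesis
  proof (rule that[of C R])
    show "C \<ge> 0" using c(1) by (simp add: C_def n_def le_max_iff_disj)
    show "R > 0" by (rule c(2))
    show "det (char_mat q U z) \<noteq> 0" if "z \<in> grid \<xi>" "R \<le> cmod z" for z by (rule nz[OF that])
    fix z assume z: "z \<in> grid \<xi>" "R \<le> cmod z"
    have low: "c * exp \<bar>Im z\<bar> * norm X \<le> norm (char_mat q U z ** X)" for X :: "complex^('r+'r)^('r+'r)"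
      using c(1) by (intro matrix_bounded_below c(3) z) simp
    have Y: "norm (fund_solution q z 1) \<le> L * exp \<bar>Im z\<bar>" "norm (fund_solution q z (-1)) \<le> L * exp \<bar>Im z\<bar>"
      using fund_solution_growth[OF q, of 1 z] fund_solution_growth[OF q, of "-1" z] by (simp_all add: L_def)
    have "norm (numer_mat q U z) \<le> norm (B_bc U) * (L * exp \<bar>Im z\<bar>) + norm (A_bc U) * (L * exp \<bar>Im z\<bar>)"
      unfolding numer_mat_def norm_mult_sg
      by (intro order_trans[OF norm_triangle_ineq4] add_mono order_trans[OF norm_matrix_mult_le] mult_left_mono Y norm_ge_zero)
    also have "\<dots> = C1 * exp \<bar>Im z\<bar>" by (simp add: C1_def algebra_simps)
    finally have "c * exp \<bar>Im z\<bar> * norm (weyl q U z) \<le> C1 * exp \<bar>Im z\<bar>"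
      using low[of "weyl q U z"] unfolding char_mat_weyl[OF nz[OF z]] norm_minus_cancel by (rule order_trans[rotated])
    then have "norm (weyl q U z) \<le> C1 / c" using c(1) by (simp add: field_simps)
    then show "norm (weyl q U z) \<le> C" by (simp add: C_def)
    have "c * exp \<bar>Im z\<bar> * norm (matrix_inv (char_mat q U z)) \<le> n"
      using low[of "matrix_inv (char_mat q U z)"] by (simp add: matrix_inv_right[OF nz[OF z]] n_def)
    then have "norm (matrix_inv (char_mat q U z)) \<le> n / c * exp (- \<bar>Im z\<bar>)"
      using c(1) by (simp add: field_simps exp_minus)
    also have "\<dots> \<le> C * exp (- \<bar>Im z\<bar>)" by (intro mult_right_mono) (auto simp: C_def)
    finally show "norm (matrix_inv (char_mat q U z)) \<le> C * exp (- \<bar>Im z\<bar>)" .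
  qed
qed

text \<open>
  One computes \<open>\<Delta> (m - 1) = - 2 (B\<^sub>U Y(1) P\<^sub>1 + A\<^sub>U Y(-1) P\<^sub>2)\<close>. In the upper half-plane these products select the
  columns in which the free solution decays, so the right-hand side is small compared with
  \<open>e\<^bsup>Im z\<^esup>\<close>, which is the size of \<open>\<Delta>\<close>.
\<close>

lemma weyl_limit: "((\<lambda>t. weyl q U (\<i> * of_real t)) \<longlongrightarrow> mat 1) at_top"
proof -
  obtain c R where c: "c > 0" "R > 0"
    "\<And>z v. z \<in> grid \<xi> \<Longrightarrow> R \<le> cmod z \<Longrightarrow> c * exp \<bar>Im z\<bar> * norm v \<le> norm (char_mat q U z *v v)"
    using char_mat_lower[OF q U \<xi>] by metis
  define b where "b = norm (A_bc U) * norm (P2 :: complex^('r+'r)^('r+'r)) + norm (B_bc U) * norm (P1 :: complex^('r+'r)^('r+'r)) + 1"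
  have b: "b > 0" by (simp add: b_def add_nonneg_pos)
  show ?thesis
  proof (rule tendstoI)
    fix e :: real assume e: "e > 0"
    define e' where "e' = e * c / (8 * b)"
    have e': "e' > 0" using e b c by (simp add: e'_def)
    obtain R1 where R1: "\<And>z. cmod z \<ge> R1 \<Longrightarrow> norm (fund_solution q z 1 - free_solution z 1) \<le> e' * exp (\<bar>Im z\<bar> * \<bar>1\<bar>)"
      using fund_solution_asymptotics[OF q _ e', of 1] by auto
    obtain R2 where R2: "\<And>z. cmod z \<ge> R2 \<Longrightarrow> norm (fund_solution q z (-1) - free_solution z (-1)) \<le> e' * exp (\<bar>Im z\<bar> * \<bar>-1\<bar>)"
      using fund_solution_asymptotics[OF q _ e', of "-1"] by auto
    have "eventually (\<lambda>t::real. max (max R1 R2) (max 1 (max R (1/e'))) \<le> t) at_top" by (rule eventually_ge_at_top)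
    then show "eventually (\<lambda>t. dist (weyl q U (\<i> * of_real t)) (mat 1) < e) at_top"
    proof eventually_elim
      case (elim t)
      define z where "z = \<i> * complex_of_real t"
      have t: "t \<ge> 1" "t \<ge> R1" "t \<ge> R2" "t \<ge> R" "t \<ge> 1/e'" using elim by auto
      have z: "cmod z = t" "Im z = t" using t by (auto simp: z_def norm_mult)
      have zg: "z \<in> grid \<xi>" "R \<le> cmod z" using t z by (auto simp: grid_def)
      have nz: "det (char_mat q U z) \<noteq> 0" by (rule notI, drule det_char_mat_real[OF q U]) (use z t in simp)
      have small: "exp (- t) \<le> e' * exp t"
      proof -
        have "1/e' \<le> t" by (rule t)
        also have "t \<le> exp (2 * t)" using exp_ge_add_one_self[of "2*t"] t by linarith
        finally have "1 \<le> e' * exp (2 * t)" using e' by (simp add: field_simps)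
        then have "exp (-t) * 1 \<le> exp (-t) * (e' * exp (2 * t))" by (intro mult_left_mono) auto
        also have "\<dots> = e' * exp t" by (simp flip: exp_add)
        finally show ?thesis by simp
      qed
      have Y1: "norm (fund_solution q z 1 ** P1) \<le> 2 * e' * exp t * norm (P1 :: complex^('r+'r)^('r+'r))"
      proof -
        have "fund_solution q z 1 ** P1 = (fund_solution q z 1 - free_solution z 1) ** P1 + cscale (exp (\<i> * z)) P1"
          by (simp add: mm.diff_left free_solution_P)
        also have "norm \<dots> \<le> e' * exp t * norm (P1 :: complex^('r+'r)^('r+'r)) + exp (- t) * norm (P1 :: complex^('r+'r)^('r+'r))"
          using R1[of z] z t by (intro norm_triangle_mono order_trans[OF norm_matrix_mult_le] mult_right_mono) (auto simp: norm_cscale)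
        also have "\<dots> \<le> e' * exp t * norm (P1 :: complex^('r+'r)^('r+'r)) + e' * exp t * norm (P1 :: complex^('r+'r)^('r+'r))"
          using small by (intro add_left_mono mult_right_mono) auto
        finally show ?thesis by (simp add: mult_ac)
      qed
      have Y2: "norm (fund_solution q z (-1) ** P2) \<le> 2 * e' * exp t * norm (P2 :: complex^('r+'r)^('r+'r))"
      proof -
        have "fund_solution q z (-1) ** P2 = (fund_solution q z (-1) - free_solution z (-1)) ** P2 + cscale (exp (\<i> * z)) P2"
          by (simp add: mm.diff_left free_solution_P)
        also have "norm \<dots> \<le> e' * exp t * norm (P2 :: complex^('r+'r)^('r+'r)) + exp (- t) * norm (P2 :: complex^('r+'r)^('r+'r))"
          using R2[of z] z t by (intro norm_triangle_mono order_trans[OF norm_matrix_mult_le] mult_right_mono) (auto simp: norm_cscale)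
        also have "\<dots> \<le> e' * exp t * norm (P2 :: complex^('r+'r)^('r+'r)) + e' * exp t * norm (P2 :: complex^('r+'r)^('r+'r))"
          using small by (intro add_left_mono mult_right_mono) auto
        finally show ?thesis by (simp add: mult_ac)
      qed
      have "char_mat q U z ** (weyl q U z - mat 1) = - (numer_mat q U z + char_mat q U z)"
        by (simp add: mm.diff_right char_mat_weyl[OF nz])
      also have "numer_mat q U z + char_mat q U z = B_bc U ** (fund_solution q z 1 ** (mat 1 + sg)) + A_bc U ** (fund_solution q z (-1) ** (mat 1 - sg))"
        by (simp add: numer_mat_def char_mat_def mm.add_left mm.add_right mm.diff_left mm.diff_right matrix_mul_assoc)
      also have "\<dots> = cscale 2 (B_bc U ** (fund_solution q z 1 ** P1) + A_bc U ** (fund_solution q z (-1) ** P2))"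
        unfolding one_plus_sg by (simp add: cscale_mult_right cscale_add)
      finally have "norm (char_mat q U z ** (weyl q U z - mat 1)) = 2 * norm (B_bc U ** (fund_solution q z 1 ** P1) + A_bc U ** (fund_solution q z (-1) ** P2))"
        by (simp add: norm_cscale)
      also have "norm (B_bc U ** (fund_solution q z 1 ** P1) + A_bc U ** (fund_solution q z (-1) ** P2))
         \<le> norm (B_bc U) * (2 * e' * exp t * norm (P1 :: complex^('r+'r)^('r+'r))) + norm (A_bc U) * (2 * e' * exp t * norm (P2 :: complex^('r+'r)^('r+'r)))"
        by (intro norm_triangle_mono order_trans[OF norm_matrix_mult_le] mult_left_mono Y1 Y2 norm_ge_zero)
      also have "\<dots> = (b - 1) * (2 * e' * exp t)" by (simp add: b_def algebra_simps)
      also have "\<dots> < b * (2 * e' * exp t)" using e' by (intro mult_strict_right_mono) auto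
      finally have "norm (char_mat q U z ** (weyl q U z - mat 1)) < 4 * b * e' * exp t" by simp
      moreover have "c * exp \<bar>Im z\<bar> * norm (weyl q U z - mat 1) \<le> norm (char_mat q U z ** (weyl q U z - mat 1))"
        using c(1) by (intro matrix_bounded_below c(3) zg) simp
      moreover have "4 * b * e' * exp t = c * exp t * (e / 2)" using b by (simp add: e'_def)
      ultimately have "c * exp t * norm (weyl q U z - mat 1) < c * exp t * (e/2)" using z t by simp
      then have "norm (weyl q U z - mat 1) < e / 2" using c(1) by simp
      then show ?case using e by (simp add: dist_norm z_def)
    qed
  qed
qed

text \<open>
  The last identity is the constancy of the Wronskian of \<open>Y(x, cnj z)\<close> and the Weyl solution, whose jump
  at \<open>0\<close> is \<open>2 \<sigma>\<close>. It bounds \<open>\<beta>\<close> by the inverse of \<open>\<Delta>(cnj z)\<close>, and it shows that \<open>\<beta>\<close> is invertible.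
\<close>

lemma boundary_trace:
  assumes nz: "det (char_mat q U z) \<noteq> 0" "det (char_mat q U (cnj z)) \<noteq> 0"
  shows "P1 ** (fund_solution q z 1 ** (weyl q U z + sg)) + P2 ** (fund_solution q z (-1) ** (weyl q U z - sg)) = - (U ** boundary_trace q U z)"
    "fund_solution q z 1 ** (weyl q U z + sg) = P2 ** boundary_trace q U z - P1 ** (U ** boundary_trace q U z)"
    "fund_solution q z (-1) ** (weyl q U z - sg) = P1 ** boundary_trace q U z - P2 ** (U ** boundary_trace q U z)"
    "adj (char_mat q U (cnj z)) ** (U ** boundary_trace q U z) = cscale (- 2) (mat 1)"
proof -
  define X where "X = fund_solution q z 1 ** (weyl q U z + sg)"
  define Z where "Z = fund_solution q z (-1) ** (weyl q U z - sg)"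
  have k: "boundary_trace q U z = P1 ** Z + P2 ** X" by (simp add: boundary_trace_def X_def Z_def)
  have PP: "P1 ** P1 = P1" "P2 ** P2 = P2" "P1 ** P2 = 0" "P2 ** P1 = 0"
    unfolding P1_diag P2_diag diag_mult_diag by (auto simp: vec_eq_iff diag_def sg_fun_def split: sum.splits)
  have PPV: "P1 ** (P1 ** V) = P1 ** V" "P2 ** (P2 ** V) = P2 ** V" "P1 ** (P2 ** V) = 0" "P2 ** (P1 ** V) = 0"
    for V :: "complex^('r+'r)^('r+'r)" by (simp_all add: matrix_mul_assoc PP)
  have P12: "P1 ** V + P2 ** V = V" for V :: "complex^('r+'r)^('r+'r)" by (simp add: P1_P2 flip: mm.add_left)
  have "(P1 ** X + P2 ** Z) + U ** boundary_trace q U z = 0"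
    using weyl_boundary[OF nz(1)] unfolding X_def[symmetric] Z_def[symmetric]
    by (simp add: k A_bc_def B_bc_def mm.add_left mm.add_right add_ac flip: matrix_mul_assoc)
  then have al: "P1 ** X + P2 ** Z = - (U ** boundary_trace q U z)" by (simp add: eq_neg_iff_add_eq_0)
  then show "P1 ** (fund_solution q z 1 ** (weyl q U z + sg)) + P2 ** (fund_solution q z (-1) ** (weyl q U z - sg)) = - (U ** boundary_trace q U z)"
    by (simp add: X_def Z_def)
  have a1: "P1 ** (P1 ** X + P2 ** Z) = P1 ** X" "P2 ** (P1 ** X + P2 ** Z) = P2 ** Z"
    by (simp_all add: mm.add_right PPV)
  have pieces: "P1 ** X = - (P1 ** (U ** boundary_trace q U z))" "P2 ** Z = - (P2 ** (U ** boundary_trace q U z))" "P2 ** X = P2 ** boundary_trace q U z" "P1 ** Z = P1 ** boundary_trace q U z"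
    using a1 unfolding al mm.minus_right by (simp_all add: k mm.add_right PPV)
  have Xk: "X = P2 ** boundary_trace q U z - P1 ** (U ** boundary_trace q U z)" using P12[of X] pieces by simp
  have Zk: "Z = P1 ** boundary_trace q U z - P2 ** (U ** boundary_trace q U z)" using P12[of Z] pieces by simp
  show "fund_solution q z 1 ** (weyl q U z + sg) = P2 ** boundary_trace q U z - P1 ** (U ** boundary_trace q U z)" using Xk by (simp add: X_def)
  show "fund_solution q z (-1) ** (weyl q U z - sg) = P1 ** boundary_trace q U z - P2 ** (U ** boundary_trace q U z)" using Zk by (simp add: Z_def)
  have sgP: "sg ** P1 = P1" "sg ** P2 = - P2"
    unfolding sg_def P1_diag P2_diag diag_mult_diag diag_minus by (auto simp: vec_eq_iff diag_def sg_fun_def split: sum.splits)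
  have sgPV: "sg ** (P1 ** V) = P1 ** V" "sg ** (P2 ** V) = - (P2 ** V)" for V :: "complex^('r+'r)^('r+'r)"
    by (simp_all add: matrix_mul_assoc sgP mm.minus_left)
  have e: "adj (fund_solution q (cnj z) x) ** (sg ** (fund_solution q z x ** V)) = sg ** V" if "x \<in> {-1..1}" for x V
    using fund_solution_symplectic[OF q that, of z] by (metis matrix_mul_assoc)
  define Y1 where "Y1 = fund_solution q (cnj z) 1"
  define Y2 where "Y2 = fund_solution q (cnj z) (-1)"
  have "adj Y1 ** (sg ** X) - adj Y2 ** (sg ** Z) = sg ** (weyl q U z + sg) - sg ** (weyl q U z - sg)"
    unfolding X_def Z_def Y1_def Y2_def by (simp add: e)
  also have "\<dots> = cscale 2 (mat 1)" by (simp add: mm.add_right mm.diff_right sg_sg) (simp add: vec_eq_iff)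
  finally have 1: "adj Y1 ** (sg ** X) - adj Y2 ** (sg ** Z) = cscale 2 (mat 1)" .
  have "adj Y1 ** (sg ** X) - adj Y2 ** (sg ** Z)
    = - ((adj Y1 ** P1 + adj Y2 ** P2) ** (U ** boundary_trace q U z) + (adj Y1 ** P2 + adj Y2 ** P1) ** boundary_trace q U z)"
    unfolding Xk Zk by (simp add: mm.diff_right sgPV mm.add_left mm.add_right mm.minus_right flip: matrix_mul_assoc)
  moreover have "adj (char_mat q U (cnj z)) ** (U ** boundary_trace q U z)
    = (adj Y1 ** P1 + adj Y2 ** P2) ** (U ** boundary_trace q U z) + (adj Y1 ** P2 + adj Y2 ** P1) ** boundary_trace q U z"
  proof -
    have aP: "adj P1 = P1" "adj P2 = P2" unfolding P1_diag P2_diag adj_diag by simp_all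
    have UU: "adj U ** (U ** V) = V" for V :: "complex^('r+'r)^('r+'r)"
      using U by (simp add: matrix_mul_assoc unitaries_def)
    show ?thesis
      by (simp add: char_mat_def A_bc_def B_bc_def adj_add adj_mult aP mm.add_left mm.add_right UU Y1_def Y2_def flip: matrix_mul_assoc)
  qed
  ultimately have "adj (char_mat q U (cnj z)) ** (U ** boundary_trace q U z) = - cscale 2 (mat 1)" using 1 by (metis minus_minus)
  then show "adj (char_mat q U (cnj z)) ** (U ** boundary_trace q U z) = cscale (- 2) (mat 1)" by (simp add: cscale_minus_left)
qed

text \<open>
  At the end points the Weyl solution is of size \<open>e\<^bsup>-|Im z|\<^esup>\<close> by the previous lemma. From there to \<open>x\<close>
  it gains at most the factor \<open>e\<^bsup>|Im z| (1 - |x|)\<^esup>\<close>, up to a constant.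
\<close>

lemma weyl_solution_decay:
  obtains C R where "C \<ge> 0" "R > 0"
    "\<And>z x. z \<in> grid \<xi> \<Longrightarrow> R \<le> cmod z \<Longrightarrow> x \<in> {0..1} \<Longrightarrow> norm (fund_solution q z x ** (weyl q U z + sg)) \<le> C * exp (- (\<bar>Im z\<bar> * \<bar>x\<bar>))"
    "\<And>z x. z \<in> grid \<xi> \<Longrightarrow> R \<le> cmod z \<Longrightarrow> x \<in> {-1..0} \<Longrightarrow> norm (fund_solution q z x ** (weyl q U z - sg)) \<le> C * exp (- (\<bar>Im z\<bar> * \<bar>x\<bar>))"
proof -
  obtain C R where C: "C \<ge> 0" "R > 0"
    "\<And>z. z \<in> grid \<xi> \<Longrightarrow> R \<le> cmod z \<Longrightarrow> det (char_mat q U z) \<noteq> 0"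
    "\<And>z. z \<in> grid \<xi> \<Longrightarrow> R \<le> cmod z \<Longrightarrow> norm (weyl q U z) \<le> C"
    "\<And>z. z \<in> grid \<xi> \<Longrightarrow> R \<le> cmod z \<Longrightarrow> norm (matrix_inv (char_mat q U z)) \<le> C * exp (- \<bar>Im z\<bar>)"
    using weyl_bounded_on_grid by metis
  define b1 where "b1 = norm (P1 :: complex^('r+'r)^('r+'r))"
  define b2 where "b2 = norm (P2 :: complex^('r+'r)^('r+'r))"
  define u where "u = norm U"
  define ck where "ck = u * (2 * C)"
  define C2 where "C2 = (b1 + b2) * (1 + u) * ck"
  have ck0: "ck \<ge> 0" using C(1) by (simp add: ck_def u_def)
  have b0: "b1 \<ge> 0" "b2 \<ge> 0" "u \<ge> 0" by (simp_all add: b1_def b2_def u_def)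
  have ends: "norm (fund_solution q z 1 ** (weyl q U z + sg)) \<le> C2 * exp (- \<bar>Im z\<bar>)" "norm (fund_solution q z (-1) ** (weyl q U z - sg)) \<le> C2 * exp (- \<bar>Im z\<bar>)"
    if z: "z \<in> grid \<xi>" "R \<le> cmod z" for z
  proof -
    have z': "cnj z \<in> grid \<xi>" "R \<le> cmod (cnj z)" using grid_cnj z by auto
    note kp = boundary_trace[OF C(3)[OF z] C(3)[OF z']]
    define D where "D = char_mat q U (cnj z)"
    have Di: "adj (matrix_inv D) ** adj D = mat 1"
      using matrix_inv_right(1)[OF C(3)[OF z']] by (simp add: D_def flip: adj_mult)
    have "adj (matrix_inv D) ** (adj D ** (U ** boundary_trace q U z)) = adj (matrix_inv D) ** cscale (-2) (mat 1)"
      using kp(4) by (simp add: D_def)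
    then have "U ** boundary_trace q U z = cscale (-2) (adj (matrix_inv D))"
      by (simp add: matrix_mul_assoc Di cscale_mult_right)
    then have "adj U ** (U ** boundary_trace q U z) = adj U ** cscale (-2) (adj (matrix_inv D))" by simp
    then have "boundary_trace q U z = adj U ** cscale (-2) (adj (matrix_inv D))" using U by (simp add: matrix_mul_assoc unitaries_def)
    then have "norm (boundary_trace q U z) \<le> norm (adj U) * norm (cscale (-2) (adj (matrix_inv D)))" using norm_matrix_mult_le by metis
    also have "\<dots> = u * (2 * norm (matrix_inv D))" by (simp add: norm_cscale u_def)
    also have "\<dots> \<le> u * (2 * (C * exp (- \<bar>Im z\<bar>)))"
      using C(5)[OF z'] b0 by (intro mult_left_mono) (auto simp: D_def)
    finally have nk: "norm (boundary_trace q U z) \<le> ck * exp (- \<bar>Im z\<bar>)" by (simp add: ck_def mult_ac)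
    have nUk: "norm (U ** boundary_trace q U z) \<le> u * (ck * exp (- \<bar>Im z\<bar>))"
      unfolding u_def by (intro order_trans[OF norm_matrix_mult_le] mult_left_mono nk norm_ge_zero)
    have 1: "norm (P ** boundary_trace q U z - P' ** (U ** boundary_trace q U z)) \<le> norm P * (ck * exp (- \<bar>Im z\<bar>)) + norm P' * (u * (ck * exp (- \<bar>Im z\<bar>)))"
      for P P' :: "complex^('r+'r)^('r+'r)"
      by (intro order_trans[OF norm_triangle_ineq4] add_mono order_trans[OF norm_matrix_mult_le] mult_left_mono nk nUk norm_ge_zero)
    have 2: "p * (ck * E) + p' * (u * (ck * E)) \<le> (p + p') * (1 + u) * ck * E" if "p \<ge> 0" "p' \<ge> 0" "E \<ge> 0" for p p' E
    proof -
      have "(p + p') * (1 + u) * ck * E - (p * (ck * E) + p' * (u * (ck * E))) = (p' + p * u) * (ck * E)"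
        by (simp add: algebra_simps)
      also have "\<dots> \<ge> 0" using that ck0 b0 by simp
      finally show ?thesis by simp
    qed
    show "norm (fund_solution q z 1 ** (weyl q U z + sg)) \<le> C2 * exp (- \<bar>Im z\<bar>)"
      unfolding kp(2) using 1[of P2 P1] 2[of b2 b1 "exp (- \<bar>Im z\<bar>)"] b0 by (simp add: C2_def b1_def b2_def add.commute)
    show "norm (fund_solution q z (-1) ** (weyl q U z - sg)) \<le> C2 * exp (- \<bar>Im z\<bar>)"
      unfolding kp(3) using 1[of P1 P2] 2[of b1 b2 "exp (- \<bar>Im z\<bar>)"] b0 by (simp add: C2_def b1_def b2_def)
  qed
  have grow: "norm (fund_solution q z x ** V) \<le> C2 * exp (potential_mass q) * exp (- (\<bar>Im z\<bar> * \<bar>x\<bar>))"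
    if "norm (fund_solution q z s ** V) \<le> C2 * exp (- \<bar>Im z\<bar>)" "s = 1 \<and> x \<in> {0..1} \<or> s = -1 \<and> x \<in> {-1..0}" for z s x and V :: "complex^('r+'r)^('r+'r)"
  proof -
    have ac: "ac_deriv (\<lambda>x. fund_solution q z x ** V) (\<lambda>x. dirac_coeff q z x ** (fund_solution q z x ** V))"
      using ac_deriv_linear[OF mm.bounded_linear_left fund_solution_ac_deriv(1)[OF q, of z], of V] by (simp add: matrix_mul_assoc)
    have "norm (fund_solution q z x ** V) \<le> exp (\<bar>Im z\<bar> * \<bar>x - s\<bar> + potential_mass q) * norm (fund_solution q z s ** V)"
      by (rule dirac_growth[OF q ac]) (use that(2) in auto)
    also have "\<dots> \<le> exp (\<bar>Im z\<bar> * \<bar>x - s\<bar> + potential_mass q) * (C2 * exp (- \<bar>Im z\<bar>))" by (rule mult_left_mono[OF that(1)]) simp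
    also have "\<bar>x - s\<bar> = 1 - \<bar>x\<bar>" using that(2) by auto
    also have "exp (\<bar>Im z\<bar> * (1 - \<bar>x\<bar>) + potential_mass q) * (C2 * exp (- \<bar>Im z\<bar>)) = C2 * exp (potential_mass q) * exp (- (\<bar>Im z\<bar> * \<bar>x\<bar>))"
      by (simp add: right_diff_distrib exp_add exp_diff exp_minus field_simps)
    finally show ?thesis .
  qed
  show thesis
  proof (rule that[of "C2 * exp (potential_mass q)" R])
    show "C2 * exp (potential_mass q) \<ge> 0" using b0 ck0 by (simp add: C2_def)
    show "R > 0" by (rule C(2))
    show "norm (fund_solution q z x ** (weyl q U z + sg)) \<le> C2 * exp (potential_mass q) * exp (- (\<bar>Im z\<bar> * \<bar>x\<bar>))"
      if "z \<in> grid \<xi>" "R \<le> cmod z" "x \<in> {0..1}" for z x by (rule grow[OF ends(1)]) (use that in auto)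
    show "norm (fund_solution q z x ** (weyl q U z - sg)) \<le> C2 * exp (potential_mass q) * exp (- (\<bar>Im z\<bar> * \<bar>x\<bar>))"
      if "z \<in> grid \<xi>" "R \<le> cmod z" "x \<in> {-1..0}" for z x by (rule grow[OF ends(2)]) (use that in auto)
  qed
qed

end

lemma fund_solution_inverse_holomorphic:
  fixes q :: "real \<Rightarrow> complex^'r::finite^'r"
  assumes q: "q absolutely_integrable_on {-1..1}" and x: "x \<in> {-1..1}"
  shows "(\<lambda>z. (sg ** adj (fund_solution q (cnj z) x) ** sg) $ i $ j) holomorphic_on UNIV"
proof (rule holomorphic_solve[where F="\<lambda>z. fund_solution q z x" and G="\<lambda>_. mat 1"])
  show "(\<lambda>z. fund_solution q z x $ i $ j) holomorphic_on UNIV" for i j by (rule fund_solution_holomorphic[OF q x])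
  show "(\<lambda>z. mat 1 $ i $ j) holomorphic_on UNIV" for i j by (rule holomorphic_on_const)
  show "det (fund_solution q z x) \<noteq> 0" for z
    using fund_solution_inverse[OF q x, of z] invertible_det_nz[of "fund_solution q z x"] by (auto simp: invertible_def)
  show "fund_solution q z x ** (sg ** adj (fund_solution q (cnj z) x) ** sg) = mat 1" for z by (rule fund_solution_inverse(2)[OF q x])
qed

lemma spectral_data_determine:
  fixes q1 q2 :: "real \<Rightarrow> complex^'r::finite^'r"
  assumes q1: "q1 absolutely_integrable_on {-1..1}" and q2: "q2 absolutely_integrable_on {-1..1}"
    and U1: "U1 \<in> unitaries" and U2: "U2 \<in> unitaries"
    and sd: "spectral_data_fun q1 U1 = spectral_data_fun q2 U2"
  shows "AE x in leb_I. q1 x = q2 x" "U1 = U2"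
proof -
  have ev: "eigenvalue_seq q1 U1 = eigenvalue_seq q2 U2"
    using sd by (auto simp: spectral_data_fun_def fun_eq_iff)
  define A where "A = {z. det (char_mat q1 U1 z) = 0}"
  have A2: "A = {z. det (char_mat q2 U2 z) = 0}"
    using eigenvalue_seq[OF q1 U1] eigenvalue_seq[OF q2 U2] ev by (simp add: A_def)
  have nm: "norming_mat q1 U1 l = norming_mat q2 U2 l" and lreal: "cnj l = l" if "l \<in> A" for l
  proof -
    have "l \<in> range (\<lambda>j. complex_of_real (eigenvalue_seq q1 U1 j))"
      unfolding eigenvalue_seq[OF q1 U1] using that by (simp add: A_def)
    then obtain j where j: "l = of_real (eigenvalue_seq q1 U1 j)" by blast
    then show "cnj l = l" by simp
    have "spectral_data_fun q1 U1 j = spectral_data_fun q2 U2 j" using sd by simp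
    then show "norming_mat q1 U1 l = norming_mat q2 U2 l" using j ev by (simp add: spectral_data_fun_def)
  qed
  have nzA: "det (char_mat q1 U1 z) \<noteq> 0" "det (char_mat q2 U2 z) \<noteq> 0" if "z \<notin> A" for z
    using that A2 by (auto simp: A_def)
  have evA: "eventually (\<lambda>z. z \<notin> A) (at a)" for a
    using eventually_det_char_mat_nz[OF q1 U1, of a] by (simp add: A_def)
  have Areal: "Im z = 0" if "z \<in> A" for z using det_char_mat_real[OF q1 U1] that by (simp add: A_def)
  obtain \<xi> where \<xi>: "det (free_mat U1 (of_real \<xi>)) \<noteq> 0" "det (free_mat U2 (of_real \<xi>)) \<noteq> 0"
    using common_regular_point[OF U1 U2] by metis
  define m1 where "m1 = weyl q1 U1"
  define m2 where "m2 = weyl q2 U2"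
  \<comment> \<open>the singularities of \<open>m1 - m2\<close> are removable, as the residues of the two Weyl matrices agree\<close>
  obtain C1 R1 where C1: "C1 \<ge> 0" "R1 > 0"
    "\<And>z. z \<in> grid \<xi> \<Longrightarrow> R1 \<le> cmod z \<Longrightarrow> det (char_mat q1 U1 z) \<noteq> 0"
    "\<And>z. z \<in> grid \<xi> \<Longrightarrow> R1 \<le> cmod z \<Longrightarrow> norm (m1 z) \<le> C1"
    using weyl_bounded_on_grid[OF q1 U1 \<xi>(1)] unfolding m1_def by metis
  obtain C2 R2 where C2: "C2 \<ge> 0" "R2 > 0"
    "\<And>z. z \<in> grid \<xi> \<Longrightarrow> R2 \<le> cmod z \<Longrightarrow> norm (m2 z) \<le> C2"
    using weyl_bounded_on_grid[OF q2 U2 \<xi>(2)] unfolding m2_def by metis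
  have meq: "m1 z = m2 z" if z: "z \<notin> A" for z
  proof -
    have "m1 z $ i $ j = m2 z $ i $ j" for i j
    proof -
      define D where "D z = m1 z $ i $ j - m2 z $ i $ j" for z
      have holD: "D holomorphic_on - A"
        unfolding D_def[abs_def] m1_def m2_def
        by (intro holomorphic_intros weyl_holomorphic[OF q1] weyl_holomorphic[OF q2]) (use nzA in auto)
      have limD: "((\<lambda>z. (z - l) * D z) \<longlongrightarrow> 0) (at l)" if l: "l \<in> A" for l
      proof -
        have 1: "((\<lambda>z. cscale (z - l) (m1 z)) \<longlongrightarrow> cscale \<i> (norming_mat q1 U1 l)) (at l)"
          unfolding m1_def by (rule weyl_residue[OF q1 U1 lreal[OF l] eventually_det_char_mat_nz[OF q1 U1]])
        have 2: "((\<lambda>z. cscale (z - l) (m2 z)) \<longlongrightarrow> cscale \<i> (norming_mat q1 U1 l)) (at l)"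
          unfolding m2_def nm[OF l] by (rule weyl_residue[OF q2 U2 lreal[OF l] eventually_det_char_mat_nz[OF q2 U2]])
        have "((\<lambda>z. (cscale (z - l) (m1 z) - cscale (z - l) (m2 z)) $ i $ j)
            \<longlongrightarrow> (cscale \<i> (norming_mat q1 U1 l) - cscale \<i> (norming_mat q1 U1 l)) $ i $ j) (at l)"
          by (intro tendsto_vec_nth tendsto_diff 1 2)
        then show ?thesis by (simp add: D_def right_diff_distrib)
      qed
      obtain g where g: "g holomorphic_on UNIV" "\<And>z. z \<notin> A \<Longrightarrow> g z = D z"
        using entire_extension[OF holD evA limD] by metis
      have "cmod (g z) \<le> C1 + C2" if z: "z \<in> grid \<xi>" "max R1 R2 \<le> cmod z" for z
      proof -
        have "z \<notin> A" using C1(3)[OF z(1)] z(2) by (simp add: A_def)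
        then have "cmod (g z) = cmod ((m1 z - m2 z) $ i $ j)" using g(2) by (simp add: D_def)
        also have "\<dots> \<le> norm (m1 z - m2 z)" by (meson Finite_Cartesian_Product.norm_nth_le order_trans)
        also have "\<dots> \<le> norm (m1 z) + norm (m2 z)" by (rule norm_triangle_ineq4)
        also have "\<dots> \<le> C1 + C2" using C1(4)[OF z(1)] C2(3)[OF z(1)] z(2) by (intro add_mono) auto
        finally show ?thesis .
      qed
      then obtain a where a: "\<And>z. g z = a" using entire_bounded_on_grid_constant[OF g(1)] by metis
      have "((\<lambda>t. (m1 (\<i> * of_real t) - m2 (\<i> * of_real t)) $ i $ j) \<longlongrightarrow> (mat 1 - mat 1) $ i $ j) at_top"
        unfolding m1_def m2_def
        by (intro tendsto_vec_nth tendsto_diff weyl_limit[OF q1 U1 \<xi>(1)] weyl_limit[OF q2 U2 \<xi>(2)])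
      moreover have "eventually (\<lambda>t. (m1 (\<i> * of_real t) - m2 (\<i> * of_real t)) $ i $ j = a) at_top"
        using eventually_gt_at_top[of "0::real"]
      proof eventually_elim
        case (elim t)
        then have "\<i> * of_real t \<notin> A" using Areal[of "\<i> * of_real t"] by auto
        then show ?case using g(2) a by (simp add: D_def)
      qed
      ultimately have "((\<lambda>t::real. a) \<longlongrightarrow> 0) at_top"
        by (subst (asm) tendsto_cong) simp_all
      then have "a = 0" by (simp add: tendsto_const_iff)
      then show ?thesis using g(2)[OF z] a by (simp add: D_def)
    qed
    then show ?thesis by (simp add: vec_eq_iff)
  qed
  obtain D1 S1 where D1: "D1 \<ge> 0" "S1 > 0"
    "\<And>z x. z \<in> grid \<xi> \<Longrightarrow> S1 \<le> cmod z \<Longrightarrow> x \<in> {0..1} \<Longrightarrow> norm (fund_solution q1 z x ** (m1 z + sg)) \<le> D1 * exp (- (\<bar>Im z\<bar> * \<bar>x\<bar>))"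
    "\<And>z x. z \<in> grid \<xi> \<Longrightarrow> S1 \<le> cmod z \<Longrightarrow> x \<in> {-1..0} \<Longrightarrow> norm (fund_solution q1 z x ** (m1 z - sg)) \<le> D1 * exp (- (\<bar>Im z\<bar> * \<bar>x\<bar>))"
    using weyl_solution_decay[OF q1 U1 \<xi>(1)] unfolding m1_def by metis
  obtain D2 S2 where D2: "D2 \<ge> 0" "S2 > 0"
    "\<And>z x. z \<in> grid \<xi> \<Longrightarrow> S2 \<le> cmod z \<Longrightarrow> x \<in> {0..1} \<Longrightarrow> norm (fund_solution q2 z x ** (m2 z + sg)) \<le> D2 * exp (- (\<bar>Im z\<bar> * \<bar>x\<bar>))"
    "\<And>z x. z \<in> grid \<xi> \<Longrightarrow> S2 \<le> cmod z \<Longrightarrow> x \<in> {-1..0} \<Longrightarrow> norm (fund_solution q2 z x ** (m2 z - sg)) \<le> D2 * exp (- (\<bar>Im z\<bar> * \<bar>x\<bar>))"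
    using weyl_solution_decay[OF q2 U2 \<xi>(2)] unfolding m2_def by metis
  define n where "n = norm (mat 1 :: complex^('r+'r)^('r+'r))"
  define L1 where "L1 = n * exp (potential_mass q1)"
  define L2 where "L2 = n * exp (potential_mass q2)"
  have L0: "L1 \<ge> 0" "L2 \<ge> 0" by (simp_all add: L1_def L2_def n_def)
  have L: "norm (fund_solution q1 z x) \<le> L1 * exp (\<bar>Im z\<bar> * \<bar>x\<bar>)" "norm (fund_solution q2 z x) \<le> L2 * exp (\<bar>Im z\<bar> * \<bar>x\<bar>)" if "x \<in> {-1..1}" for z x
    using fund_solution_growth[OF q1 that] fund_solution_growth[OF q2 that] by (simp_all add: L1_def L2_def n_def)
  have Yeq: "fund_solution q1 z x = fund_solution q2 z x" if x: "x \<in> {-1..1}" for z x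
  proof -
    define P where "P z = fund_solution q1 z x ** (sg ** adj (fund_solution q2 (cnj z) x) ** sg)" for z
    \<comment> \<open>the second factor of \<open>P z\<close> is the inverse of the fundamental solution for \<open>q2\<close>\<close>
    have bound: "2 * norm (P z) \<le> D1 * L2 + L1 * D2"
      if z: "z \<in> grid \<xi>" "max (max R1 R2) (max S1 S2) \<le> cmod z" for z
    proof -
      have z': "cnj z \<in> grid \<xi>" "max (max R1 R2) (max S1 S2) \<le> cmod (cnj z)" using z grid_cnj by auto
      have zA: "z \<notin> A" "cnj z \<notin> A" using C1(3)[OF z(1)] C1(3)[OF z'(1)] z(2) by (auto simp: A_def)
      define t where "t = \<bar>Im z\<bar> * \<bar>x\<bar>"
      have adjm: "adj (m2 (cnj z)) = - m1 z"
        using weyl_adj[OF q2 U2 nzA(2)[OF zA(1)] nzA(2)[OF zA(2)]] meq[OF zA(1)] by (simp add: m2_def)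
      \<comment> \<open>\<open>s\<close> is the sign of \<open>x\<close>; it selects the half of the Weyl solution that lives at \<open>x\<close>\<close>
      define s where "s = (if 0 \<le> x then 1 else -1 :: real)"
      define W1 where "W1 = m1 z + s *\<^sub>R sg"
      define W2 where "W2 = m2 (cnj z) + s *\<^sub>R sg"
      have aW2: "adj W2 = s *\<^sub>R sg - m1 z"
        by (simp add: W2_def adj_add adjm scaleR_cscale adj_cscale)
      have d1: "norm (fund_solution q1 z x ** W1) \<le> D1 * exp (- t)"
        using D1(3)[OF z(1), of x] D1(4)[OF z(1), of x] z(2) x by (auto simp: W1_def s_def t_def)
      have d2: "norm (fund_solution q2 (cnj z) x ** W2) \<le> D2 * exp (- t)"
        using D2(3)[OF z'(1), of x] D2(4)[OF z'(1), of x] z(2) x by (auto simp: W2_def s_def t_def)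
      define Y2 where "Y2 = adj (fund_solution q2 (cnj z) x)"
      have "(fund_solution q1 z x ** W1) ** Y2 + fund_solution q1 z x ** adj (fund_solution q2 (cnj z) x ** W2)
          = fund_solution q1 z x ** ((W1 + adj W2) ** Y2)"
        by (simp add: adj_mult Y2_def mm.add_left mm.add_right matrix_mul_assoc)
      also have "W1 + adj W2 = (2 * s) *\<^sub>R sg" by (simp add: W1_def aW2 scaleR_cscale vec_eq_iff)
      finally have "norm ((fund_solution q1 z x ** W1) ** Y2 + fund_solution q1 z x ** adj (fund_solution q2 (cnj z) x ** W2))
          = 2 * norm (fund_solution q1 z x ** (sg ** Y2))"
        by (simp add: mm.scaleR_left mm.scaleR_right s_def)
      also have "norm (fund_solution q1 z x ** (sg ** Y2)) = norm (P z)"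
        by (simp add: P_def Y2_def matrix_mul_assoc)
      finally have "2 * norm (P z) = norm ((fund_solution q1 z x ** W1) ** Y2 + fund_solution q1 z x ** adj (fund_solution q2 (cnj z) x ** W2))" by simp
      also have "\<dots> \<le> (D1 * exp (- t)) * (L2 * exp t) + (L1 * exp t) * (D2 * exp (- t))"
      proof (rule norm_triangle_mono)
        have "norm ((fund_solution q1 z x ** W1) ** Y2) \<le> norm (fund_solution q1 z x ** W1) * norm Y2" by (rule norm_matrix_mult_le)
        also have "\<dots> \<le> (D1 * exp (- t)) * (L2 * exp t)"
          by (rule mult_mono[OF d1]) (use L(2)[OF x, of "cnj z"] D1(1) in \<open>auto simp: Y2_def t_def\<close>)
        finally show "norm ((fund_solution q1 z x ** W1) ** Y2) \<le> (D1 * exp (- t)) * (L2 * exp t)" .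
        have "norm (fund_solution q1 z x ** adj (fund_solution q2 (cnj z) x ** W2)) \<le> norm (fund_solution q1 z x) * norm (adj (fund_solution q2 (cnj z) x ** W2))"
          by (rule norm_matrix_mult_le)
        also have "\<dots> \<le> (L1 * exp t) * (D2 * exp (- t))"
          by (rule mult_mono) (use L(1)[OF x, of z] d2 L0 in \<open>auto simp: t_def\<close>)
        finally show "norm (fund_solution q1 z x ** adj (fund_solution q2 (cnj z) x ** W2)) \<le> (L1 * exp t) * (D2 * exp (- t))" .
      qed
      also have "\<dots> = (D1 * L2 + L1 * D2) * (exp (- t) * exp t)" by (simp add: algebra_simps)
      also have "exp (- t) * exp t = 1" by (simp flip: exp_add)
      finally show ?thesis by simp
    qed
    have const: "\<exists>a. \<forall>z. P z $ i $ j = a" for i j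
    proof -
      have hol: "(\<lambda>z. P z $ i $ j) holomorphic_on UNIV"
        unfolding P_def
        by (rule holomorphic_matrix_mult[OF fund_solution_holomorphic[OF q1 x] fund_solution_inverse_holomorphic[OF q2 x]])
      have "cmod (P z $ i $ j) \<le> (D1 * L2 + L1 * D2) / 2"
        if z: "z \<in> grid \<xi>" "max (max R1 R2) (max S1 S2) \<le> cmod z" for z
      proof -
        have "cmod (P z $ i $ j) \<le> norm (P z)" by (meson Finite_Cartesian_Product.norm_nth_le order_trans)
        then show ?thesis using bound[OF z] by simp
      qed
      from entire_bounded_on_grid_constant[OF hol this] show ?thesis by metis
    qed
    then have const': "P z = P w" for z w by (simp add: vec_eq_iff) metis
    have "norm (P z - mat 1) \<le> e" if e: "e > 0" for e
    proof -
      define e' where "e' = e / (2 * (L2 + 1))"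
      have e': "e' > 0" using e L0 by (simp add: e'_def)
      obtain T1 where T1: "\<And>z. cmod z \<ge> T1 \<Longrightarrow> norm (fund_solution q1 z x - free_solution z x) \<le> e' * exp (\<bar>Im z\<bar> * \<bar>x\<bar>)"
        using fund_solution_asymptotics[OF q1 x e'] by metis
      obtain T2 where T2: "\<And>z. cmod z \<ge> T2 \<Longrightarrow> norm (fund_solution q2 z x - free_solution z x) \<le> e' * exp (\<bar>Im z\<bar> * \<bar>x\<bar>)"
        using fund_solution_asymptotics[OF q2 x e'] by metis
      define w where "w = complex_of_real (max 0 (max T1 T2))"
      have w: "cmod w \<ge> T1" "cmod w \<ge> T2" "Im w = 0" "cnj w = w" by (auto simp: w_def)
      have "fund_solution q1 w x - fund_solution q2 w x = (fund_solution q1 w x - free_solution w x) - (fund_solution q2 w x - free_solution w x)" by simp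
      then have d: "norm (fund_solution q1 w x - fund_solution q2 w x) \<le> e' + e'"
        using T1[OF w(1)] T2[OF w(2)] w(3) norm_triangle_ineq4[of "fund_solution q1 w x - free_solution w x" "fund_solution q2 w x - free_solution w x"] by simp
      have "P w - mat 1 = (fund_solution q1 w x - fund_solution q2 w x) ** (sg ** adj (fund_solution q2 (cnj w) x) ** sg)"
        by (simp add: P_def mm.diff_left fund_solution_inverse(2)[OF q2 x])
      then have "norm (P w - mat 1) \<le> norm (fund_solution q1 w x - fund_solution q2 w x) * norm (sg ** adj (fund_solution q2 (cnj w) x) ** sg)"
        using norm_matrix_mult_le by metis
      also have "\<dots> \<le> (e' + e') * L2"
        using d L(2)[OF x, of w] w e' by (intro mult_mono) auto
      also have "\<dots> \<le> e"
      proof -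
        have "(e' + e') * L2 \<le> (e' + e') * (L2 + 1)" using e' by (intro mult_left_mono) auto
        also have "\<dots> = e' * (2 * (L2 + 1))" by (simp only: distrib_right mult_2 distrib_left)
        also have "\<dots> = e" using L0(2) by (simp add: e'_def)
        finally show ?thesis .
      qed
      finally show ?thesis using const'[of z w] by simp
    qed
    then have "norm (P z - mat 1) \<le> 0" by - (rule field_le_epsilon, simp)
    then have "P z = mat 1" by simp
    then have "P z ** fund_solution q2 z x = fund_solution q2 z x" by (simp only: matrix_mul_lid)
    moreover have "P z ** fund_solution q2 z x = fund_solution q1 z x"
      unfolding P_def matrix_mul_assoc[symmetric, of "fund_solution q1 z x"] fund_solution_inverse(1)[OF q2 x] by simp
    ultimately show ?thesis by simp
  qed
  show "AE x in leb_I. q1 x = q2 x"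
  proof -
    have "ac_deriv (fund_solution q1 0) (\<lambda>x. dirac_coeff q2 0 x ** fund_solution q2 0 x)"
      by (rule ac_deriv_cong[OF fund_solution_ac_deriv(1)[OF q2, of 0]]) (simp_all add: Yeq)
    from ac_deriv_unique[OF fund_solution_ac_deriv(1)[OF q1, of 0] this]
    have ae: "AE x in leb_I. dirac_coeff q1 0 x ** fund_solution q1 0 x = dirac_coeff q2 0 x ** fund_solution q2 0 x" .
    have "AE x in leb_I. x \<in> {-1<..<1}" by (rule AE_I2) auto
    with ae show ?thesis
    proof eventually_elim
      case (elim x)
      then have x: "x \<in> {-1..1}" by auto
      define V where "V = sg ** adj (fund_solution q2 (cnj 0) x) ** sg"
      have "(dirac_coeff q1 0 x ** fund_solution q2 0 x) ** V = (dirac_coeff q2 0 x ** fund_solution q2 0 x) ** V"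
        using elim(1) Yeq[OF x, of 0] by simp
      then have "dirac_coeff q1 0 x ** (fund_solution q2 0 x ** V) = dirac_coeff q2 0 x ** (fund_solution q2 0 x ** V)" by (simp only: matrix_mul_assoc)
      then have "dirac_coeff q1 0 x = dirac_coeff q2 0 x"
        unfolding V_def fund_solution_inverse(2)[OF q2 x] by simp
      then show ?case by (simp add: dirac_coeff_def potential_def potential_lin_eq_iff)
    qed
  qed
  show "U1 = U2"
  proof -
    define z where "z = \<i>"
    have zA: "z \<notin> A" "cnj z \<notin> A" using Areal[of z] Areal[of "cnj z"] by (auto simp: z_def)
    note k1 = boundary_trace[OF q1 U1 \<xi>(1) nzA(1)[OF zA(1)] nzA(1)[OF zA(2)]]
    note k2 = boundary_trace[OF q2 U2 \<xi>(2) nzA(2)[OF zA(1)] nzA(2)[OF zA(2)]]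
    have Y: "fund_solution q1 z 1 = fund_solution q2 z 1" "fund_solution q1 z (-1) = fund_solution q2 z (-1)" by (rule Yeq; simp)+
    have m: "weyl q1 U1 z = weyl q2 U2 z" using meq[OF zA(1)] by (simp add: m1_def m2_def)
    have keq: "boundary_trace q1 U1 z = boundary_trace q2 U2 z" by (simp only: boundary_trace_def Y m)
    have "- (U1 ** boundary_trace q1 U1 z) = - (U2 ** boundary_trace q2 U2 z)" unfolding k1(1)[symmetric] k2(1)[symmetric] by (simp only: Y m)
    then have Uk: "U1 ** boundary_trace q1 U1 z = U2 ** boundary_trace q1 U1 z" by (simp add: keq)
    define E where "E = cscale (- (1/2)) (adj (char_mat q1 U1 (cnj z)) ** U1)"
    have "E ** boundary_trace q1 U1 z = cscale (- (1/2)) (adj (char_mat q1 U1 (cnj z)) ** (U1 ** boundary_trace q1 U1 z))"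
      by (simp add: E_def cscale_mult_left matrix_mul_assoc)
    also have "\<dots> = mat 1" unfolding k1(4) by simp
    finally have "boundary_trace q1 U1 z ** E = mat 1" by (simp add: matrix_left_right_inverse)
    then show ?thesis using Uk by (metis matrix_mul_assoc matrix_mul_rid)
  qed
qed

theorem theorem3p2:
  fixes p :: real
  assumes "1 \<le> p"
  shows "bij_betw
    (\<lambda>(q :: (real \<Rightarrow> complex^'r::finite^'r) set, U). spectral_data q U)
    (Q_space p \<times> unitaries) (spectral_data_set p)"
proof -
  let ?f = "\<lambda>(q :: (real \<Rightarrow> complex^'r::finite^'r) set, U). spectral_data q U"
  have "inj_on ?f (Q_space p \<times> unitaries)"
  proof (rule inj_onI)
    fix a b :: "(real \<Rightarrow> complex^'r^'r) set \<times> (complex^('r + 'r)^('r + 'r))"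
    assume a: "a \<in> Q_space p \<times> unitaries" and b: "b \<in> Q_space p \<times> unitaries" and eq: "?f a = ?f b"
    obtain q1 U1 where 1: "a = (ae_rel p `` {q1}, U1)" "q1 \<in> Lp_fun p" "U1 \<in> unitaries"
      using a by (auto simp: Q_space_def elim!: quotientE)
    obtain q2 U2 where 2: "b = (ae_rel p `` {q2}, U2)" "q2 \<in> Lp_fun p" "U2 \<in> unitaries"
      using b by (auto simp: Q_space_def elim!: quotientE)
    have sd: "spectral_data_fun q1 U1 = spectral_data_fun q2 U2"
      using eq 1 2 by (simp add: spectral_data_class)
    note d = spectral_data_determine[OF Lp_fun_imp_integrable[OF assms 1(2)] Lp_fun_imp_integrable[OF assms 2(2)] 1(3) 2(3) sd]
    have "(q1, q2) \<in> ae_rel p" using 1 2 d(1) by (simp add: ae_rel_def)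
    then have "ae_rel p `` {q1} = ae_rel p `` {q2}" by (rule equiv_class_eq[OF equiv_ae_rel])
    then show "a = b" using 1 2 d(2) by simp
  qed
  moreover have "?f ` (Q_space p \<times> unitaries) = spectral_data_set p"
    by (auto simp: spectral_data_set_def image_iff)
  ultimately show ?thesis by (simp add: bij_betw_def)
qed

end
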